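(* Let $\gamma>0$ and let $K$ be a measurable function on $\mathbb{R}^{d+2}$, written $K(t,s,x)$ with $t,s\in\mathbb{R}$, $x\in\mathbb{R}^d$, such that $K(t,s,\cdot)$ is integrable on $\mathbb{R}^d$ for each $s<t$. Suppose that $K$ satisfies Assumption A and Assumption B (both stated in the context), and let $p\in[2,\infty)$. Then there is a constant $N$, depending only on $d$, $p$ and the constants in the assumptions (that is, $\gamma$, the function $\varphi$, and $\sup_\xi\int_0^\infty H(t,\xi)\,dt$), such that for every $f\in C_c^\infty(\mathbb{R}^{d+1})$ $$\|\mathcal{G}f\|_{BMO(\mathbb{R}^{d+1})}\le N\|f\|_{L_\infty(\mathbb{R}^{d+1})}$$ and $$\|\mathcal{G}f\|_{L_p(\mathbb{R}^{d+1})}\le N\|f\|_{L_p(\mathbb{R}^{d+1})}.$$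
   Context: Points of $\mathbb{R}^{d+1}$ are written $(t,x)$, $t\in\mathbb{R}$, $x\in\mathbb{R}^d$. $B_c(x_0)=\{y\in\mathbb{R}^d:|y-x_0|<c\}$ and $Q_c(t_0,x_0)=(t_0-c^\gamma,t_0+c^\gamma)\times B_c(x_0)$. For a locally integrable $h$ on $\mathbb{R}^{d+1}$, $$\|h\|_{BMO(\mathbb{R}^{d+1})}=\sup_Q\frac1{|Q|}\int_Q|h(r,z)-h_Q|\,dr\,dz,\qquad h_Q=\frac1{|Q|}\int_Q h(r,z)\,dr\,dz,$$ where the supremum is over all $Q=Q_c(t_0,x_0)$ with $c>0$, $(t_0,x_0)\in\mathbb{R}^{d+1}$. The Fourier transform on $\mathbb{R}^d$ is $\mathcal{F}(g)(\xi)=\int_{\mathbb{R}^d}e^{-ix\cdot\xi}g(x)\,dx$, and $\hat K(t,s,\xi)=\mathcal{F}(K(t,s,\cdot))(\xi)$. Assumption A. There is a measurable function $H$ on $\mathbb{R}^{d+1}$ such that $|\hat K(t,s,\xi)|\le H(t-s,\xi)$ for all $t>s$ and $\xi\in\mathbb{R}^d$, and $\sup_{\xi}\int_0^\infty H(t,\xi)\,dt<\infty$. Assumption B. There is a nondecreasing function $\varphi:(0,\infty)\to[0,\infty)$ such that (i) for all $s>r$ and $c>0$: $\int_r^s\int_{|z|\ge c}|K(s,\tau,z)|\,dz\,d\tau\le\varphi((s-r)c^{-\gamma})$; (ii) for all $s>r>a$: $\int_{-\infty}^a\int_{\mathbb{R}^d}|K(s,\tau,z)-K(r,\tau,z)|\,dz\,d\tau\le\varphi((s-r)(r-a)^{-1})$;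 (iii) for all $s>a$ and $h\in\mathbb{R}^d$ (nothing being required for $h=0$, where the left side vanishes): $\int_{-\infty}^a\int_{\mathbb{R}^d}|K(s,\tau,z+h)-K(s,\tau,z)|\,dz\,d\tau\le\varphi(|h|(s-a)^{-1/\gamma})$. For $f\in C_c^\infty(\mathbb{R}^{d+1})$, $\mathcal{G}f(t,x)=\int_{-\infty}^t\big(K(t,s,\cdot)*f(s,\cdot)\big)(x)\,ds$, where $*$ is convolution on $\mathbb{R}^d$. *)

theory Defs
  imports "HOL-Analysis.Analysis" "HOL-Probability.Essential_Supremum"
begin

text \<open>
  Points of the space-time are pairs \<open>(t, x) :: real \<times> (real ^ 'n)\<close>, so that \<open>d = CARD('n)\<close>.
  Measurability and integrals are those of Lebesgue measure; kernels and functions are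
  complex-valued, which includes the real-valued case.
\<close>

subsection \<open>Test functions\<close>

primrec Ck :: "nat \<Rightarrow> ('a::real_normed_vector \<Rightarrow> 'b::real_normed_vector) \<Rightarrow> bool" where
  "Ck 0 f \<longleftrightarrow> continuous_on UNIV f"
| "Ck (Suc k) f \<longleftrightarrow>
     (\<forall>x. f differentiable (at x)) \<and> (\<forall>v. Ck k (\<lambda>x. frechet_derivative f (at x) v))"

definition test_functions :: "('a::real_normed_vector \<Rightarrow> 'b::real_normed_vector) set" where
  "test_functions = {f. (\<forall>k. Ck k f) \<and> compact (closure (support_on UNIV f))}"

subsection \<open>Norms\<close>

text \<open>As for \<^const>\<open>esssup\<close>, norms are infinite outside their natural domain: non-measurable
  functions for \<open>L\<^sub>p\<close>, functions that are not locally integrable for BMO. In particular, a finite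
  bound includes measurability, respectively local integrability.\<close>

definition Linf_norm :: "('a::euclidean_space \<Rightarrow> complex) \<Rightarrow> ennreal" where
  "Linf_norm f = esssup lebesgue (\<lambda>x. ennreal (norm (f x)))"

definition Lp_norm :: "real \<Rightarrow> ('a::euclidean_space \<Rightarrow> complex) \<Rightarrow> ennreal" where
  "Lp_norm p f =
     (let I = \<integral>\<^sup>+ x. ennreal (norm (f x) powr p) \<partial>lebesgue
      in if f \<in> borel_measurable lebesgue \<and> I < \<infinity> then ennreal (enn2real I powr (1 / p)) else \<infinity>)"

definition locally_integrable :: "('a::euclidean_space \<Rightarrow> complex) \<Rightarrow> bool" where
  "locally_integrable h \<longleftrightarrow> (\<forall>C. compact C \<longrightarrow> set_integrable lebesgue C h)"

definition cylinder :: "real \<Rightarrow> real \<Rightarrow> real \<Rightarrow> real ^ 'n \<Rightarrow> (real \<times> (real ^ 'n)) set" where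
  "cylinder \<gamma> c t\<^sub>0 x\<^sub>0 = {t\<^sub>0 - c powr \<gamma> <..< t\<^sub>0 + c powr \<gamma>} \<times> ball x\<^sub>0 c"

definition mean :: "'a::euclidean_space set \<Rightarrow> ('a \<Rightarrow> complex) \<Rightarrow> complex" where
  "mean Q h = (LINT z:Q|lebesgue. h z) /\<^sub>R measure lebesgue Q"

definition mean_oscillation :: "'a::euclidean_space set \<Rightarrow> ('a \<Rightarrow> complex) \<Rightarrow> ennreal" where
  "mean_oscillation Q h =
     (\<integral>\<^sup>+ z\<in>Q. ennreal (norm (h z - mean Q h)) \<partial>lebesgue) / emeasure lebesgue Q"

definition BMO_norm :: "real \<Rightarrow> (real \<times> (real ^ 'n) \<Rightarrow> complex) \<Rightarrow> ennreal" where
  "BMO_norm \<gamma> h =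
     (if locally_integrable h
      then SUP (c, t\<^sub>0, x\<^sub>0) \<in> {0<..} \<times> UNIV \<times> UNIV. mean_oscillation (cylinder \<gamma> c t\<^sub>0 x\<^sub>0) h
      else \<infinity>)"

subsection \<open>The kernel and its operator\<close>

definition fourier :: "(real ^ 'n \<Rightarrow> complex) \<Rightarrow> real ^ 'n \<Rightarrow> complex" where
  "fourier g \<xi> = (LINT x|lebesgue. exp (- \<i> * complex_of_real (x \<bullet> \<xi>)) * g x)"

definition space_convolution ::
    "(real ^ 'n \<Rightarrow> complex) \<Rightarrow> (real ^ 'n \<Rightarrow> complex) \<Rightarrow> real ^ 'n \<Rightarrow> complex" where
  "space_convolution g h x = (LINT y|lebesgue. g (x - y) * h y)"

definition admissible_kernel :: "(real \<Rightarrow> real \<Rightarrow> real ^ 'n \<Rightarrow> complex) \<Rightarrow> bool" where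
  "admissible_kernel K \<longleftrightarrow>
     (\<lambda>(t, s, x). K t s x) \<in> borel_measurable lebesgue \<and>
     (\<forall>t s. s < t \<longrightarrow> integrable lebesgue (K t s))"

definition kernel_operator ::
    "(real \<Rightarrow> real \<Rightarrow> real ^ 'n \<Rightarrow> complex) \<Rightarrow> (real \<times> (real ^ 'n) \<Rightarrow> complex)
       \<Rightarrow> real \<times> (real ^ 'n) \<Rightarrow> complex" where
  "kernel_operator K f =
     (\<lambda>(t, x). LINT s:{..<t}|lebesgue. space_convolution (K t s) (\<lambda>y. f (s, y)) x)"

definition fourier_majorant ::
    "(real \<Rightarrow> real ^ 'n \<Rightarrow> real) \<Rightarrow> (real \<Rightarrow> real \<Rightarrow> real ^ 'n \<Rightarrow> complex) \<Rightarrow> bool" where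
  "fourier_majorant H K \<longleftrightarrow>
     (\<lambda>(t, \<xi>). H t \<xi>) \<in> borel_measurable lebesgue \<and>
     (\<forall>t s \<xi>. s < t \<longrightarrow> norm (fourier (K t s) \<xi>) \<le> H (t - s) \<xi>)"

text \<open>A majorant \<open>H\<close> is nonnegative at positive times, so \<^const>\<open>ennreal\<close> does not truncate it here.\<close>

definition majorant_bound :: "(real \<Rightarrow> real ^ 'n \<Rightarrow> real) \<Rightarrow> ennreal" where
  "majorant_bound H = (SUP \<xi>. \<integral>\<^sup>+ t\<in>{0<..}. ennreal (H t \<xi>) \<partial>lebesgue)"

definition kernel_estimates ::
    "real \<Rightarrow> (real \<Rightarrow> real) \<Rightarrow> (real \<Rightarrow> real \<Rightarrow> real ^ 'n \<Rightarrow> complex) \<Rightarrow> bool" where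
  "kernel_estimates \<gamma> \<phi> K \<longleftrightarrow>
     mono_on {0<..} \<phi> \<and> (\<forall>u>0. 0 \<le> \<phi> u) \<and>
     (\<forall>s r c. r < s \<and> 0 < c \<longrightarrow>
        (\<integral>\<^sup>+ \<tau>\<in>{r<..<s}. (\<integral>\<^sup>+ z\<in>{z. c \<le> norm z}. ennreal (norm (K s \<tau> z)) \<partial>lebesgue) \<partial>lebesgue)
          \<le> ennreal (\<phi> ((s - r) * c powr (- \<gamma>)))) \<and>
     (\<forall>s r a. a < r \<and> r < s \<longrightarrow>
        (\<integral>\<^sup>+ \<tau>\<in>{..<a}. (\<integral>\<^sup>+ z. ennreal (norm (K s \<tau> z - K r \<tau> z)) \<partial>lebesgue) \<partial>lebesgue)
          \<le> ennreal (\<phi> ((s - r) / (r - a)))) \<and>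
     (\<forall>s a h. a < s \<and> h \<noteq> 0 \<longrightarrow>
        (\<integral>\<^sup>+ \<tau>\<in>{..<a}. (\<integral>\<^sup>+ z. ennreal (norm (K s \<tau> (z + h) - K s \<tau> z)) \<partial>lebesgue) \<partial>lebesgue)
          \<le> ennreal (\<phi> (norm h * (s - a) powr (- 1 / \<gamma>))))"

end

(*
  Plancherel's identity and Young's inequality in time bound the operator on square-integrable inputs
  by sup_xi int H. For a bounded input f and a cylinder Q, cut f smoothly in space and sharply in time
  around Q: the near part is controlled by the L2 bound, the oscillation on Q of the far part by the
  three kernel estimates. This is the BMO bound.

  For p > 2, cut f at height eps * lambda. The large part is handled by the L2 bound, the small part by
  the BMO bound, and comparing averages over stopping-time boxes of an anisotropic dyadic grid gives
  |E(L lambda)| <= theta |E(lambda)| + C lambda^-2 int_{|f| > eps lambda} |f|^2 for the sets E(lambda)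
  where some average of |Gf| exceeds lambda. Integrating against lambda^(p-1) and absorbing gives the
  Lp bound. Since the sharply cut f is not smooth, this is done for G applied to a Gaussian mollification
  in space, which is then removed by Fatou's lemma.
*)

theory Submission
  imports Defs "HOL-Probability.Probability"
begin

section \<open>Plane waves and Gaussians\<close>

text \<open>The assumptions leave \<open>K t s z\<close> possibly non-integrable jointly in s and z,
  so the time integral defining the operator is made to converge on the Fourier side: there
  \<open>H\<close> has integrable time sections, and it suffices that the spatial transforms of all
  slices of the input share one integrable majorant. A sharp cut in time and multiplication by a
  function with integrable transform keep such a majorant; a cut in height in general does not. Of
  Plancherel's identity only the upper bound is proved. It is used twice, because at a fixed time
  the operator is, up to the factor (2 pi)^d, again the Fourier transform of an integrable symbol,
  taken at the reflected point. A Borel version of a Lebesgue measurable kernel agrees with it only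
  for almost every time. Estimates at fixed times therefore hold off a null set \<open>N\<close>,
  and the oscillation on a cylinder is measured against a reference time chosen outside
  \<open>N\<close>. It is measured from an arbitrary constant instead of the mean, so that one bound
  on cylinders serves both the BMO norm and the grid boxes inside them.\<close>

definition wave :: "'a::real_inner \<Rightarrow> 'a \<Rightarrow> complex" where
  "wave x \<xi> = exp (\<i> * complex_of_real (x \<bullet> \<xi>))"

lemma norm_wave [simp]: "norm (wave x \<xi>) = 1"
  by (simp add: wave_def)

lemma wave_commute: "wave x \<xi> = wave \<xi> x"
  by (simp add: wave_def inner_commute)

lemma wave_zero [simp]: "wave 0 \<xi> = 1" "wave x 0 = 1"
  by (simp_all add: wave_def)

lemma wave_add_left: "wave (x + y) \<xi> = wave x \<xi> * wave y \<xi>"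
  by (simp add: wave_def inner_add_left exp_add[symmetric] ring_distribs)

lemma wave_add_right: "wave x (\<xi> + \<zeta>) = wave x \<xi> * wave x \<zeta>"
  by (simp add: wave_def inner_add_right exp_add[symmetric] ring_distribs)

lemma wave_minus: "wave (- x) \<xi> = cnj (wave x \<xi>)" "wave x (- \<xi>) = cnj (wave x \<xi>)"
  by (simp_all add: wave_def exp_cnj)

lemma wave_mult_cnj [simp]: "wave x \<xi> * cnj (wave x \<xi>) = 1" "cnj (wave x \<xi>) * wave x \<xi> = 1"
  using complex_norm_square[of "wave x \<xi>"] by (simp_all add: mult.commute)

lemma borel_measurable_cnj [measurable]:
  "f \<in> borel_measurable M \<Longrightarrow> (\<lambda>x. cnj (f x)) \<in> borel_measurable M"
  by (rule measurable_compose[OF _ borel_measurable_continuous_onI]) (auto intro: continuous_intros)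

lemma continuous_on_wave [continuous_intros]:
  "continuous_on S f \<Longrightarrow> continuous_on S g \<Longrightarrow> continuous_on S (\<lambda>x. wave (f x) (g x))"
  unfolding wave_def by (intro continuous_intros)

lemma borel_measurable_wave [measurable]:
  fixes f g :: "'b \<Rightarrow> 'a::euclidean_space"
  shows "f \<in> borel_measurable M \<Longrightarrow> g \<in> borel_measurable M
    \<Longrightarrow> (\<lambda>x. wave (f x) (g x)) \<in> borel_measurable M"
  unfolding wave_def by measurable

text \<open>The analysis is done with \<open>lborel\<close>; for a Borel integrand the completed
  measure of the definitions gives the same integral.\<close>

lemma fourier_eq:
  assumes "g \<in> borel_measurable borel"
  shows "fourier g \<xi> = (LINT x|lborel. cnj (wave x \<xi>) * g x)"
proof -
  have "fourier g \<xi> = (LINT x|lebesgue. cnj (wave x \<xi>) * g x)"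
    by (simp add: fourier_def wave_def exp_cnj)
  also have "\<dots> = (LINT x|lborel. cnj (wave x \<xi>) * g x)"
    using assms by (intro integral_completion) simp
  finally show ?thesis .
qed

text \<open>The shape of the oscillatory double integrals below: absolute integrability comes from
  the two tensor factors alone, so the bounded factor \<open>E\<close>, usually a product of plane
  waves, may mix the variables in any measurable way.\<close>

lemma integrable_tensor:
  fixes f :: "'a::euclidean_space \<Rightarrow> complex" and g :: "'b::euclidean_space \<Rightarrow> complex"
  assumes f: "integrable lborel f" and g: "integrable lborel g"
    and E: "(\<lambda>(x, y). E x y) \<in> borel_measurable (borel \<Otimes>\<^sub>M borel)"
    and B: "\<And>x y. norm (E x y) \<le> B"
  shows "integrable (lborel \<Otimes>\<^sub>M lborel) (\<lambda>(x, y). f x * g y * E x y)"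
proof -
  have [measurable]: "f \<in> borel_measurable borel" "g \<in> borel_measurable borel"
    using borel_measurable_integrable[OF f] borel_measurable_integrable[OF g] by auto
  have [measurable]: "case_prod E \<in> borel_measurable (lborel \<Otimes>\<^sub>M lborel)"
    using E by (simp add: measurable_lborel1 cong: measurable_cong_sets)
  have "integrable (lborel \<Otimes>\<^sub>M lborel) (\<lambda>z. norm (f (fst z)) * norm (g (snd z)))"
  proof (rule lborel_pair.Fubini_integrable)
    show "integrable lborel (\<lambda>x. LINT y|lborel. norm (norm (f (fst (x, y))) * norm (g (snd (x, y)))))"
      using f by (auto simp: norm_mult)
    show "AE x in lborel. integrable lborel (\<lambda>y. norm (f (fst (x, y))) * norm (g (snd (x, y))))"
      using g by auto
  qed measurable
  then have I: "integrable (lborel \<Otimes>\<^sub>M lborel) (\<lambda>z. norm (f (fst z)) * norm (g (snd z)) * B)"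
    by (rule integrable_mult_left)
  have "\<And>x y. norm (f x) * norm (g y) * norm (E x y) \<le> norm (f x) * norm (g y) * \<bar>B\<bar>"
    by (intro mult_left_mono order.trans[OF B] abs_ge_self) simp
  then show ?thesis
    by (intro Bochner_Integration.integrable_bound[OF I])
      (auto simp: norm_mult abs_mult split: prod.splits)
qed

section \<open>Products of one-dimensional functions and the Fourier transform of a Gaussian\<close>

lemma product_sigma_finite_lborel: "product_sigma_finite (\<lambda>_. lborel :: real measure)"
  by unfold_locales

lemma
  fixes f :: "'a::euclidean_space \<Rightarrow> real \<Rightarrow> complex"
  assumes f: "\<And>b. b \<in> Basis \<Longrightarrow> integrable lborel (f b)"
  shows integrable_lborel_prod: "integrable lborel (\<lambda>x::'a. \<Prod>b\<in>Basis. f b (x \<bullet> b))"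
    and integral_lborel_prod:
      "(LINT x|lborel. (\<Prod>b\<in>Basis. f b (x \<bullet> b))) = (\<Prod>b\<in>Basis. (LINT t|lborel. f b t))"
proof -
  interpret product_sigma_finite "\<lambda>_. lborel :: real measure"
    by (rule product_sigma_finite_lborel)
  have m: "\<And>b. b \<in> Basis \<Longrightarrow> f b \<in> borel_measurable borel"
    using borel_measurable_integrable[OF f] by auto
  have T: "(\<lambda>g. \<Sum>b\<in>Basis. g b *\<^sub>R b) \<in> measurable (\<Pi>\<^sub>M b\<in>(Basis::'a set). lborel) borel"
    by measurable
  have F: "(\<lambda>x::'a. \<Prod>b\<in>Basis. f b (x \<bullet> b)) \<in> borel_measurable borel"
    by (intro borel_measurable_prod measurable_compose[OF _ m]) auto
  have eq: "(\<Prod>b\<in>Basis. f b ((\<Sum>c\<in>Basis. g c *\<^sub>R c) \<bullet> b)) = (\<Prod>b\<in>Basis. f b (g b))" for g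
    by (intro prod.cong refl) simp
  show "integrable lborel (\<lambda>x::'a. \<Prod>b\<in>Basis. f b (x \<bullet> b))"
    using product_integrable_prod[OF finite_Basis f]
    by (subst lborel_eq, subst integrable_distr_eq[OF T F]) (simp add: eq)
  show "(LINT x|lborel. (\<Prod>b\<in>Basis. f b (x \<bullet> b))) = (\<Prod>b\<in>Basis. (LINT t|lborel. f b t))"
    using product_integral_prod[OF finite_Basis f]
    by (subst lborel_eq, subst integral_distr[OF T F]) (simp add: eq)
qed

definition gauss :: "real \<Rightarrow> 'a::real_normed_vector \<Rightarrow> real" where
  "gauss \<sigma> \<xi> = exp (- (\<sigma> * norm \<xi>)\<^sup>2 / 2)"

lemma gauss_pos: "0 < gauss \<sigma> \<xi>" and gauss_le_1: "gauss \<sigma> \<xi> \<le> 1"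
  and gauss_zero [simp]: "gauss \<sigma> 0 = 1" and gauss_minus: "gauss \<sigma> (- \<xi>) = gauss \<sigma> \<xi>"
  by (simp_all add: gauss_def)

lemma borel_measurable_gauss [measurable]:
  "f \<in> borel_measurable M \<Longrightarrow> (\<lambda>x. gauss \<sigma> (f x :: 'a::euclidean_space)) \<in> borel_measurable M"
  unfolding gauss_def
  by (rule measurable_compose[OF _ borel_measurable_continuous_onI]) (auto intro!: continuous_intros)

lemma gauss_prod:
  "gauss \<sigma> (x::'a::euclidean_space) = (\<Prod>b\<in>Basis. gauss \<sigma> (x \<bullet> b))"
proof -
  have "(norm x)\<^sup>2 = (\<Sum>b\<in>Basis. (x \<bullet> b)\<^sup>2)"
    unfolding power2_norm_eq_inner by (subst euclidean_inner) (simp add: power2_eq_square)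
  then show ?thesis
    by (simp add: gauss_def exp_sum[symmetric] power_mult_distrib sum_divide_distrib sum_distrib_left sum_negf)
qed

lemma wave_prod:
  "wave x (\<xi>::'a::euclidean_space) = (\<Prod>b\<in>Basis. wave (x \<bullet> b) (\<xi> \<bullet> b))"
  by (simp add: wave_def exp_sum[symmetric] euclidean_inner[of x \<xi>] sum_distrib_left)

text \<open>Rescaling by \<open>1 / \<sigma>\<close> turns the Gaussian into a multiple of the
  standard normal density, so the integral is the characteristic function of the normal
  distribution.\<close>

lemma gauss_transform_1:
  fixes x :: real
  assumes "\<sigma> > 0"
  shows "integrable lborel (\<lambda>t. wave x t * complex_of_real (gauss \<sigma> t))"
    and "(LINT t|lborel. wave x t * complex_of_real (gauss \<sigma> t))
      = complex_of_real (sqrt (2 * pi) / \<sigma> * gauss (1 / \<sigma>) x)"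
proof -
  define F where "F t = wave x t * complex_of_real (gauss \<sigma> t)" for t
  have eq: "F (0 + (1 / \<sigma>) * t) = complex_of_real (sqrt (2 * pi)) * (std_normal_density t *\<^sub>R iexp (x / \<sigma> * t))" for t
    using assms by (simp add: F_def wave_def gauss_def std_normal_density_def scaleR_conv_of_real mult_ac)
  have "char std_normal_distribution (x / \<sigma>) = (LINT t|lborel. std_normal_density t *\<^sub>R iexp (x / \<sigma> * t))"
    unfolding char_def by (subst integral_density) auto
  then have c: "(LINT t|lborel. std_normal_density t *\<^sub>R iexp (x / \<sigma> * t)) = complex_of_real (gauss (1 / \<sigma>) x)"
    by (simp add: char_std_normal_distribution gauss_def power_divide power_mult_distrib)
  have "integrable lborel std_normal_density"
    by (rule integrable_normal_density) simp
  then have "integrable lborel (\<lambda>t. std_normal_density t *\<^sub>R iexp (x / \<sigma> * t))"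
    by (rule Bochner_Integration.integrable_bound) (auto simp: abs_mult)
  then have "integrable lborel (\<lambda>t. F (0 + (1 / \<sigma>) * t))"
    unfolding eq by (rule integrable_mult_right)
  then have "integrable lborel F"
    using assms by (subst (asm) lborel_integrable_real_affine_iff) auto
  then show "integrable lborel (\<lambda>t. wave x t * complex_of_real (gauss \<sigma> t))"
    unfolding F_def[abs_def] .
  have "integral\<^sup>L lborel F = \<bar>1 / \<sigma>\<bar> *\<^sub>R (LINT t|lborel. F (0 + (1 / \<sigma>) * t))"
    using assms by (intro lborel_integral_real_affine) auto
  also have "\<dots> = complex_of_real (sqrt (2 * pi) / \<sigma> * gauss (1 / \<sigma>) x)"
    unfolding eq using assms c by (simp add: scaleR_conv_of_real)
  finally show "(LINT t|lborel. wave x t * complex_of_real (gauss \<sigma> t))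
      = complex_of_real (sqrt (2 * pi) / \<sigma> * gauss (1 / \<sigma>) x)"
    unfolding F_def[abs_def] .
qed

lemma gauss_transform:
  fixes x :: "'a::euclidean_space"
  assumes "\<sigma> > 0"
  shows "integrable lborel (\<lambda>\<xi>. wave x \<xi> * complex_of_real (gauss \<sigma> \<xi>))"
    and "(LINT \<xi>|lborel. wave x \<xi> * complex_of_real (gauss \<sigma> \<xi>))
      = complex_of_real ((sqrt (2 * pi) / \<sigma>) ^ DIM('a) * gauss (1 / \<sigma>) x)"
proof -
  let ?f = "\<lambda>b t. wave (x \<bullet> b) t * complex_of_real (gauss \<sigma> t)"
  have eq: "wave x \<xi> * complex_of_real (gauss \<sigma> \<xi>) = (\<Prod>b\<in>Basis. ?f b (\<xi> \<bullet> b))" for \<xi>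
    by (simp add: wave_prod[of x] gauss_prod[of \<sigma> \<xi>] prod.distrib)
  show "integrable lborel (\<lambda>\<xi>. wave x \<xi> * complex_of_real (gauss \<sigma> \<xi>))"
    unfolding eq by (intro integrable_lborel_prod gauss_transform_1 assms)
  have "(LINT \<xi>|lborel. wave x \<xi> * complex_of_real (gauss \<sigma> \<xi>))
      = (\<Prod>b\<in>Basis. complex_of_real (sqrt (2 * pi) / \<sigma> * gauss (1 / \<sigma>) (x \<bullet> b)))"
    unfolding eq by (subst integral_lborel_prod) (auto intro: gauss_transform_1 simp: gauss_transform_1 assms)
  also have "\<dots> = complex_of_real ((sqrt (2 * pi) / \<sigma>) ^ DIM('a) * gauss (1 / \<sigma>) x)"
    by (simp only: gauss_prod[of _ x] prod.distrib prod_constant of_real_prod[symmetric])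
  finally show "(LINT \<xi>|lborel. wave x \<xi> * complex_of_real (gauss \<sigma> \<xi>))
      = complex_of_real ((sqrt (2 * pi) / \<sigma>) ^ DIM('a) * gauss (1 / \<sigma>) x)" .
qed

section \<open>Reflections, translations and dilations of integrals\<close>

lemma lborel_distr_diff: "distr lborel borel (\<lambda>y. x - y) = (lborel :: 'a::euclidean_space measure)"
  using lborel_affine[of "-1" x] by (simp add: density_1)

lemma nn_integral_lborel_diff:
  fixes f :: "'a::euclidean_space \<Rightarrow> ennreal"
  assumes "f \<in> borel_measurable borel"
  shows "(\<integral>\<^sup>+y. f (x - y) \<partial>lborel) = (\<integral>\<^sup>+y. f y \<partial>lborel)"
  using assms by (subst lborel_distr_diff[symmetric, of x], subst nn_integral_distr) auto

lemma nn_integral_lborel_shift: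
  fixes f :: "'a::euclidean_space \<Rightarrow> ennreal"
  assumes "f \<in> borel_measurable borel"
  shows "(\<integral>\<^sup>+x. f (x - y) \<partial>lborel) = (\<integral>\<^sup>+x. f x \<partial>lborel)"
  using assms lborel_distr_plus[of "- y"]
  by (subst (2) lborel_distr_plus[symmetric, of "- y"], subst nn_integral_distr) auto

lemma integral_lborel_diff:
  fixes f :: "'a::euclidean_space \<Rightarrow> complex"
  assumes "f \<in> borel_measurable borel"
  shows "(LINT y|lborel. f (x - y)) = (LINT y|lborel. f y)"
  using assms by (subst lborel_distr_diff[symmetric, of x], subst integral_distr) auto

lemma integrable_lborel_diff:
  fixes f :: "'a::euclidean_space \<Rightarrow> complex"
  assumes "integrable lborel f"
  shows "integrable lborel (\<lambda>y. f (x - y))"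
proof -
  have "f \<in> borel_measurable borel"
    using borel_measurable_integrable[OF assms] by simp
  then have "integrable (distr lborel borel (\<lambda>y. x - y)) f \<longleftrightarrow> integrable lborel (\<lambda>y. f (x - y))"
    by (intro integrable_distr_eq) auto
  then show ?thesis
    using assms by (simp add: lborel_distr_diff)
qed

lemma integral_lborel_scale:
  fixes f :: "'a::euclidean_space \<Rightarrow> complex"
  assumes "f \<in> borel_measurable borel" "c > 0"
  shows "(LINT y|lborel. f y) = c ^ DIM('a) *\<^sub>R (LINT y|lborel. f (c *\<^sub>R y))"
proof -
  have "(LINT y|lborel. f y) = (LINT y|density (distr lborel borel (\<lambda>x. 0 + c *\<^sub>R x)) (\<lambda>_. \<bar>c\<bar>^DIM('a)). f y)"
    using assms by (subst lborel_affine[symmetric]) auto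
  also have "\<dots> = (LINT y|distr lborel borel (\<lambda>x. 0 + c *\<^sub>R x). c ^ DIM('a) *\<^sub>R f y)"
    using assms by (subst integral_density) auto
  also have "\<dots> = (LINT y|lborel. c ^ DIM('a) *\<^sub>R f (c *\<^sub>R y))"
    using assms by (subst integral_distr) auto
  finally show ?thesis by simp
qed

lemma borel_integrable:
  "integrable lborel f \<Longrightarrow> f \<in> borel_measurable (borel :: 'a::euclidean_space measure)"
  by (drule borel_measurable_integrable) simp

lemma fourier_borel_measurable [measurable]:
  assumes [measurable]: "h \<in> borel_measurable borel"
  shows "fourier h \<in> borel_measurable borel"
proof -
  have "(\<lambda>\<xi>. LINT x|lborel. cnj (wave x \<xi>) * h x) \<in> borel_measurable borel"
    by measurable
  then show ?thesis
    by (simp add: fourier_eq[OF assms, abs_def])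
qed

lemma norm_fourier_le:
  assumes "integrable lborel h"
  shows "norm (fourier h \<xi>) \<le> (LINT x|lborel. norm (h x))"
  using integral_norm_bound[of lborel "\<lambda>x. cnj (wave x \<xi>) * h x"]
  by (simp add: fourier_eq[OF borel_integrable[OF assms]] norm_mult)

text \<open>The Fourier transform of \<open>gauss \<sigma>\<close>. It is left with total mass (2
  pi)^d so that Fubini produces it without stray factors; the mass is divided out later, as in
  \<open>mollify\<close>.\<close>

definition gkernel :: "real \<Rightarrow> 'a::euclidean_space \<Rightarrow> real" where
  "gkernel \<sigma> x = (sqrt (2 * pi) / \<sigma>) ^ DIM('a) * gauss (1 / \<sigma>) x"

lemma gkernel_pos: "0 < \<sigma> \<Longrightarrow> 0 < gkernel \<sigma> x"
  by (simp add: gkernel_def gauss_pos)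

lemma gkernel_nonneg: "0 < \<sigma> \<Longrightarrow> 0 \<le> gkernel \<sigma> x"
  by (simp add: gkernel_pos less_imp_le)

lemma borel_measurable_gkernel [measurable]:
  "f \<in> borel_measurable M \<Longrightarrow> (\<lambda>x. gkernel \<sigma> (f x)) \<in> borel_measurable M"
  unfolding gkernel_def by measurable

lemma integrable_gauss:
  assumes "\<sigma> > 0"
  shows "integrable lborel (\<lambda>\<xi>::'a::euclidean_space. complex_of_real (gauss \<sigma> \<xi>))"
  using gauss_transform(1)[OF assms, of "0::'a"] by simp

lemma gauss_transform_gkernel:
  assumes "\<sigma> > 0"
  shows "(LINT \<xi>|lborel. wave x \<xi> * complex_of_real (gauss \<sigma> \<xi>)) = complex_of_real (gkernel \<sigma> x)"
  using gauss_transform(2)[OF assms] by (simp add: gkernel_def)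

lemma integrable_gkernel:
  assumes "\<sigma> > 0"
  shows "integrable lborel (\<lambda>x::'a::euclidean_space. complex_of_real (gkernel \<sigma> x))"
  using assms integrable_mult_right[OF integrable_gauss[of "1 / \<sigma>"],
      of "complex_of_real ((sqrt (2 * pi) / \<sigma>) ^ DIM('a))"]
  by (simp only: gkernel_def of_real_mult) simp

text \<open>\<open>gkernel \<sigma>\<close> is a multiple of \<open>gauss (1 / \<sigma>)\<close>, so
  the Gaussian transform applies with the inverse width, and \<sigma> cancels between the two
  prefactors.\<close>

lemma fourier_gkernel:
  fixes \<xi> :: "real ^ 'n"
  assumes "\<sigma> > 0"
  shows "fourier (\<lambda>x. complex_of_real (gkernel \<sigma> x)) \<xi> = complex_of_real ((2 * pi) ^ CARD('n) * gauss \<sigma> \<xi>)"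
proof -
  have "fourier (\<lambda>x. complex_of_real (gkernel \<sigma> x)) \<xi>
      = (LINT x|lborel. complex_of_real ((sqrt (2 * pi) / \<sigma>) ^ CARD('n)) * (wave (- \<xi>) x * complex_of_real (gauss (1 / \<sigma>) x)))"
    by (subst fourier_eq) (auto simp: gkernel_def wave_minus wave_commute[of \<xi>] mult_ac)
  also have "\<dots> = complex_of_real ((sqrt (2 * pi) / \<sigma>) ^ CARD('n)) * complex_of_real (gkernel (1 / \<sigma>) (- \<xi>))"
    using assms by (subst integral_mult_right_zero, subst gauss_transform_gkernel) auto
  also have "gkernel (1 / \<sigma>) (- \<xi>) = (sqrt (2 * pi) * \<sigma>) ^ CARD('n) * gauss \<sigma> \<xi>"
    by (simp add: gkernel_def gauss_minus)
  also have "complex_of_real ((sqrt (2 * pi) / \<sigma>) ^ CARD('n)) * complex_of_real ((sqrt (2 * pi) * \<sigma>) ^ CARD('n) * gauss \<sigma> \<xi>)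
      = complex_of_real ((sqrt (2 * pi) / \<sigma> * (sqrt (2 * pi) * \<sigma>)) ^ CARD('n) * gauss \<sigma> \<xi>)"
    by (simp only: power_mult_distrib mult.assoc of_real_mult)
  also have "sqrt (2 * pi) / \<sigma> * (sqrt (2 * pi) * \<sigma>) = 2 * pi"
    using assms by (simp add: field_simps)
  finally show ?thesis .
qed

lemma integral_gkernel:
  assumes "\<sigma> > 0"
  shows "(LINT x|lborel. complex_of_real (gkernel \<sigma> (x :: real ^ 'n))) = complex_of_real ((2 * pi) ^ CARD('n))"
  using fourier_gkernel[OF assms, of "0 :: real ^ 'n"] by (subst (asm) fourier_eq) auto

lemma nn_integral_gkernel:
  assumes "\<sigma> > 0"
  shows "(\<integral>\<^sup>+x. ennreal (gkernel \<sigma> (x :: real ^ 'n)) \<partial>lborel) = ennreal ((2 * pi) ^ CARD('n))"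
proof -
  have "integrable lborel (\<lambda>x::real^'n. gkernel \<sigma> x)"
    using integrable_gkernel[OF assms] by (simp only: complex_of_real_integrable_eq)
  moreover have "(LINT x|lborel. gkernel \<sigma> (x :: real ^ 'n)) = (2 * pi) ^ CARD('n)"
    using integral_gkernel[OF assms, where 'n='n] by (metis integral_complex_of_real of_real_eq_iff)
  ultimately show ?thesis
    using assms by (subst nn_integral_eq_integral) (auto simp: gkernel_pos less_imp_le)
qed

text \<open>The Gaussian factor makes the double integral absolutely convergent for every integrable
  \<open>h\<close>, so Fubini applies. This is inversion with a convergence factor; letting \<sigma>
  tend to 0 leads to \<open>bessel\<close> and to \<open>fourier_inversion\<close>.\<close>

lemma gauss_fourier:
  fixes h :: "real ^ 'n \<Rightarrow> complex"
  assumes h: "integrable lborel h" and "\<sigma> > 0"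
  shows "(LINT \<xi>|lborel. wave x \<xi> * complex_of_real (gauss \<sigma> \<xi>) * fourier h \<xi>)
    = (LINT y|lborel. h y * complex_of_real (gkernel \<sigma> (x - y)))"
proof -
  note [measurable] = borel_integrable[OF h]
  let ?F = "\<lambda>y \<xi>. h y * complex_of_real (gauss \<sigma> \<xi>) * (wave x \<xi> * cnj (wave y \<xi>))"
  have "integrable (lborel \<Otimes>\<^sub>M lborel) (\<lambda>(y, \<xi>). ?F y \<xi>)"
    by (rule integrable_tensor[where B=1])
      (use assms in \<open>auto intro: integrable_gauss simp: norm_mult\<close>)
  then have "(LINT \<xi>|lborel. LINT y|lborel. ?F y \<xi>) = (LINT y|lborel. LINT \<xi>|lborel. ?F y \<xi>)"
    by (rule lborel_pair.Fubini_integral)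
  moreover have "(LINT y|lborel. ?F y \<xi>) = wave x \<xi> * complex_of_real (gauss \<sigma> \<xi>) * fourier h \<xi>" for \<xi>
    by (subst fourier_eq) (auto simp: mult_ac simp flip: integral_mult_right_zero)
  moreover have "(LINT \<xi>|lborel. ?F y \<xi>) = h y * complex_of_real (gkernel \<sigma> (x - y))" for y
  proof -
    have "(LINT \<xi>|lborel. ?F y \<xi>) = (LINT \<xi>|lborel. h y * (wave (x - y) \<xi> * complex_of_real (gauss \<sigma> \<xi>)))"
      using wave_add_left[of x "- y"] by (simp add: wave_minus mult_ac)
    then show ?thesis
      using assms by (simp add: gauss_transform_gkernel)
  qed
  ultimately show ?thesis by simp
qed

text \<open>By Fubini the left side is the pairing of \<open>h\<close> with its Gaussian average.
  Then 2ab \<le> a^2 + b^2 separates the values of \<open>h\<close> at x and y (Schur's test), and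
  each remaining integral of the kernel is its mass. The right side may be infinite.\<close>

lemma bessel_gauss:
  fixes h :: "real ^ 'n \<Rightarrow> complex"
  assumes h: "integrable lborel h" and \<sigma>: "\<sigma> > 0"
  shows "(\<integral>\<^sup>+\<xi>. ennreal ((norm (fourier h \<xi>))\<^sup>2 * gauss \<sigma> \<xi>) \<partial>lborel)
    \<le> ennreal ((2 * pi) ^ CARD('n)) * (\<integral>\<^sup>+x. ennreal ((norm (h x))\<^sup>2) \<partial>lborel)"
proof -
  note [measurable] = borel_integrable[OF h]
  let ?A = "\<integral>\<^sup>+x. ennreal ((norm (h x))\<^sup>2) \<partial>lborel"
  let ?P = "ennreal ((2 * pi) ^ CARD('n))"
  let ?m = "\<lambda>\<xi>. cnj (fourier h \<xi>) * complex_of_real (gauss \<sigma> \<xi>)"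
  have ig: "integrable lborel (\<lambda>\<xi>::real^'n. complex_of_real (gauss \<sigma> \<xi>))"
    using \<sigma> by (rule integrable_gauss)
  have m: "integrable lborel ?m"
    by (rule Bochner_Integration.integrable_bound[OF integrable_mult_right[OF ig, of "complex_of_real (LINT x|lborel. norm (h x))"]])
      (auto simp: norm_mult abs_mult intro!: mult_right_mono norm_fourier_le[OF h] order.trans[OF norm_fourier_le[OF h]])
  \<comment> \<open>Integrated over x first this becomes the weighted square of the transform;
    integrated over \<xi> first it becomes \<open>h x\<close> times the conjugate of its Gaussian
    average.\<close>
  let ?F = "\<lambda>x \<xi>. h x * ?m \<xi> * cnj (wave x \<xi>)"
  have "integrable (lborel \<Otimes>\<^sub>M lborel) (\<lambda>(x, \<xi>). ?F x \<xi>)"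
    by (rule integrable_tensor[where B=1]) (use h m in auto)
  then have eq: "(LINT \<xi>|lborel. LINT x|lborel. ?F x \<xi>) = (LINT x|lborel. LINT \<xi>|lborel. ?F x \<xi>)"
    by (rule lborel_pair.Fubini_integral)
  have 1: "(LINT x|lborel. ?F x \<xi>) = complex_of_real ((norm (fourier h \<xi>))\<^sup>2 * gauss \<sigma> \<xi>)" for \<xi>
  proof -
    have "(LINT x|lborel. ?F x \<xi>) = fourier h \<xi> * ?m \<xi>"
    proof -
      have "(LINT x|lborel. ?F x \<xi>) = (LINT x|lborel. ?m \<xi> * (cnj (wave x \<xi>) * h x))"
        by (simp add: mult_ac)
      also have "\<dots> = ?m \<xi> * fourier h \<xi>"
        by (simp only: integral_mult_right_zero fourier_eq[OF borel_integrable[OF h]])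
      finally show ?thesis by (simp only: mult.commute)
    qed
    also have "\<dots> = complex_of_real ((norm (fourier h \<xi>))\<^sup>2 * gauss \<sigma> \<xi>)"
      using complex_norm_square[of "fourier h \<xi>"] by (simp add: mult_ac)
    finally show ?thesis .
  qed
  have 2: "(LINT \<xi>|lborel. ?F x \<xi>) = h x * cnj (LINT y|lborel. h y * complex_of_real (gkernel \<sigma> (x - y)))" for x
  proof -
    have "(LINT \<xi>|lborel. ?F x \<xi>)
        = h x * (LINT \<xi>|lborel. cnj (wave x \<xi> * complex_of_real (gauss \<sigma> \<xi>) * fourier h \<xi>))"
      by (simp add: mult_ac flip: integral_mult_right_zero)
    also have "(LINT \<xi>|lborel. cnj (wave x \<xi> * complex_of_real (gauss \<sigma> \<xi>) * fourier h \<xi>))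
        = cnj (LINT \<xi>|lborel. wave x \<xi> * complex_of_real (gauss \<sigma> \<xi>) * fourier h \<xi>)"
      by (rule Bochner_Integration.integral_cnj)
    finally show ?thesis
      using assms by (simp add: gauss_fourier)
  qed
  have int: "integrable lborel (\<lambda>\<xi>. (norm (fourier h \<xi>))\<^sup>2 * gauss \<sigma> \<xi>)"
  proof (rule Bochner_Integration.integrable_bound[OF integrable_mult_right[OF ig, of "complex_of_real ((LINT x|lborel. norm (h x))\<^sup>2)"]])
    show "AE \<xi> in lborel. norm ((norm (fourier h \<xi>))\<^sup>2 * gauss \<sigma> \<xi>)
        \<le> norm (complex_of_real ((LINT x|lborel. norm (h x))\<^sup>2) * complex_of_real (gauss \<sigma> \<xi>))"
      by (auto simp: norm_mult abs_mult norm_power intro!: mult_right_mono power_mono norm_fourier_le[OF h])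
  qed simp
  have "(\<integral>\<^sup>+\<xi>. ennreal ((norm (fourier h \<xi>))\<^sup>2 * gauss \<sigma> \<xi>) \<partial>lborel)
      = ennreal (LINT \<xi>|lborel. (norm (fourier h \<xi>))\<^sup>2 * gauss \<sigma> \<xi>)"
    using int by (intro nn_integral_eq_integral) (auto simp: gauss_pos less_imp_le)
  also have "\<dots> \<le> ennreal (norm (LINT \<xi>|lborel. complex_of_real ((norm (fourier h \<xi>))\<^sup>2 * gauss \<sigma> \<xi>)))"
    by (simp only: integral_complex_of_real norm_of_real ennreal_leI abs_ge_self)
  also have "\<dots> = ennreal (norm (LINT x|lborel. h x * cnj (LINT y|lborel. h y * complex_of_real (gkernel \<sigma> (x - y)))))"
    using eq unfolding 1 2 by simp
  also have "\<dots> \<le> (\<integral>\<^sup>+x. ennreal (norm (h x * cnj (LINT y|lborel. h y * complex_of_real (gkernel \<sigma> (x - y))))) \<partial>lborel)"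
    by (cases "integrable lborel (\<lambda>x. h x * cnj (LINT y|lborel. h y * complex_of_real (gkernel \<sigma> (x - y))))")
      (auto intro: integral_norm_bound_ennreal simp: not_integrable_integral_eq)
  also have "\<dots> \<le> (\<integral>\<^sup>+x. (\<integral>\<^sup>+y. ennreal (norm (h x) * norm (h y) * gkernel \<sigma> (x - y)) \<partial>lborel) \<partial>lborel)"
  proof (rule nn_integral_mono)
    fix x
    have "ennreal (norm (h x * cnj (LINT y|lborel. h y * complex_of_real (gkernel \<sigma> (x - y)))))
        = ennreal (norm (h x)) * ennreal (norm (LINT y|lborel. h y * complex_of_real (gkernel \<sigma> (x - y))))"
      by (simp add: norm_mult ennreal_mult)
    also have "\<dots> \<le> ennreal (norm (h x)) * (\<integral>\<^sup>+y. ennreal (norm (h y * complex_of_real (gkernel \<sigma> (x - y)))) \<partial>lborel)"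
      by (intro mult_left_mono,
        cases "integrable lborel (\<lambda>y. h y * complex_of_real (gkernel \<sigma> (x - y)))")
      (auto intro: integral_norm_bound_ennreal simp: not_integrable_integral_eq)
    also have "\<dots> = (\<integral>\<^sup>+y. ennreal (norm (h x) * norm (h y) * gkernel \<sigma> (x - y)) \<partial>lborel)"
      using \<sigma> by (subst nn_integral_cmult[symmetric])
        (auto simp: norm_mult ennreal_mult abs_of_pos gkernel_pos less_imp_le mult.assoc)
    finally show "ennreal (norm (h x * cnj (LINT y|lborel. h y * complex_of_real (gkernel \<sigma> (x - y)))))
      \<le> (\<integral>\<^sup>+y. ennreal (norm (h x) * norm (h y) * gkernel \<sigma> (x - y)) \<partial>lborel)" .
  qed
  also have "\<dots> \<le> (\<integral>\<^sup>+x. (\<integral>\<^sup>+y. ennreal ((norm (h x))\<^sup>2 / 2) * ennreal (gkernel \<sigma> (x - y)) + ennreal ((norm (h y))\<^sup>2 / 2) * ennreal (gkernel \<sigma> (x - y)) \<partial>lborel) \<partial>lborel)"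
  proof (intro nn_integral_mono)
    fix x y
    have "norm (h x) * norm (h y) * gkernel \<sigma> (x - y) \<le> ((norm (h x))\<^sup>2 / 2 + (norm (h y))\<^sup>2 / 2) * gkernel \<sigma> (x - y)"
      using sum_squares_bound[of "norm (h x)" "norm (h y)"] \<sigma>
      by (intro mult_right_mono) (auto simp: gkernel_pos less_imp_le)
    then show "ennreal (norm (h x) * norm (h y) * gkernel \<sigma> (x - y))
        \<le> ennreal ((norm (h x))\<^sup>2 / 2) * ennreal (gkernel \<sigma> (x - y)) + ennreal ((norm (h y))\<^sup>2 / 2) * ennreal (gkernel \<sigma> (x - y))"
      using \<sigma> by (simp add: ennreal_mult[symmetric] ennreal_plus[symmetric] gkernel_pos less_imp_le distrib_right del: ennreal_plus)
  qed
  also have "\<dots> = (\<integral>\<^sup>+x. (\<integral>\<^sup>+y. ennreal ((norm (h x))\<^sup>2 / 2) * ennreal (gkernel \<sigma> (x - y)) \<partial>lborel) \<partial>lborel)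
      + (\<integral>\<^sup>+x. (\<integral>\<^sup>+y. ennreal ((norm (h y))\<^sup>2 / 2) * ennreal (gkernel \<sigma> (x - y)) \<partial>lborel) \<partial>lborel)"
    by (subst nn_integral_add[symmetric]) (auto intro!: nn_integral_cong simp: nn_integral_add)
  also have "(\<integral>\<^sup>+x. (\<integral>\<^sup>+y. ennreal ((norm (h y))\<^sup>2 / 2) * ennreal (gkernel \<sigma> (x - y)) \<partial>lborel) \<partial>lborel)
      = (\<integral>\<^sup>+y. (\<integral>\<^sup>+x. ennreal ((norm (h y))\<^sup>2 / 2) * ennreal (gkernel \<sigma> (x - y)) \<partial>lborel) \<partial>lborel)"
    by (rule lborel_pair.Fubini') measurable
  also have "(\<integral>\<^sup>+x. (\<integral>\<^sup>+y. ennreal ((norm (h x))\<^sup>2 / 2) * ennreal (gkernel \<sigma> (x - y)) \<partial>lborel) \<partial>lborel)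
      = (\<integral>\<^sup>+x. ennreal ((norm (h x))\<^sup>2 / 2) * ?P \<partial>lborel)"
    using \<sigma> by (simp add: nn_integral_cmult nn_integral_lborel_diff[of "\<lambda>z. ennreal (gkernel \<sigma> z)"] nn_integral_gkernel)
  also have "(\<integral>\<^sup>+y. (\<integral>\<^sup>+x. ennreal ((norm (h y))\<^sup>2 / 2) * ennreal (gkernel \<sigma> (x - y)) \<partial>lborel) \<partial>lborel)
      = (\<integral>\<^sup>+x. ennreal ((norm (h x))\<^sup>2 / 2) * ?P \<partial>lborel)"
  proof (rule nn_integral_cong)
    fix y :: "real ^ 'n"
    have "gkernel \<sigma> (x - y) = gkernel \<sigma> (y - x)" for x
      using gauss_minus[of "1 / \<sigma>" "x - y"] by (simp add: gkernel_def)
    then show "(\<integral>\<^sup>+x. ennreal ((norm (h y))\<^sup>2 / 2) * ennreal (gkernel \<sigma> (x - y)) \<partial>lborel) = ennreal ((norm (h y))\<^sup>2 / 2) * ?P"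
      using \<sigma> by (simp add: nn_integral_cmult nn_integral_lborel_diff[of "\<lambda>z. ennreal (gkernel \<sigma> z)"] nn_integral_gkernel)
  qed
  also have "(\<integral>\<^sup>+x. ennreal ((norm (h x))\<^sup>2 / 2) * ?P \<partial>lborel) + (\<integral>\<^sup>+x. ennreal ((norm (h x))\<^sup>2 / 2) * ?P \<partial>lborel)
      = (\<integral>\<^sup>+x. ?P * ennreal ((norm (h x))\<^sup>2) \<partial>lborel)"
    by (subst nn_integral_add[symmetric])
      (auto intro!: nn_integral_cong simp: ennreal_mult[symmetric] ennreal_plus[symmetric] simp del: ennreal_plus)
  also have "\<dots> = ?P * ?A"
    by (rule nn_integral_cmult) measurable
  finally show ?thesis .
qed

lemma gauss_tendsto_1: "(\<lambda>n. gauss (1 / real (Suc n)) \<xi>) \<longlonglongrightarrow> 1"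
proof -
  have "(\<lambda>n. exp (- (1 / real (Suc n) * norm \<xi>)\<^sup>2 / 2)) \<longlonglongrightarrow> exp (- (0 * norm \<xi>)\<^sup>2 / 2)"
    by (intro tendsto_intros LIMSEQ_Suc[OF lim_1_over_n]) simp_all
  then show ?thesis by (simp add: gauss_def)
qed

text \<open>Fatou's lemma as the Gaussian weight increases to 1.\<close>

lemma bessel:
  fixes h :: "real ^ 'n \<Rightarrow> complex"
  assumes h: "integrable lborel h"
  shows "(\<integral>\<^sup>+\<xi>. ennreal ((norm (fourier h \<xi>))\<^sup>2) \<partial>lborel)
    \<le> ennreal ((2 * pi) ^ CARD('n)) * (\<integral>\<^sup>+x. ennreal ((norm (h x))\<^sup>2) \<partial>lborel)" (is "_ \<le> ?R")
proof -
  note [measurable] = borel_integrable[OF h]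
  let ?u = "\<lambda>n \<xi>. ennreal ((norm (fourier h \<xi>))\<^sup>2 * gauss (1 / real (Suc n)) \<xi>)"
  have "(\<lambda>n. ?u n \<xi>) \<longlonglongrightarrow> ennreal ((norm (fourier h \<xi>))\<^sup>2 * 1)" for \<xi>
    by (intro tendsto_intros gauss_tendsto_1)
  then have "liminf (\<lambda>n. ?u n \<xi>) = ennreal ((norm (fourier h \<xi>))\<^sup>2)" for \<xi>
    by (simp add: lim_imp_Liminf)
  then have "(\<integral>\<^sup>+\<xi>. ennreal ((norm (fourier h \<xi>))\<^sup>2) \<partial>lborel) = (\<integral>\<^sup>+\<xi>. liminf (\<lambda>n. ?u n \<xi>) \<partial>lborel)"
    by simp
  also have "\<dots> \<le> liminf (\<lambda>n. \<integral>\<^sup>+\<xi>. ?u n \<xi> \<partial>lborel)"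
    by (rule nn_integral_liminf) measurable
  also have "\<dots> \<le> liminf (\<lambda>n. ?R)"
    by (intro Liminf_mono always_eventually allI bessel_gauss h) simp
  also have "\<dots> = ?R" by (simp add: Liminf_const)
  finally show ?thesis .
qed

section \<open>Inversion, convolution and mollification\<close>

lemma continuous_on_integral_sequential:
  fixes F :: "'a::metric_space \<Rightarrow> 'b::euclidean_space \<Rightarrow> complex"
  assumes meas: "\<And>x. F x \<in> borel_measurable borel"
    and cont: "\<And>y. continuous_on UNIV (\<lambda>x. F x y)"
    and b: "integrable lborel b" "\<And>x y. norm (F x y) \<le> b y"
  shows "continuous_on UNIV (\<lambda>x. LINT y|lborel. F x y)"
proof (rule continuous_on_sequentiallyI)
  fix u :: "nat \<Rightarrow> 'a" and a assume u: "u \<longlonglongrightarrow> a"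
  show "(\<lambda>n. LINT y|lborel. F (u n) y) \<longlonglongrightarrow> (LINT y|lborel. F a y)"
  proof (rule integral_dominated_convergence[OF _ _ b(1)])
    show "AE y in lborel. (\<lambda>n. F (u n) y) \<longlonglongrightarrow> F a y"
      using cont u by (auto simp: continuous_on_sequentially o_def)
  qed (use meas b in auto)
qed

lemma continuous_on_wave_integral:
  fixes m :: "'a::euclidean_space \<Rightarrow> complex"
  assumes "integrable lborel m"
  shows "continuous_on UNIV (\<lambda>x. LINT \<xi>|lborel. wave x \<xi> * m \<xi>)"
  using borel_integrable[OF assms]
  by (intro continuous_on_integral_sequential[where b = "\<lambda>\<xi>. norm (m \<xi>)"])
    (use assms in \<open>auto intro!: continuous_intros simp: norm_mult\<close>)

text \<open>The Gaussian convergence factor is inserted and its limit computed twice: directly,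
  dominated by the transform itself, and through \<open>gauss_fourier\<close> as an average of
  \<open>f\<close> over ever smaller neighbourhoods of x, where continuity and the bound
  \<open>B\<close> give f(x).\<close>

lemma fourier_inversion:
  fixes f :: "real ^ 'n \<Rightarrow> complex"
  assumes f: "integrable lborel f" and cont: "continuous_on UNIV f"
    and B: "\<And>x. norm (f x) \<le> B" and ff: "integrable lborel (fourier f)"
  shows "(LINT \<xi>|lborel. wave x \<xi> * fourier f \<xi>) = complex_of_real ((2 * pi) ^ CARD('n)) * f x"
proof -
  note [measurable] = borel_integrable[OF f]
  let ?s = "\<lambda>n. 1 / real (Suc n)"
  have s0: "?s \<longlonglongrightarrow> 0"
    by (intro LIMSEQ_Suc[OF lim_1_over_n])
  have "(\<lambda>n. LINT \<xi>|lborel. wave x \<xi> * complex_of_real (gauss (?s n) \<xi>) * fourier f \<xi>)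
      \<longlonglongrightarrow> (LINT \<xi>|lborel. wave x \<xi> * fourier f \<xi>)"
  proof (rule integral_dominated_convergence)
    show "integrable lborel (\<lambda>\<xi>. norm (fourier f \<xi>))"
      using ff by simp
    show "AE \<xi> in lborel. (\<lambda>n. wave x \<xi> * complex_of_real (gauss (?s n) \<xi>) * fourier f \<xi>)
        \<longlonglongrightarrow> wave x \<xi> * fourier f \<xi>"
    proof (rule AE_I2)
      fix \<xi>
      have "(\<lambda>n. wave x \<xi> * complex_of_real (gauss (?s n) \<xi>) * fourier f \<xi>)
          \<longlonglongrightarrow> wave x \<xi> * complex_of_real 1 * fourier f \<xi>"
        by (intro tendsto_intros gauss_tendsto_1)
      then show "(\<lambda>n. wave x \<xi> * complex_of_real (gauss (?s n) \<xi>) * fourier f \<xi>)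
          \<longlonglongrightarrow> wave x \<xi> * fourier f \<xi>" by simp
    qed
    show "AE \<xi> in lborel. norm (wave x \<xi> * complex_of_real (gauss (?s n) \<xi>) * fourier f \<xi>)
        \<le> norm (fourier f \<xi>)" for n
      using gauss_le_1[of "?s n"] gauss_pos[of "?s n"]
      by (intro AE_I2) (simp only: norm_mult norm_wave norm_of_real mult_1, rule mult_left_le_one_le, auto simp: less_imp_le abs_of_pos gauss_pos)
  qed measurable
  moreover have "(LINT \<xi>|lborel. wave x \<xi> * complex_of_real (gauss (?s n) \<xi>) * fourier f \<xi>)
      = (LINT z|lborel. f (x - ?s n *\<^sub>R z) * complex_of_real (gkernel 1 z))" for n
  proof -
    let ?g = "\<lambda>z. f (x - z) * complex_of_real (gkernel (?s n) z)"
    have "(LINT \<xi>|lborel. wave x \<xi> * complex_of_real (gauss (?s n) \<xi>) * fourier f \<xi>)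
        = (LINT y|lborel. f y * complex_of_real (gkernel (?s n) (x - y)))"
      by (rule gauss_fourier[OF f]) simp
    also have "\<dots> = (LINT y|lborel. ?g (x - y))" by simp
    also have "\<dots> = (LINT z|lborel. ?g z)"
      by (rule integral_lborel_diff) measurable
    \<comment> \<open>Dilation by the width: the Jacobian cancels the power of the width in
      \<open>gkernel\<close>, so the kernel becomes \<open>gkernel 1\<close> for every n and the
      width moves into the argument of \<open>f\<close>.\<close>
    also have "\<dots> = ?s n ^ CARD('n) *\<^sub>R (LINT z|lborel. ?g (?s n *\<^sub>R z))"
      by (subst integral_lborel_scale[of _ "?s n"]) auto
    also have "\<dots> = (LINT z|lborel. ?s n ^ CARD('n) *\<^sub>R ?g (?s n *\<^sub>R z))"
      by simp
    also have "\<dots> = (LINT z|lborel. f (x - ?s n *\<^sub>R z) * complex_of_real (gkernel 1 z))"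
    proof (intro Bochner_Integration.integral_cong refl)
      fix z :: "real ^ 'n"
      have "\<And>a. gauss (1 / ?s n) (?s n *\<^sub>R z) = gauss 1 z"
        by (simp add: gauss_def)
      then have "?s n ^ CARD('n) * gkernel (?s n) (?s n *\<^sub>R z) = (?s n * (sqrt (2 * pi) / ?s n)) ^ CARD('n) * gauss 1 z"
        unfolding gkernel_def by (simp only: power_mult_distrib mult.assoc) simp
      also have "?s n * (sqrt (2 * pi) / ?s n) = sqrt (2 * pi)" by simp
      finally have "?s n ^ CARD('n) * gkernel (?s n) (?s n *\<^sub>R z) = gkernel 1 z"
        by (simp add: gkernel_def)
      then show "?s n ^ CARD('n) *\<^sub>R ?g (?s n *\<^sub>R z) = f (x - ?s n *\<^sub>R z) * complex_of_real (gkernel 1 z)"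
        by (metis (no_types, lifting) mult_scaleR_right of_real_mult scaleR_conv_of_real)
    qed
    finally show ?thesis .
  qed
  moreover have "(\<lambda>n. LINT z|lborel. f (x - ?s n *\<^sub>R z) * complex_of_real (gkernel 1 z))
      \<longlonglongrightarrow> (LINT z|lborel. f x * complex_of_real (gkernel 1 (z :: real ^ 'n)))"
  proof (rule integral_dominated_convergence)
    show "integrable lborel (\<lambda>z::real^'n. norm (complex_of_real B * complex_of_real (gkernel 1 z)))"
      by (intro integrable_norm integrable_mult_right integrable_gkernel) simp
    show "AE z in lborel. (\<lambda>n. f (x - ?s n *\<^sub>R z) * complex_of_real (gkernel 1 z)) \<longlonglongrightarrow> f x * complex_of_real (gkernel 1 z)"
    proof (rule AE_I2)
      fix z :: "real ^ 'n"
      have "(\<lambda>n. x - ?s n *\<^sub>R z) \<longlonglongrightarrow> x - 0 *\<^sub>R z"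
        by (intro tendsto_intros s0)
      then have "(\<lambda>n. f (x - ?s n *\<^sub>R z)) \<longlonglongrightarrow> f x"
        using cont by (auto simp: continuous_on_sequentially o_def)
      then show "(\<lambda>n. f (x - ?s n *\<^sub>R z) * complex_of_real (gkernel 1 z)) \<longlonglongrightarrow> f x * complex_of_real (gkernel 1 z)"
        by (intro tendsto_intros)
    qed
    show "AE z in lborel. norm (f (x - ?s n *\<^sub>R z) * complex_of_real (gkernel 1 z))
        \<le> norm (complex_of_real B * complex_of_real (gkernel 1 z))" for n
      by (auto simp: norm_mult intro!: mult_right_mono order.trans[OF B])
  qed measurable
  ultimately have "(LINT \<xi>|lborel. wave x \<xi> * fourier f \<xi>) = (LINT z|lborel. f x * complex_of_real (gkernel 1 (z :: real ^ 'n)))"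
    using LIMSEQ_unique by (simp only:)
  also have "\<dots> = f x * (LINT z|lborel. complex_of_real (gkernel 1 (z :: real ^ 'n)))"
    by (rule integral_mult_right_zero)
  finally show ?thesis
    by (simp only: integral_gkernel[OF zero_less_one] mult.commute)
qed

text \<open>Inversion is applied to \<open>f\<close> alone, inside the convolution: the transform of
  \<open>g\<close> is only known to be bounded. In the application \<open>g\<close> is a kernel
  slice, of which only integrability is known.\<close>

lemma convolution_fourier:
  fixes f g :: "real ^ 'n \<Rightarrow> complex"
  assumes g: "integrable lborel g" and f: "integrable lborel f" and cont: "continuous_on UNIV f"
    and B: "\<And>x. norm (f x) \<le> B" and ff: "integrable lborel (fourier f)"
  shows "complex_of_real ((2 * pi) ^ CARD('n)) * (LINT y|lborel. g (x - y) * f y)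
    = (LINT \<xi>|lborel. wave x \<xi> * (fourier g \<xi> * fourier f \<xi>))"
proof -
  note [measurable] = borel_integrable[OF f] borel_integrable[OF g]
  let ?F = "\<lambda>y \<xi>. g (x - y) * fourier f \<xi> * wave y \<xi>"
  have "integrable (lborel \<Otimes>\<^sub>M lborel) (\<lambda>(y, \<xi>). ?F y \<xi>)"
    by (rule integrable_tensor[where B=1]) (use ff integrable_lborel_diff[OF g] in auto)
  then have "(LINT \<xi>|lborel. LINT y|lborel. ?F y \<xi>) = (LINT y|lborel. LINT \<xi>|lborel. ?F y \<xi>)"
    by (rule lborel_pair.Fubini_integral)
  moreover have "(LINT \<xi>|lborel. ?F y \<xi>) = complex_of_real ((2 * pi) ^ CARD('n)) * (g (x - y) * f y)" for y
  proof -
    have "(LINT \<xi>|lborel. ?F y \<xi>) = (LINT \<xi>|lborel. g (x - y) * (wave y \<xi> * fourier f \<xi>))"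
      by (intro Bochner_Integration.integral_cong refl) (simp add: mult_ac)
    also have "\<dots> = g (x - y) * (LINT \<xi>|lborel. wave y \<xi> * fourier f \<xi>)"
      by (rule integral_mult_right_zero)
    finally show ?thesis
      unfolding fourier_inversion[OF f cont B ff] by (simp only: mult_ac)
  qed
  moreover have "(LINT y|lborel. ?F y \<xi>) = wave x \<xi> * (fourier g \<xi> * fourier f \<xi>)" for \<xi>
  proof -
    let ?h = "\<lambda>z. wave x \<xi> * fourier f \<xi> * (cnj (wave z \<xi>) * g z)"
    have "?F y \<xi> = ?h (x - y)" for y
      using wave_add_left[of "x - y" y \<xi>] by (simp add: mult_ac)
    then have "(LINT y|lborel. ?F y \<xi>) = (LINT y|lborel. ?h (x - y))"
      by (simp only:)
    also have "\<dots> = (LINT y|lborel. ?h y)"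
      by (rule integral_lborel_diff) measurable
    also have "\<dots> = wave x \<xi> * fourier f \<xi> * (LINT y|lborel. cnj (wave y \<xi>) * g y)"
      by (rule integral_mult_right_zero)
    finally show ?thesis
      unfolding fourier_eq[OF borel_integrable[OF g]] by (simp only: mult_ac)
  qed
  ultimately show ?thesis by simp
qed

lemma
  fixes f g :: "'a::euclidean_space \<Rightarrow> 'b::{real_normed_field,banach,second_countable_topology}"
  assumes g: "integrable lborel g" and f: "integrable lborel f"
  shows integrable_convolution_pair: "integrable (lborel \<Otimes>\<^sub>M lborel) (\<lambda>(y, x). g (x - y) * f y)"
    and integrable_convolution: "integrable lborel (\<lambda>x. LINT y|lborel. g (x - y) * f y)"
proof -
  note [measurable] = borel_integrable[OF f] borel_integrable[OF g]
  have eq: "(\<integral>\<^sup>+x. ennreal (norm (g (x - y))) \<partial>lborel) = (\<integral>\<^sup>+x. ennreal (norm (g x)) \<partial>lborel)" for y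
    by (rule nn_integral_lborel_shift[of "\<lambda>x. ennreal (norm (g x))"]) measurable
  have g': "integrable lborel (\<lambda>x. g (x - y))" for y
    using g unfolding integrable_iff_bounded by (simp add: eq)
  show P: "integrable (lborel \<Otimes>\<^sub>M lborel) (\<lambda>(y, x). g (x - y) * f y)"
  proof (rule integrableI_bounded)
    have "(\<integral>\<^sup>+z. ennreal (norm (case z of (y, x) \<Rightarrow> g (x - y) * f y)) \<partial>(lborel \<Otimes>\<^sub>M lborel))
        = (\<integral>\<^sup>+y. (\<integral>\<^sup>+x. ennreal (norm (g (x - y))) * ennreal (norm (f y)) \<partial>lborel) \<partial>lborel)"
      by (subst lborel.nn_integral_fst[symmetric]) (auto simp: norm_mult ennreal_mult)
    also have "\<dots> = (\<integral>\<^sup>+x. ennreal (norm (g x)) \<partial>lborel) * (\<integral>\<^sup>+y. ennreal (norm (f y)) \<partial>lborel)"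
      by (simp add: nn_integral_multc nn_integral_cmult eq)
    also have "\<dots> < \<infinity>"
      using f g by (auto simp: integrable_iff_bounded ennreal_mult_less_top)
    finally show "(\<integral>\<^sup>+z. ennreal (norm (case z of (y, x) \<Rightarrow> g (x - y) * f y)) \<partial>(lborel \<Otimes>\<^sub>M lborel)) < \<infinity>" .
  qed measurable
  show "integrable lborel (\<lambda>x. LINT y|lborel. g (x - y) * f y)"
    using lborel_pair.integrable_snd[OF P] .
qed

lemma fourier_convolution:
  fixes f g :: "real ^ 'n \<Rightarrow> complex"
  assumes g: "integrable lborel g" and f: "integrable lborel f"
  shows "fourier (\<lambda>x. LINT y|lborel. g (x - y) * f y) \<xi> = fourier g \<xi> * fourier f \<xi>"
proof -
  note [measurable] = borel_integrable[OF f] borel_integrable[OF g]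
  let ?F = "\<lambda>y x. cnj (wave x \<xi>) * (g (x - y) * f y)"
  have "integrable (lborel \<Otimes>\<^sub>M lborel) (\<lambda>z. case z of (y, x) \<Rightarrow> ?F y x)"
    by (rule Bochner_Integration.integrable_bound[OF integrable_convolution_pair[OF g f]])
      (auto simp: norm_mult)
  then have "(LINT x|lborel. LINT y|lborel. ?F y x) = (LINT y|lborel. LINT x|lborel. ?F y x)"
    by (rule lborel_pair.Fubini_integral)
  moreover have "(LINT y|lborel. ?F y x) = cnj (wave x \<xi>) * (LINT y|lborel. g (x - y) * f y)" for x
    by (rule integral_mult_right_zero)
  moreover have "(LINT x|lborel. ?F y x) = fourier g \<xi> * (cnj (wave y \<xi>) * f y)" for y
  proof -
    let ?h = "\<lambda>z. (cnj (wave y \<xi>) * f y) * (cnj (wave z \<xi>) * g z)"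
    have "?F y x = ?h (- y + x)" for x
      using wave_add_left[of "x - y" y \<xi>] by (simp add: mult_ac)
    then have "(LINT x|lborel. ?F y x) = (LINT x|lborel. ?h (- y + x))"
      by (simp only:)
    also have "\<dots> = (LINT x|distr lborel borel ((+) (- y)). ?h x)"
      by (rule integral_distr[symmetric]) measurable
    also have "\<dots> = (LINT x|lborel. ?h x)"
      by (simp add: lborel_distr_plus)
    finally show ?thesis
      unfolding integral_mult_right_zero fourier_eq[OF borel_integrable[OF g]] by (simp only: mult_ac)
  qed
  ultimately show ?thesis
    by (subst (1 3) fourier_eq) auto
qed

text \<open>A multiplier that is an inverse transform of an integrable \<open>m\<close> acts on the
  Fourier side as convolution with \<open>m\<close>. This lets \<open>regular_cutoff\<close> control
  the transform of a cut function.\<close>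

lemma fourier_mult_wave_integral:
  fixes f m :: "real ^ 'n \<Rightarrow> complex"
  assumes m: "integrable lborel m" and f: "integrable lborel f"
  shows "fourier (\<lambda>y. (LINT \<zeta>|lborel. wave y \<zeta> * m \<zeta>) * f y) \<xi> = (LINT \<zeta>|lborel. fourier f (\<xi> - \<zeta>) * m \<zeta>)"
proof -
  note [measurable] = borel_integrable[OF f] borel_integrable[OF m]
  let ?F = "\<lambda>y \<zeta>. f y * m \<zeta> * (cnj (wave y \<xi>) * wave y \<zeta>)"
  have "integrable (lborel \<Otimes>\<^sub>M lborel) (\<lambda>(y, \<zeta>). ?F y \<zeta>)"
    by (rule integrable_tensor[where B=1]) (use f m in \<open>auto simp: norm_mult\<close>)
  then have "(LINT \<zeta>|lborel. LINT y|lborel. ?F y \<zeta>) = (LINT y|lborel. LINT \<zeta>|lborel. ?F y \<zeta>)"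
    by (rule lborel_pair.Fubini_integral)
  moreover have "(LINT \<zeta>|lborel. ?F y \<zeta>) = cnj (wave y \<xi>) * ((LINT \<zeta>|lborel. wave y \<zeta> * m \<zeta>) * f y)" for y
  proof -
    have "(LINT \<zeta>|lborel. ?F y \<zeta>) = (LINT \<zeta>|lborel. (cnj (wave y \<xi>) * f y) * (wave y \<zeta> * m \<zeta>))"
      by (intro Bochner_Integration.integral_cong refl) (simp add: mult_ac)
    also have "\<dots> = (cnj (wave y \<xi>) * f y) * (LINT \<zeta>|lborel. wave y \<zeta> * m \<zeta>)"
      by (rule integral_mult_right_zero)
    finally show ?thesis by (simp only: mult_ac)
  qed
  moreover have "(LINT y|lborel. ?F y \<zeta>) = fourier f (\<xi> - \<zeta>) * m \<zeta>" for \<zeta>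
  proof -
    have "(LINT y|lborel. ?F y \<zeta>) = (LINT y|lborel. m \<zeta> * (cnj (wave y (\<xi> - \<zeta>)) * f y))"
      using wave_add_right[of _ \<xi> "- \<zeta>"] by (simp add: wave_minus mult_ac)
    then show ?thesis
      by (simp add: fourier_eq mult.commute)
  qed
  ultimately show ?thesis
    by (subst fourier_eq) auto
qed

text \<open>The divisor is the total mass of \<open>gkernel\<close>, so this is an average.\<close>

definition mollify :: "real \<Rightarrow> (real ^ 'n \<Rightarrow> complex) \<Rightarrow> real ^ 'n \<Rightarrow> complex" where
  "mollify \<sigma> h x = (LINT y|lborel. complex_of_real (gkernel \<sigma> (x - y)) * h y) / complex_of_real ((2 * pi) ^ CARD('n))"

lemma
  fixes h :: "real ^ 'n \<Rightarrow> complex"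
  assumes h: "integrable lborel h" and \<sigma>: "\<sigma> > 0"
  shows integrable_mollify: "integrable lborel (mollify \<sigma> h)"
    and fourier_mollify: "fourier (mollify \<sigma> h) \<xi> = complex_of_real (gauss \<sigma> \<xi>) * fourier h \<xi>"
    and continuous_on_mollify: "continuous_on UNIV (mollify \<sigma> h)"
proof -
  note [measurable] = borel_integrable[OF h]
  let ?P = "complex_of_real ((2 * pi) ^ CARD('n))"
  let ?c = "\<lambda>x. LINT y|lborel. complex_of_real (gkernel \<sigma> (x - y)) * h y"
  have ic: "integrable lborel ?c"
    using integrable_convolution[OF integrable_gkernel[OF \<sigma>] h] .
  then show "integrable lborel (mollify \<sigma> h)"
    unfolding mollify_def[abs_def] by (intro integrable_divide_zero)
  have "fourier (mollify \<sigma> h) \<xi> = fourier ?c \<xi> / ?P"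
    unfolding mollify_def[abs_def] using borel_integrable[OF ic]
    by (simp add: fourier_eq)
  then show "fourier (mollify \<sigma> h) \<xi> = complex_of_real (gauss \<sigma> \<xi>) * fourier h \<xi>"
    using fourier_convolution[OF integrable_gkernel[OF \<sigma>] h] by (simp add: fourier_gkernel \<sigma>)
  have "mollify \<sigma> h = (\<lambda>x. (LINT \<xi>|lborel. wave x \<xi> * (complex_of_real (gauss \<sigma> \<xi>) * fourier h \<xi>)) / ?P)"
    using gauss_fourier[OF h \<sigma>] by (simp add: mollify_def[abs_def] mult_ac)
  moreover have "integrable lborel (\<lambda>\<xi>. complex_of_real (gauss \<sigma> \<xi>) * fourier h \<xi>)"
    by (rule Bochner_Integration.integrable_bound[OF integrable_mult_left[OF integrable_gauss[OF \<sigma>], of "complex_of_real (LINT x|lborel. norm (h x))"]])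
      (auto simp: norm_mult intro!: mult_left_mono order.trans[OF norm_fourier_le[OF h]])
  ultimately show "continuous_on UNIV (mollify \<sigma> h)"
    by (auto intro!: continuous_intros continuous_on_wave_integral)
qed

text \<open>In \<open>ennreal\<close> this holds for every Borel \<open>h\<close>: where the Bochner
  integral is undefined its value is 0.\<close>

lemma norm_mollify_le_nn:
  fixes h :: "real ^ 'n \<Rightarrow> complex"
  assumes [measurable]: "h \<in> borel_measurable borel" and \<sigma>: "\<sigma> > 0"
  shows "ennreal ((2 * pi) ^ CARD('n)) * ennreal (norm (mollify \<sigma> h x))
    \<le> (\<integral>\<^sup>+y. ennreal (gkernel \<sigma> (x - y)) * ennreal (norm (h y)) \<partial>lborel)"
proof -
  have "ennreal ((2 * pi) ^ CARD('n)) * ennreal (norm (mollify \<sigma> h x))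
      = ennreal (norm (LINT y|lborel. complex_of_real (gkernel \<sigma> (x - y)) * h y))"
    by (simp add: mollify_def norm_divide norm_mult norm_power ennreal_mult[symmetric])
  also have "\<dots> \<le> (\<integral>\<^sup>+y. ennreal (norm (complex_of_real (gkernel \<sigma> (x - y)) * h y)) \<partial>lborel)"
    by (cases "integrable lborel (\<lambda>y. complex_of_real (gkernel \<sigma> (x - y)) * h y)")
      (auto intro: integral_norm_bound_ennreal simp: not_integrable_integral_eq)
  also have "\<dots> = (\<integral>\<^sup>+y. ennreal (gkernel \<sigma> (x - y)) * ennreal (norm (h y)) \<partial>lborel)"
    by (simp add: norm_mult ennreal_mult gkernel_nonneg[OF \<sigma>])
  finally show ?thesis .
qed

lemma norm_mollify_le:
  fixes h :: "real ^ 'n \<Rightarrow> complex"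
  assumes [measurable]: "h \<in> borel_measurable borel" and \<sigma>: "\<sigma> > 0"
    and B: "\<And>x. norm (h x) \<le> B"
  shows "norm (mollify \<sigma> h x) \<le> B"
proof -
  have "0 \<le> B" using order.trans[OF norm_ge_zero B] .
  have "ennreal ((2 * pi) ^ CARD('n)) * ennreal (norm (mollify \<sigma> h x))
    \<le> (\<integral>\<^sup>+y. ennreal (gkernel \<sigma> (x - y)) * ennreal B \<partial>lborel)"
    by (rule order.trans[OF norm_mollify_le_nn]) (auto intro!: nn_integral_mono mult_left_mono B ennreal_leI \<sigma>)
  also have "\<dots> = ennreal ((2 * pi) ^ CARD('n)) * ennreal B"
    using \<sigma> by (simp add: nn_integral_multc nn_integral_lborel_diff[of "\<lambda>z. ennreal (gkernel \<sigma> z)"] nn_integral_gkernel)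
  finally show ?thesis
    using \<open>0 \<le> B\<close> by (simp add: ennreal_mult[symmetric] del: ennreal_power)
qed

text \<open>Cauchy-Schwarz for the finite measure with density
  \<open>gkernel \<sigma> (x - y)\<close>, followed by Tonelli in x. Both sides end up with the
  square of the total mass, which is cancelled.\<close>

lemma mollify_L2:
  fixes h :: "real ^ 'n \<Rightarrow> complex"
  assumes [measurable]: "h \<in> borel_measurable borel" and \<sigma>: "\<sigma> > 0"
  shows "(\<integral>\<^sup>+x. ennreal ((norm (mollify \<sigma> h x))\<^sup>2) \<partial>lborel) \<le> (\<integral>\<^sup>+x. ennreal ((norm (h x))\<^sup>2) \<partial>lborel)"
proof -
  let ?P = "ennreal ((2 * pi) ^ CARD('n))"
  have P0: "?P \<noteq> 0" "?P \<noteq> \<infinity>" by simp_all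
  have [measurable]: "mollify \<sigma> h \<in> borel_measurable borel"
    unfolding mollify_def[abs_def] by measurable
  have gm: "(\<lambda>y. gkernel \<sigma> (x - y)) \<in> borel_measurable borel" for x :: "real ^ 'n"
    by measurable
  have "?P\<^sup>2 * ennreal ((norm (mollify \<sigma> h x))\<^sup>2)
      \<le> ?P * (\<integral>\<^sup>+y. ennreal (gkernel \<sigma> (x - y)) * ennreal ((norm (h y))\<^sup>2) \<partial>lborel)" for x
  proof -
    \<comment> \<open>Writing the kernel as the square of its root puts one root into each
      Cauchy-Schwarz factor.\<close>
    let ?r = "\<lambda>y. ennreal (sqrt (gkernel \<sigma> (x - y)))"
    have g0: "0 \<le> gkernel \<sigma> (x - y)" for y
      by (rule gkernel_nonneg[OF \<sigma>])
    have r2: "?r y * ?r y = ennreal (gkernel \<sigma> (x - y))" for y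
      using g0 by (simp add: ennreal_mult[symmetric])
    have "?P\<^sup>2 * ennreal ((norm (mollify \<sigma> h x))\<^sup>2) = (?P * ennreal (norm (mollify \<sigma> h x)))\<^sup>2"
      by (simp add: power_mult_distrib ennreal_power)
    also have "\<dots> \<le> (\<integral>\<^sup>+y. ennreal (gkernel \<sigma> (x - y)) * ennreal (norm (h y)) \<partial>lborel)\<^sup>2"
      by (intro power_mono norm_mollify_le_nn \<sigma>) auto
    also have "\<dots> = (\<integral>\<^sup>+y. ?r y * (?r y * ennreal (norm (h y))) \<partial>lborel)\<^sup>2"
      by (simp add: mult.assoc[symmetric] r2)
    also have "\<dots> \<le> (\<integral>\<^sup>+y. (?r y)\<^sup>2 \<partial>lborel) * (\<integral>\<^sup>+y. (?r y * ennreal (norm (h y)))\<^sup>2 \<partial>lborel)"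
      by (rule Cauchy_Schwarz_nn_integral) (use gm in auto)
    also have "(\<integral>\<^sup>+y. (?r y)\<^sup>2 \<partial>lborel) = ?P"
      using \<sigma> by (simp add: power2_eq_square r2 nn_integral_lborel_diff[of "\<lambda>z. ennreal (gkernel \<sigma> z)"] nn_integral_gkernel)
    also have "(\<integral>\<^sup>+y. (?r y * ennreal (norm (h y)))\<^sup>2 \<partial>lborel)
        = (\<integral>\<^sup>+y. ennreal (gkernel \<sigma> (x - y)) * ennreal ((norm (h y))\<^sup>2) \<partial>lborel)"
      using g0 by (simp add: power_mult_distrib ennreal_power real_sqrt_pow2)
    finally show ?thesis .
  qed
  then have "(\<integral>\<^sup>+x. ?P\<^sup>2 * ennreal ((norm (mollify \<sigma> h x))\<^sup>2) \<partial>lborel)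
      \<le> (\<integral>\<^sup>+x. ?P * (\<integral>\<^sup>+y. ennreal (gkernel \<sigma> (x - y)) * ennreal ((norm (h y))\<^sup>2) \<partial>lborel) \<partial>lborel)"
    by (intro nn_integral_mono)
  also have "\<dots> = ?P * (\<integral>\<^sup>+x. (\<integral>\<^sup>+y. ennreal (gkernel \<sigma> (x - y)) * ennreal ((norm (h y))\<^sup>2) \<partial>lborel) \<partial>lborel)"
    by (rule nn_integral_cmult) measurable
  also have "(\<integral>\<^sup>+x. (\<integral>\<^sup>+y. ennreal (gkernel \<sigma> (x - y)) * ennreal ((norm (h y))\<^sup>2) \<partial>lborel) \<partial>lborel)
      = (\<integral>\<^sup>+y. (\<integral>\<^sup>+x. ennreal (gkernel \<sigma> (x - y)) * ennreal ((norm (h y))\<^sup>2) \<partial>lborel) \<partial>lborel)"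
    by (rule lborel_pair.Fubini') measurable
  also have "\<dots> = (\<integral>\<^sup>+y. ?P * ennreal ((norm (h y))\<^sup>2) \<partial>lborel)"
  proof (rule nn_integral_cong)
    fix y :: "real ^ 'n"
    have "gkernel \<sigma> (x - y) = gkernel \<sigma> (y - x)" for x
      using gauss_minus[of "1 / \<sigma>" "x - y"] by (simp add: gkernel_def)
    then show "(\<integral>\<^sup>+x. ennreal (gkernel \<sigma> (x - y)) * ennreal ((norm (h y))\<^sup>2) \<partial>lborel) = ?P * ennreal ((norm (h y))\<^sup>2)"
      using \<sigma> by (simp add: nn_integral_multc nn_integral_lborel_diff[of "\<lambda>z. ennreal (gkernel \<sigma> z)"] nn_integral_gkernel)
  qed
  also have "\<dots> = ?P * (\<integral>\<^sup>+x. ennreal ((norm (h x))\<^sup>2) \<partial>lborel)"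
    by (rule nn_integral_cmult) measurable
  finally have "?P\<^sup>2 * (\<integral>\<^sup>+x. ennreal ((norm (mollify \<sigma> h x))\<^sup>2) \<partial>lborel)
      \<le> ?P\<^sup>2 * (\<integral>\<^sup>+x. ennreal ((norm (h x))\<^sup>2) \<partial>lborel)"
    by (simp add: nn_integral_cmult power2_eq_square mult.assoc)
  then show ?thesis
    using P0 by (subst (asm) ennreal_mult_le_mult_iff) (auto simp: power2_eq_square ennreal_mult_eq_top_iff)
qed

section \<open>Inputs for the kernel operator\<close>

text \<open>By \<open>bessel\<close> both transforms are square integrable. This yields an
  integrable transform without any derivative: that of a convolution of two square integrable
  functions.\<close>

lemma integrable_mult_fourier:
  fixes f g :: "real ^ 'n \<Rightarrow> complex"
  assumes f: "integrable lborel f" and g: "integrable lborel g"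
    and f2: "(\<integral>\<^sup>+x. ennreal ((norm (f x))\<^sup>2) \<partial>lborel) < \<infinity>"
    and g2: "(\<integral>\<^sup>+x. ennreal ((norm (g x))\<^sup>2) \<partial>lborel) < \<infinity>"
  shows "integrable lborel (\<lambda>\<xi>. fourier f \<xi> * fourier g \<xi>)"
proof (rule integrableI_bounded)
  note [measurable] = borel_integrable[OF f] borel_integrable[OF g]
  show "(\<lambda>\<xi>. fourier f \<xi> * fourier g \<xi>) \<in> borel_measurable lborel"
    by measurable
  have "(\<integral>\<^sup>+\<xi>. ennreal (norm (fourier f \<xi> * fourier g \<xi>)) \<partial>lborel)
      \<le> (\<integral>\<^sup>+\<xi>. ennreal ((norm (fourier f \<xi>))\<^sup>2) + ennreal ((norm (fourier g \<xi>))\<^sup>2) \<partial>lborel)"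
  proof (intro nn_integral_mono)
    fix \<xi>
    have "norm (fourier f \<xi> * fourier g \<xi>) \<le> (norm (fourier f \<xi>))\<^sup>2 + (norm (fourier g \<xi>))\<^sup>2"
      using sum_squares_bound[of "norm (fourier f \<xi>)" "norm (fourier g \<xi>)"]
        mult_nonneg_nonneg[OF norm_ge_zero norm_ge_zero, of "fourier f \<xi>" "fourier g \<xi>"]
      unfolding norm_mult by linarith
    then show "ennreal (norm (fourier f \<xi> * fourier g \<xi>))
        \<le> ennreal ((norm (fourier f \<xi>))\<^sup>2) + ennreal ((norm (fourier g \<xi>))\<^sup>2)"
      by (simp add: ennreal_plus[symmetric] ennreal_leI del: ennreal_plus)
  qed
  also have "\<dots> = (\<integral>\<^sup>+\<xi>. ennreal ((norm (fourier f \<xi>))\<^sup>2) \<partial>lborel) + (\<integral>\<^sup>+\<xi>. ennreal ((norm (fourier g \<xi>))\<^sup>2) \<partial>lborel)"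
    by (rule nn_integral_add) measurable
  also have "\<dots> \<le> ennreal ((2 * pi) ^ CARD('n)) * (\<integral>\<^sup>+x. ennreal ((norm (f x))\<^sup>2) \<partial>lborel)
      + ennreal ((2 * pi) ^ CARD('n)) * (\<integral>\<^sup>+x. ennreal ((norm (g x))\<^sup>2) \<partial>lborel)"
    by (intro add_mono bessel f g)
  also have "\<dots> < \<infinity>"
    using f2 g2 by (simp add: ennreal_mult_less_top)
  finally show "(\<integral>\<^sup>+\<xi>. ennreal (norm (fourier f \<xi> * fourier g \<xi>)) \<partial>lborel) < \<infinity>" .
qed

lemma square_integrable_bounded:
  fixes f :: "'a::euclidean_space \<Rightarrow> complex"
  assumes f: "integrable lborel f" and B: "\<And>x. norm (f x) \<le> 1"
  shows "(\<integral>\<^sup>+x. ennreal ((norm (f x))\<^sup>2) \<partial>lborel) < \<infinity>"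
proof -
  have "(\<integral>\<^sup>+x. ennreal ((norm (f x))\<^sup>2) \<partial>lborel) \<le> (\<integral>\<^sup>+x. ennreal (norm (f x)) \<partial>lborel)"
    using B by (intro nn_integral_mono ennreal_leI) (auto simp: power2_eq_square intro!: mult_left_le)
  also have "\<dots> < \<infinity>"
    using f by (simp add: integrable_iff_bounded)
  finally show ?thesis .
qed

lemma integrable_indicator_bounded:
  fixes f :: "'a::euclidean_space \<Rightarrow> 'b::euclidean_space"
  assumes [measurable]: "f \<in> borel_measurable borel" and B: "\<And>x. norm (f x) \<le> B"
    and supp: "\<And>x. x \<notin> S \<Longrightarrow> f x = 0" and "bounded S"
  shows "integrable lborel f"
proof -
  obtain r where r: "S \<subseteq> cball 0 r"
    using \<open>bounded S\<close> by (auto simp: bounded_iff subset_iff)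
  show ?thesis
  proof (rule integrableI_bounded_set[where A = "cball 0 r" and B=B])
    show "emeasure lborel (cball 0 r :: 'a set) < \<infinity>"
      using emeasure_lborel_cball_finite by auto
    show "AE x in lborel. x \<notin> cball 0 r \<longrightarrow> f x = 0"
      using r supp by (intro AE_I2) blast
  qed (use B in auto)
qed

text \<open>The cutoff is the normalised convolution of a tent of radius c with the indicator of the
  ball of radius 3c, hence 1 within 3c - c and 0 beyond 3c + c. What matters is less its smoothness
  than that it is the inverse transform of an integrable function; its transform is a product of two
  square integrable ones.\<close>

lemma smooth_cutoff_exists:
  fixes x\<^sub>0 :: "real ^ 'n"
  assumes c: "c > 0"
  obtains m \<eta> :: "real ^ 'n \<Rightarrow> complex"
  where "integrable lborel m" "\<And>y. \<eta> y = (LINT \<zeta>|lborel. wave y \<zeta> * m \<zeta>)"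
    "\<And>y. norm (\<eta> y) \<le> 1" "\<And>y. norm (1 - \<eta> y) \<le> 1"
    "\<And>y. dist x\<^sub>0 y < 2 * c \<Longrightarrow> \<eta> y = 1" "\<And>y. 4 * c \<le> dist x\<^sub>0 y \<Longrightarrow> \<eta> y = 0"
proof -
  define p :: "real ^ 'n \<Rightarrow> real" where "p x = max 0 (1 - norm x / c)" for x
  define q :: "real ^ 'n \<Rightarrow> real" where "q = indicator (ball x\<^sub>0 (3 * c))"
  have p01: "0 \<le> p x" "p x \<le> 1" and p_supp: "c \<le> norm x \<Longrightarrow> p x = 0" for x
    using c by (auto simp: p_def field_simps)
  have q01: "0 \<le> q x" "q x \<le> 1" for x
    by (auto simp: q_def indicator_def)
  have q_supp: "x \<notin> ball x\<^sub>0 (3 * c) \<Longrightarrow> q x = 0" for x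
    by (simp add: q_def)
  have [continuous_intros]: "continuous_on S f \<Longrightarrow> continuous_on S (\<lambda>x. p (f x))" for S :: "(real ^ 'n) set" and f
    unfolding p_def using c by (auto intro!: continuous_intros)
  have [measurable]: "p \<in> borel_measurable borel"
    by (intro borel_measurable_continuous_onI continuous_intros)
  have [measurable]: "q \<in> borel_measurable borel"
    unfolding q_def by (rule borel_measurable_indicator[OF borel_open[OF open_ball]])
  have pi: "integrable lborel p"
    by (rule integrable_indicator_bounded[where B=1 and S="ball 0 c"]) (use p01 p_supp in auto)
  have qi: "integrable lborel q"
    by (rule integrable_indicator_bounded[where B=1 and S="ball x\<^sub>0 (3 * c)"]) (use q01 q_supp in auto)
  let ?p = "\<lambda>x. complex_of_real (p x)" and ?q = "\<lambda>x. complex_of_real (q x)"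
  have cpi: "integrable lborel ?p" and cqi: "integrable lborel ?q"
    using pi qi by simp_all
  define Z where "Z = (LINT x|lborel. p x)"
  have shift: "(LINT y|lborel. p (x - y)) = Z" for x
    using integral_lborel_diff[of ?p x] by (simp add: Z_def)
  have shift_i: "integrable lborel (\<lambda>y. p (x - y))" for x
    using integrable_lborel_diff[OF cpi, of x] by (simp only: complex_of_real_integrable_eq)
  have "0 < Z"
  proof -
    have "0 < measure lborel (ball (0 :: real ^ 'n) (c / 2)) / 2"
      using c content_ball_pos[of "c / 2" "0 :: real ^ 'n"] by simp
    also have "\<dots> = (LINT x|lborel. indicator (ball (0 :: real ^ 'n) (c / 2)) x / 2)"
      by simp
    also have "\<dots> \<le> Z"
      unfolding Z_def
    proof (rule integral_mono)
      show "integrable lborel (\<lambda>x. indicator (ball (0 :: real ^ 'n) (c / 2)) x / 2 :: real)"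
        using emeasure_lborel_ball_finite[of "0 :: real ^ 'n" "c / 2"] by (intro integrable_divide_zero) auto
      show "indicator (ball 0 (c / 2)) x / 2 \<le> p x" for x
        using c p01[of x] by (auto simp: indicator_def p_def field_simps)
    qed (rule pi)
    finally show ?thesis .
  qed
  define e where "e x = (LINT y|lborel. p (x - y) * q y)" for x
  let ?e = "\<lambda>x. LINT y|lborel. ?p (x - y) * ?q y"
  have e_eq: "?e x = complex_of_real (e x)" for x
    unfolding e_def by (simp flip: integral_complex_of_real)
  have e_int: "integrable lborel (\<lambda>y. p (x - y) * q y)" for x
    by (rule Bochner_Integration.integrable_bound[OF shift_i[of x]])
      (use p01 q01 in \<open>auto simp: abs_mult intro!: mult_left_le\<close>)
  have e0: "0 \<le> e x" for x
    unfolding e_def using p01 q01 by (intro integral_nonneg_AE) auto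
  have eZ: "e x \<le> Z" for x
    unfolding e_def shift[of x, symmetric] using p01 q01
    by (intro integral_mono e_int shift_i) (auto intro: mult_left_le)
  have e_inside: "e y = Z" if "dist x\<^sub>0 y < 2 * c" for y
  proof -
    have "p (y - z) * q z = p (y - z)" for z
    proof (cases "dist y z < c")
      case True
      then have "z \<in> ball x\<^sub>0 (3 * c)"
        using that dist_triangle[of x\<^sub>0 z y] by auto
      then show ?thesis by (simp add: q_def)
    qed (simp add: p_supp dist_norm)
    then show ?thesis by (simp only: e_def shift)
  qed
  have e_outside: "e y = 0" if "4 * c \<le> dist x\<^sub>0 y" for y
  proof -
    have "p (y - z) * q z = 0" for z
    proof (cases "dist y z < c")
      case True
      then have "z \<notin> ball x\<^sub>0 (3 * c)"
        using that dist_triangle[of x\<^sub>0 y z] by (auto simp: dist_commute)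
      then show ?thesis by (simp add: q_def)
    qed (simp add: p_supp dist_norm)
    then show ?thesis by (simp only: e_def Bochner_Integration.integral_zero)
  qed
  have ei: "integrable lborel ?e"
    by (rule integrable_convolution[OF cpi cqi])
  have e_cont: "continuous_on UNIV ?e"
    by (rule continuous_on_integral_sequential[where b=q])
      (use qi p01 q01 in \<open>auto intro!: continuous_intros simp: norm_mult abs_mult mult_left_le_one_le\<close>)
  have fe: "fourier ?e = (\<lambda>\<xi>. fourier ?p \<xi> * fourier ?q \<xi>)"
    by (intro ext fourier_convolution cpi cqi)
  have fei: "integrable lborel (fourier ?e)"
    unfolding fe by (intro integrable_mult_fourier square_integrable_bounded cpi cqi) (use p01 q01 in auto)
  let ?P = "complex_of_real ((2 * pi) ^ CARD('n))"
  \<comment> \<open>The transform of the normalised convolution, divided by (2 pi)^d so that the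
    plain wave integral of \<open>m\<close> returns the cutoff.\<close>
  define m where "m \<xi> = fourier ?e \<xi> / (?P * complex_of_real Z)" for \<xi>
  have mi: "integrable lborel m"
    unfolding m_def[abs_def] by (intro integrable_divide_zero fei)
  show thesis
  proof (rule that[of m "\<lambda>y. complex_of_real (e y / Z)"])
    show "integrable lborel m" by (rule mi)
    show "complex_of_real (e y / Z) = (LINT \<zeta>|lborel. wave y \<zeta> * m \<zeta>)" for y
    proof -
      have "(LINT \<zeta>|lborel. wave y \<zeta> * m \<zeta>) = (LINT \<zeta>|lborel. wave y \<zeta> * fourier ?e \<zeta>) / (?P * complex_of_real Z)"
        unfolding m_def by (simp only: times_divide_eq_right integral_divide_zero)
      also have "(LINT \<zeta>|lborel. wave y \<zeta> * fourier ?e \<zeta>) = ?P * ?e y"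
        by (rule fourier_inversion[OF ei e_cont _ fei, of Z])
          (use e0 eZ in \<open>auto simp: e_eq\<close>)
      finally show ?thesis
        using \<open>0 < Z\<close> by (simp add: e_eq)
    qed
    have eZ01: "0 \<le> e y / Z" "e y / Z \<le> 1" for y
      using e0[of y] eZ[of y] \<open>0 < Z\<close> by simp_all
    show "norm (complex_of_real (e y / Z)) \<le> 1" for y
      unfolding norm_of_real using eZ01[of y] by linarith
    have eq: "1 - complex_of_real (e y / Z) = complex_of_real (1 - e y / Z)" for y by simp
    show "norm (1 - complex_of_real (e y / Z)) \<le> 1" for y
      unfolding eq norm_of_real using eZ01[of y] by linarith
  qed (use e_inside e_outside \<open>0 < Z\<close> in auto)
qed

text \<open>Inputs on which the kernel operator can be computed on the Fourier side. The common majorant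
  of the spatial Fourier transforms replaces smoothness; unlike smoothness, it survives sharp
  truncation in time.\<close>

definition regular :: "(real \<times> (real ^ 'n) \<Rightarrow> complex) \<Rightarrow> bool" where
  "regular f \<longleftrightarrow> f \<in> borel_measurable borel \<and> (\<exists>B. \<forall>z. norm (f z) \<le> B) \<and>
     (\<forall>s. continuous_on UNIV (\<lambda>y. f (s, y))) \<and> (\<forall>s. integrable lborel (\<lambda>y. f (s, y))) \<and>
     (\<exists>\<Phi>. integrable lborel \<Phi> \<and> (\<forall>s. AE \<xi> in lborel. norm (fourier (\<lambda>y. f (s, y)) \<xi>) \<le> \<Phi> \<xi>))"

lemma fourier_diff:
  assumes "integrable lborel f" "integrable lborel g"
  shows "fourier (\<lambda>y. f y - g y) \<xi> = fourier f \<xi> - fourier g \<xi>"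
proof -
  have "integrable lborel (\<lambda>x. cnj (wave x \<xi>) * h x)" if "integrable lborel h" for h
    by (rule Bochner_Integration.integrable_bound[OF that])
      (use borel_integrable[OF that] in \<open>auto simp: norm_mult\<close>)
  then show ?thesis
    using assms borel_integrable[OF assms(1)] borel_integrable[OF assms(2)]
    by (simp add: fourier_eq right_diff_distrib)
qed

lemma regular_diff:
  assumes "regular f" "regular g"
  shows "regular (\<lambda>z. f z - g z)"
proof -
  obtain B C where BC: "\<And>z. norm (f z) \<le> B" "\<And>z. norm (g z) \<le> C"
    using assms by (auto simp: regular_def)
  obtain \<Phi> \<Psi> where \<Phi>: "integrable lborel \<Phi>" "\<And>s. AE \<xi> in lborel. norm (fourier (\<lambda>y. f (s, y)) \<xi>) \<le> \<Phi> \<xi>"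
    and \<Psi>: "integrable lborel \<Psi>" "\<And>s. AE \<xi> in lborel. norm (fourier (\<lambda>y. g (s, y)) \<xi>) \<le> \<Psi> \<xi>"
    using assms by (auto simp: regular_def)
  have i: "integrable lborel (\<lambda>y. f (s, y))" "integrable lborel (\<lambda>y. g (s, y))" for s
    using assms by (auto simp: regular_def)
  show ?thesis
    unfolding regular_def
  proof (intro conjI)
    show "\<exists>B. \<forall>z. norm (f z - g z) \<le> B"
      using BC by (intro exI[of _ "B + C"] allI norm_triangle_le_diff add_mono)
    show "\<exists>\<Phi>. integrable lborel \<Phi> \<and> (\<forall>s. AE \<xi> in lborel. norm (fourier (\<lambda>y. f (s, y) - g (s, y)) \<xi>) \<le> \<Phi> \<xi>)"
    proof (intro exI[of _ "\<lambda>\<xi>. \<Phi> \<xi> + \<Psi> \<xi>"] conjI allI)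
      show "AE \<xi> in lborel. norm (fourier (\<lambda>y. f (s, y) - g (s, y)) \<xi>) \<le> \<Phi> \<xi> + \<Psi> \<xi>" for s
        using \<Phi>(2)[of s] \<Psi>(2)[of s]
        by eventually_elim (auto simp: fourier_diff[OF i] intro!: norm_triangle_le_diff add_mono)
    qed (use \<Phi> \<Psi> in auto)
  qed (use assms in \<open>auto simp: regular_def intro!: continuous_intros\<close>)
qed

lemma borel_measurable_Pair_section:
  fixes f :: "'a::euclidean_space \<times> 'b::euclidean_space \<Rightarrow> 'c::topological_space"
  assumes f: "f \<in> borel_measurable borel"
  shows "(\<lambda>y. f (s, y)) \<in> borel_measurable borel"
  by (rule measurable_compose[OF _ f]) (simp add: borel_prod[symmetric])

text \<open>Multiplying by \<eta> convolves the transform with \<open>m\<close>, so the convolution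
  of \<Phi> with the modulus of \<open>m\<close> is a new common majorant. The sharp indicator costs
  nothing because \<open>regular\<close> asks for no continuity in time.\<close>

lemma regular_cutoff:
  fixes f :: "real \<times> (real ^ 'n) \<Rightarrow> complex"
  assumes f: "regular f" and S: "S \<in> sets borel"
    and m: "integrable lborel m" and \<eta>: "\<And>y. \<eta> y = (LINT \<zeta>|lborel. wave y \<zeta> * m \<zeta>)"
    and \<eta>1: "\<And>y. norm (\<eta> y) \<le> 1"
  shows "regular (\<lambda>(s, y). indicator S s * (\<eta> y * f (s, y)))"
proof -
  obtain B where B: "\<And>z. norm (f z) \<le> B"
    using f by (auto simp: regular_def)
  obtain \<Phi> where \<Phi>: "integrable lborel \<Phi>" "\<And>s. AE \<xi> in lborel. norm (fourier (\<lambda>y. f (s, y)) \<xi>) \<le> \<Phi> \<xi>"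
    using f by (auto simp: regular_def)
  have fi: "integrable lborel (\<lambda>y. f (s, y))" for s
    using f by (auto simp: regular_def)
  have fm [measurable]: "f \<in> borel_measurable borel"
    using f by (auto simp: regular_def)
  have \<eta>c: "continuous_on UNIV \<eta>"
    using continuous_on_wave_integral[OF m] by (simp add: \<eta>[abs_def])
  have [measurable]: "\<eta> \<in> borel_measurable borel"
    using \<eta>c by (rule borel_measurable_continuous_onI)
  have \<eta>fi: "integrable lborel (\<lambda>y. \<eta> y * f (s, y))" for s
    by (rule Bochner_Integration.integrable_bound[OF fi[of s]])
      (use \<eta>1 in \<open>auto simp: norm_mult intro!: mult_left_le_one_le borel_measurable_times borel_measurable_Pair_section[OF fm]\<close>)
  define \<Psi> where "\<Psi> \<xi> = (LINT \<zeta>|lborel. \<Phi> (\<xi> - \<zeta>) * norm (m \<zeta>))" for \<xi>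
  have \<Psi>: "integrable lborel \<Psi>"
    unfolding \<Psi>_def[abs_def] by (intro integrable_convolution \<Phi> integrable_norm m)
  have P: "integrable (lborel \<Otimes>\<^sub>M lborel) (\<lambda>(\<zeta>, \<xi>). \<Phi> (\<xi> - \<zeta>) * norm (m \<zeta>))"
    by (intro integrable_convolution_pair \<Phi> integrable_norm m)
  have "AE \<xi> in lborel. norm (fourier (\<lambda>y. \<eta> y * f (s, y)) \<xi>) \<le> \<Psi> \<xi>" for s
    \<comment> \<open>Where the integral defining \<open>\<Psi> \<xi>\<close> diverges, its default
      value 0 bounds nothing. Such \<xi> form a null set, which is why \<open>regular\<close> asks
      for the majorant only almost everywhere.\<close>
    using lborel_pair.AE_integrable_snd[OF P]
  proof eventually_elim
    case (elim \<xi>)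
    have "AE \<zeta> in lborel. norm (fourier (\<lambda>y. f (s, y)) (\<xi> - \<zeta>)) \<le> \<Phi> (\<xi> - \<zeta>)"
      by (rule AE_distrD[of "\<lambda>\<zeta>. \<xi> - \<zeta>" lborel borel "\<lambda>\<zeta>. norm (fourier (\<lambda>y. f (s, y)) \<zeta>) \<le> \<Phi> \<zeta>"])
        (simp, unfold lborel_distr_diff, rule \<Phi>(2))
    then have le: "AE \<zeta> in lborel. norm (fourier (\<lambda>y. f (s, y)) (\<xi> - \<zeta>) * m \<zeta>) \<le> \<Phi> (\<xi> - \<zeta>) * norm (m \<zeta>)"
      by eventually_elim (auto simp: norm_mult intro!: mult_right_mono)
    have "norm (fourier (\<lambda>y. \<eta> y * f (s, y)) \<xi>)
        = norm (LINT \<zeta>|lborel. fourier (\<lambda>y. f (s, y)) (\<xi> - \<zeta>) * m \<zeta>)"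
      unfolding \<eta> fourier_mult_wave_integral[OF m fi] ..
    also have "\<dots> \<le> (LINT \<zeta>|lborel. norm (fourier (\<lambda>y. f (s, y)) (\<xi> - \<zeta>) * m \<zeta>))"
      by (rule integral_norm_bound)
    also have "\<dots> \<le> \<Psi> \<xi>"
      unfolding \<Psi>_def
    proof (rule integral_mono_AE)
      have [measurable]: "fourier (\<lambda>y. f (s, y)) \<in> borel_measurable borel"
        by (intro fourier_borel_measurable borel_measurable_Pair_section fm)
      show "integrable lborel (\<lambda>\<zeta>. norm (fourier (\<lambda>y. f (s, y)) (\<xi> - \<zeta>) * m \<zeta>))"
        by (rule Bochner_Integration.integrable_bound[OF elim])
          (use le borel_integrable[OF m] in auto)
    qed (use elim le in auto)
    finally show ?case .
  qed
  note bound = this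
  have "AE \<xi> in lborel. norm (fourier (\<lambda>y. indicator S s * (\<eta> y * f (s, y))) \<xi>) \<le> \<Psi> \<xi>" for s
    using bound[of s]
  proof eventually_elim
    case (elim \<xi>)
    show ?case
    proof (cases "s \<in> S")
      case False
      have "fourier (\<lambda>y::real^'n. 0) \<xi> = 0"
        by (simp add: fourier_def)
      then show ?thesis
        using False order.trans[OF norm_ge_zero elim] by simp
    qed (use elim in simp)
  qed
  moreover have "norm (case z of (s, y) \<Rightarrow> indicator S s * (\<eta> y * f (s, y))) \<le> B" for z
    using B \<eta>1 order.trans[OF norm_ge_zero B[of z]]
    by (auto simp: norm_mult indicator_def split: prod.splits intro!: order.trans[OF mult_left_le_one_le B])
  moreover have "(\<lambda>(s, y). indicator S s * (\<eta> y * f (s, y))) \<in> borel_measurable borel"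
    using S by (simp add: borel_prod[symmetric]) measurable
  moreover have "continuous_on UNIV (\<lambda>y. indicator S s * (\<eta> y * f (s, y)))" for s
    using f \<eta>c by (auto simp: regular_def intro!: continuous_intros)
  moreover have "integrable lborel (\<lambda>y. indicator S s * (\<eta> y * f (s, y)))" for s
    by (intro integrable_mult_right \<eta>fi)
  ultimately show ?thesis
    unfolding regular_def using \<Psi> by auto
qed

text \<open>Mollification multiplies the transform of each slice by a Gaussian, and a uniform bound
  \<open>C\<close> on the slice integrals turns this into a majorant valid at all times. In this way
  an input cut at a height becomes \<open>regular\<close>.\<close>

lemma regular_mollify:
  fixes f :: "real \<times> (real ^ 'n) \<Rightarrow> complex"
  assumes f [measurable]: "f \<in> borel_measurable borel" and B: "\<And>z. norm (f z) \<le> B"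
    and i: "\<And>s. integrable lborel (\<lambda>y. f (s, y))"
    and C: "\<And>s. (LINT y|lborel. norm (f (s, y))) \<le> C" and \<sigma>: "\<sigma> > 0"
  shows "regular (\<lambda>(s, y). mollify \<sigma> (\<lambda>w. f (s, w)) y)"
  unfolding regular_def
proof (intro conjI allI)
  have [measurable]: "f \<in> borel_measurable (borel \<Otimes>\<^sub>M borel)"
    by (simp add: borel_prod)
  show "(\<lambda>(s, y). mollify \<sigma> (\<lambda>w. f (s, w)) y) \<in> borel_measurable borel"
    unfolding mollify_def by (simp add: borel_prod[symmetric])
  show "\<exists>B. \<forall>z. norm (case z of (s, y) \<Rightarrow> mollify \<sigma> (\<lambda>w. f (s, w)) y) \<le> B"
    using B by (intro exI[of _ B]) (auto intro!: norm_mollify_le \<sigma> borel_measurable_Pair_section f)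
  show "\<exists>\<Phi>. integrable lborel \<Phi> \<and> (\<forall>s. AE \<xi> in lborel.
      norm (fourier (\<lambda>y. case (s, y) of (s, y) \<Rightarrow> mollify \<sigma> (\<lambda>w. f (s, w)) y) \<xi>) \<le> \<Phi> \<xi>)"
  proof (intro exI[of _ "\<lambda>\<xi>. gauss \<sigma> \<xi> * C"] conjI allI AE_I2)
    show "integrable lborel (\<lambda>\<xi>::real^'n. gauss \<sigma> \<xi> * C)"
      using integrable_gauss[OF \<sigma>, where 'a="real^'n"] by (intro integrable_mult_left) (simp only: complex_of_real_integrable_eq)
    show "norm (fourier (\<lambda>y. case (s, y) of (s, y) \<Rightarrow> mollify \<sigma> (\<lambda>w. f (s, w)) y) \<xi>) \<le> gauss \<sigma> \<xi> * C" for s \<xi>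
      using order.trans[OF norm_fourier_le[OF i] C, of s \<xi>] gauss_pos[of \<sigma> \<xi>]
      by (simp add: fourier_mollify[OF i \<sigma>] norm_mult abs_of_pos)
  qed
qed (use i \<sigma> in \<open>auto intro: continuous_on_mollify integrable_mollify\<close>)

section \<open>The kernel operator and its bound on square-integrable inputs\<close>

lemma fourier_measurable_param:
  fixes F :: "'a \<Rightarrow> real ^ 'n \<Rightarrow> complex"
  assumes F [measurable]: "(\<lambda>(a, x). F a x) \<in> borel_measurable (M \<Otimes>\<^sub>M borel)"
  shows "(\<lambda>(a, \<xi>). fourier (F a) \<xi>) \<in> borel_measurable (M \<Otimes>\<^sub>M borel)"
proof -
  have "(\<lambda>(a, \<xi>). LINT x|lborel. cnj (wave x \<xi>) * F a x) \<in> borel_measurable (M \<Otimes>\<^sub>M borel)"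
    by measurable
  moreover have "fourier (F a) \<xi> = (LINT x|lborel. cnj (wave x \<xi>) * F a x)" if "a \<in> space M" for a \<xi>
    using measurable_Pair2[OF F that] by (intro fourier_eq) simp
  ultimately show ?thesis
    by (subst measurable_cong[where g="\<lambda>(a, \<xi>). LINT x|lborel. cnj (wave x \<xi>) * F a x"])
      (auto simp: space_pair_measure)
qed

text \<open>Without integrability the Bochner integral has the value 0, so the inequality still
  holds.\<close>

lemma ennreal_norm_integral_le:
  "ennreal (norm (LINT x|M. f x)) \<le> (\<integral>\<^sup>+x. ennreal (norm (f x)) \<partial>M)"
  by (cases "integrable M f") (auto intro: integral_norm_bound_ennreal simp: not_integrable_integral_eq)

lemma nn_integral_ennreal_finite:
  fixes f :: "'a \<Rightarrow> real"
  assumes "integrable A f"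
  shows "(\<integral>\<^sup>+x. ennreal (f x) \<partial>A) < \<infinity>"
proof -
  have "(\<integral>\<^sup>+x. ennreal (f x) \<partial>A) \<le> (\<integral>\<^sup>+x. ennreal (norm (f x)) \<partial>A)"
    by (intro nn_integral_mono ennreal_leI) simp
  also have "\<dots> < \<infinity>"
    using assms by (simp add: integrable_iff_bounded)
  finally show ?thesis .
qed

text \<open>\<open>N\<close> collects the times whose slices are lost when a Lebesgue measurable kernel is replaced by a
  Borel version.\<close>

locale causal_kernel =
  fixes K :: "real \<Rightarrow> real \<Rightarrow> real ^ 'n \<Rightarrow> complex"
    and H :: "real \<Rightarrow> real ^ 'n \<Rightarrow> ennreal" and N :: "real set" and M :: real
  assumes K_borel: "(\<lambda>(t, s, x). K t s x) \<in> borel_measurable borel"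
    and K_integrable: "\<And>t s. integrable lborel (K t s)"
    and H_borel: "(\<lambda>(t, \<xi>). H t \<xi>) \<in> borel_measurable borel"
    and H_bound: "\<And>\<xi>. (\<integral>\<^sup>+t. H t \<xi> \<partial>lborel) \<le> ennreal M"
    and M_nonneg: "0 \<le> M"
    and N_null: "N \<in> null_sets lborel"
    and majorant: "\<And>t. t \<notin> N \<Longrightarrow>
      AE s in lborel. AE \<xi> in lborel. ennreal (norm (fourier (K t s) \<xi>)) \<le> H (t - s) \<xi>"
begin

lemma K_measurable [measurable]:
  assumes [measurable]: "a \<in> borel_measurable A" "b \<in> borel_measurable A" "c \<in> borel_measurable A"
  shows "(\<lambda>z. K (a z) (b z) (c z)) \<in> borel_measurable A"
proof -
  have "(\<lambda>z. (a z, b z, c z)) \<in> measurable A borel"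
    by (simp add: borel_prod[symmetric])
  from measurable_compose[OF this K_borel] show ?thesis by simp
qed

lemma H_measurable [measurable]:
  assumes [measurable]: "a \<in> borel_measurable A" "b \<in> borel_measurable A"
  shows "(\<lambda>z. H (a z) (b z)) \<in> borel_measurable A"
proof -
  have "(\<lambda>z. (a z, b z)) \<in> measurable A borel"
    by (simp add: borel_prod[symmetric])
  from measurable_compose[OF this H_borel] show ?thesis by simp
qed

lemma fourier_K_measurable [measurable]:
  assumes [measurable]: "a \<in> borel_measurable A" "b \<in> borel_measurable A" "c \<in> borel_measurable A"
  shows "(\<lambda>z. fourier (K (a z) (b z)) (c z)) \<in> borel_measurable A"
proof -
  have "(\<lambda>(z, \<xi>). fourier (K (a z) (b z)) \<xi>) \<in> borel_measurable (A \<Otimes>\<^sub>M borel)"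
    by (rule fourier_measurable_param) measurable
  from measurable_compose[OF _ this, of "\<lambda>z. (z, c z)" A] show ?thesis by simp
qed

lemma input_measurable:
  fixes f :: "real \<times> (real ^ 'n) \<Rightarrow> complex"
  assumes f: "f \<in> borel_measurable borel"
    and [measurable]: "a \<in> borel_measurable A" "b \<in> borel_measurable A"
  shows "(\<lambda>z. f (a z, b z)) \<in> borel_measurable A"
  by (rule measurable_compose[OF _ f]) (simp add: borel_prod[symmetric])

lemma fourier_input_measurable:
  fixes f :: "real \<times> (real ^ 'n) \<Rightarrow> complex"
  assumes f: "f \<in> borel_measurable borel"
    and [measurable]: "a \<in> borel_measurable A" "c \<in> borel_measurable A"
  shows "(\<lambda>z. fourier (\<lambda>y. f (a z, y)) (c z)) \<in> borel_measurable A"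
proof -
  have "(\<lambda>(z, \<xi>). fourier (\<lambda>y. f (a z, y)) \<xi>) \<in> borel_measurable (A \<Otimes>\<^sub>M borel)"
    by (rule fourier_measurable_param) (use input_measurable[OF f] in measurable)
  from measurable_compose[OF _ this, of "\<lambda>z. (z, c z)" A] show ?thesis by simp
qed

text \<open>The integral runs over all times; restriction to the past comes from kernels that vanish
  for t \<le> s, as required in \<open>causal_kernel_estimates\<close>.\<close>

definition kernel_op :: "(real \<times> (real ^ 'n) \<Rightarrow> complex) \<Rightarrow> real \<times> (real ^ 'n) \<Rightarrow> complex" where
  "kernel_op f = (\<lambda>(t, x). LINT s|lborel. LINT y|lborel. K t s (x - y) * f (s, y))"

text \<open>Formally the spatial Fourier transform of \<open>kernel_op f\<close> at time t;
  rigorously, its wave integral recovers the operator (\<open>kernel_op_eq_symbol\<close>).\<close>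

definition symbol :: "(real \<times> (real ^ 'n) \<Rightarrow> complex) \<Rightarrow> real \<Rightarrow> real ^ 'n \<Rightarrow> complex" where
  "symbol f t \<xi> = (LINT s|lborel. fourier (K t s) \<xi> * fourier (\<lambda>y. f (s, y)) \<xi>)"

lemma kernel_op_borel_measurable:
  assumes [measurable]: "f \<in> borel_measurable borel"
  shows "kernel_op f \<in> borel_measurable borel"
proof -
  note [measurable] = input_measurable[OF assms]
  show ?thesis
    unfolding kernel_op_def by (simp add: borel_prod[symmetric])
qed

lemma symbol_measurable [measurable]:
  assumes f: "f \<in> borel_measurable borel" and [measurable]: "a \<in> borel_measurable A" "b \<in> borel_measurable A"
  shows "(\<lambda>z. symbol f (a z) (b z)) \<in> borel_measurable A"
proof -
  note [measurable] = fourier_input_measurable[OF f]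
  show ?thesis
    unfolding symbol_def by measurable
qed

text \<open>\<open>H\<close> dominates the kernel and \<Phi> the input; after Tonelli the time
  integral of \<open>H\<close> at a fixed frequency is at most \<open>M\<close>. The Fubini argument
  for \<open>kernel_op_eq_symbol\<close> rests on this absolute convergence.\<close>

lemma nn_integral_symbol_le:
  assumes t: "t \<notin> N" and f: "f \<in> borel_measurable borel"
    and \<Phi>: "integrable lborel \<Phi>" "\<And>s. AE \<xi> in lborel. norm (fourier (\<lambda>y. f (s, y)) \<xi>) \<le> \<Phi> \<xi>"
  shows "(\<integral>\<^sup>+s. (\<integral>\<^sup>+\<xi>. ennreal (norm (fourier (K t s) \<xi> * fourier (\<lambda>y. f (s, y)) \<xi>)) \<partial>lborel) \<partial>lborel)
    \<le> ennreal M * (\<integral>\<^sup>+\<xi>. ennreal (\<Phi> \<xi>) \<partial>lborel)"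
proof -
  note [measurable] = f borel_integrable[OF \<Phi>(1)] fourier_input_measurable[OF f]
  have "(\<integral>\<^sup>+s. (\<integral>\<^sup>+\<xi>. ennreal (norm (fourier (K t s) \<xi> * fourier (\<lambda>y. f (s, y)) \<xi>)) \<partial>lborel) \<partial>lborel)
      \<le> (\<integral>\<^sup>+s. (\<integral>\<^sup>+\<xi>. H (t - s) \<xi> * ennreal (\<Phi> \<xi>) \<partial>lborel) \<partial>lborel)"
  proof (rule nn_integral_mono_AE)
    show "AE s in lborel. (\<integral>\<^sup>+\<xi>. ennreal (norm (fourier (K t s) \<xi> * fourier (\<lambda>y. f (s, y)) \<xi>)) \<partial>lborel)
        \<le> (\<integral>\<^sup>+\<xi>. H (t - s) \<xi> * ennreal (\<Phi> \<xi>) \<partial>lborel)"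
      using majorant[OF t]
    proof eventually_elim
      case (elim s)
      have "AE \<xi> in lborel. ennreal (norm (fourier (K t s) \<xi> * fourier (\<lambda>y. f (s, y)) \<xi>)) \<le> H (t - s) \<xi> * ennreal (\<Phi> \<xi>)"
        using elim \<Phi>(2)[of s]
        by eventually_elim (auto simp: norm_mult ennreal_mult intro!: mult_mono ennreal_leI)
      then show ?case by (rule nn_integral_mono_AE)
    qed
  qed
  also have "\<dots> = (\<integral>\<^sup>+\<xi>. (\<integral>\<^sup>+s. H (t - s) \<xi> * ennreal (\<Phi> \<xi>) \<partial>lborel) \<partial>lborel)"
    by (rule lborel_pair.Fubini') measurable
  also have "\<dots> = (\<integral>\<^sup>+\<xi>. (\<integral>\<^sup>+s. H s \<xi> \<partial>lborel) * ennreal (\<Phi> \<xi>) \<partial>lborel)"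
    by (simp add: nn_integral_multc nn_integral_lborel_diff[of "\<lambda>s. H s _"])
  also have "\<dots> \<le> (\<integral>\<^sup>+\<xi>. ennreal M * ennreal (\<Phi> \<xi>) \<partial>lborel)"
    by (intro nn_integral_mono mult_right_mono H_bound) auto
  also have "\<dots> = ennreal M * (\<integral>\<^sup>+\<xi>. ennreal (\<Phi> \<xi>) \<partial>lborel)"
    by (rule nn_integral_cmult) measurable
  finally show ?thesis .
qed

text \<open>\<open>convolution_fourier\<close> turns each convolution into an integral over
  frequencies. One absolutely integrable function of time and frequency then yields all three claims
  through its iterated integrals.\<close>

lemma
  assumes t: "t \<notin> N" and f: "regular f"
  shows integrable_op: "integrable lborel (\<lambda>s. LINT y|lborel. K t s (x - y) * f (s, y))"
    and integrable_symbol: "integrable lborel (symbol f t)"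
    and kernel_op_eq_symbol: "complex_of_real ((2 * pi) ^ CARD('n)) * kernel_op f (t, x)
      = (LINT \<xi>|lborel. wave x \<xi> * symbol f t \<xi>)"
proof -
  let ?P = "complex_of_real ((2 * pi) ^ CARD('n))"
  let ?F = "\<lambda>x s \<xi>. wave x \<xi> * (fourier (K t s) \<xi> * fourier (\<lambda>y. f (s, y)) \<xi>)"
  obtain \<Phi> where \<Phi>: "integrable lborel \<Phi>" "\<And>s. AE \<xi> in lborel. norm (fourier (\<lambda>y. f (s, y)) \<xi>) \<le> \<Phi> \<xi>"
    using f by (auto simp: regular_def)
  obtain B where B: "\<And>z. norm (f z) \<le> B"
    using f by (auto simp: regular_def)
  have fi: "integrable lborel (\<lambda>y. f (s, y))" and fc: "continuous_on UNIV (\<lambda>y. f (s, y))" for s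
    using f by (auto simp: regular_def)
  have fm [measurable]: "f \<in> borel_measurable borel"
    using f by (auto simp: regular_def)
  note [measurable] = input_measurable[OF fm] fourier_input_measurable[OF fm]
  have pair: "integrable (lborel \<Otimes>\<^sub>M lborel) (\<lambda>(s, \<xi>). ?F x s \<xi>)" for x
  proof (rule integrableI_bounded)
    have "(\<integral>\<^sup>+z. ennreal (norm (case z of (s, \<xi>) \<Rightarrow> ?F x s \<xi>)) \<partial>(lborel \<Otimes>\<^sub>M lborel))
        = (\<integral>\<^sup>+s. (\<integral>\<^sup>+\<xi>. ennreal (norm (fourier (K t s) \<xi> * fourier (\<lambda>y. f (s, y)) \<xi>)) \<partial>lborel) \<partial>lborel)"
      by (subst lborel.nn_integral_fst[symmetric]) (auto simp: norm_mult)
    also have "\<dots> \<le> ennreal M * (\<integral>\<^sup>+\<xi>. ennreal (\<Phi> \<xi>) \<partial>lborel)"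
      by (rule nn_integral_symbol_le[OF t fm \<Phi>])
    also have "\<dots> < \<infinity>"
      using nn_integral_ennreal_finite[OF \<Phi>(1)] by (simp add: ennreal_mult_less_top)
    finally show "(\<integral>\<^sup>+z. ennreal (norm (case z of (s, \<xi>) \<Rightarrow> ?F x s \<xi>)) \<partial>(lborel \<Otimes>\<^sub>M lborel)) < \<infinity>" .
  qed measurable
  have ffi: "integrable lborel (fourier (\<lambda>y. f (s, y)))" for s
  proof (rule Bochner_Integration.integrable_bound[OF \<Phi>(1)])
    show "AE \<xi> in lborel. norm (fourier (\<lambda>y. f (s, y)) \<xi>) \<le> norm (\<Phi> \<xi>)"
      using \<Phi>(2)[of s] by eventually_elim (auto intro: order.trans)
  qed (use borel_measurable_Pair_section[OF fm] in auto)
  have conv: "(LINT y|lborel. K t s (x - y) * f (s, y)) = (LINT \<xi>|lborel. ?F x s \<xi>) / ?P" for s x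
  proof -
    have "?P * (LINT y|lborel. K t s (x - y) * f (s, y)) = (LINT \<xi>|lborel. ?F x s \<xi>)"
      by (rule convolution_fourier[OF K_integrable fi fc B ffi])
    then show ?thesis by (simp add: field_simps)
  qed
  show "integrable lborel (\<lambda>s. LINT y|lborel. K t s (x - y) * f (s, y))"
    unfolding conv by (intro integrable_divide_zero lborel_pair.integrable_fst pair)
  show "integrable lborel (symbol f t)"
    using lborel_pair.integrable_snd[OF pair[of 0]] by (simp add: symbol_def[abs_def])
  have "?P * kernel_op f (t, x) = (LINT s|lborel. LINT \<xi>|lborel. ?F x s \<xi>)"
    unfolding kernel_op_def by (simp add: conv)
  also have "\<dots> = (LINT \<xi>|lborel. LINT s|lborel. ?F x s \<xi>)"
    by (rule lborel_pair.Fubini_integral[OF pair, symmetric])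
  also have "\<dots> = (LINT \<xi>|lborel. wave x \<xi> * symbol f t \<xi>)"
    unfolding symbol_def by (simp only: integral_mult_right_zero)
  finally show "?P * kernel_op f (t, x) = (LINT \<xi>|lborel. wave x \<xi> * symbol f t \<xi>)" .
qed

text \<open>Purely qualitative: the bound depends on the majorant of the individual input. It
  provides local integrability for the BMO norm and enters no final constant.\<close>

lemma kernel_op_bounded:
  assumes f: "regular f"
  obtains B where "\<And>t x. t \<notin> N \<Longrightarrow> norm (kernel_op f (t, x)) \<le> B"
proof -
  obtain \<Phi> where \<Phi>: "integrable lborel \<Phi>" "\<And>s. AE \<xi> in lborel. norm (fourier (\<lambda>y. f (s, y)) \<xi>) \<le> \<Phi> \<xi>"
    using f by (auto simp: regular_def)
  have fm [measurable]: "f \<in> borel_measurable borel"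
    using f by (auto simp: regular_def)
  note [measurable] = input_measurable[OF fm] fourier_input_measurable[OF fm]
  let ?C = "ennreal M * (\<integral>\<^sup>+\<xi>. ennreal (\<Phi> \<xi>) \<partial>lborel)"
  have C: "?C < \<infinity>"
    using nn_integral_ennreal_finite[OF \<Phi>(1)] by (simp add: ennreal_mult_less_top)
  have *: "(2 * pi) ^ CARD('n) * norm (kernel_op f (t, x)) \<le> enn2real ?C" if t: "t \<notin> N" for t x
  proof -
    have "ennreal ((2 * pi) ^ CARD('n) * norm (kernel_op f (t, x))) = ennreal (norm (LINT \<xi>|lborel. wave x \<xi> * symbol f t \<xi>))"
      by (simp only: kernel_op_eq_symbol[OF t f, symmetric] norm_mult norm_of_real abs_of_nonneg[OF zero_le_power] mult_nonneg_nonneg pi_ge_zero zero_le_numeral)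
    also have "\<dots> \<le> (\<integral>\<^sup>+\<xi>. ennreal (norm (wave x \<xi> * symbol f t \<xi>)) \<partial>lborel)"
      by (rule ennreal_norm_integral_le)
    also have "\<dots> \<le> (\<integral>\<^sup>+\<xi>. (\<integral>\<^sup>+s. ennreal (norm (fourier (K t s) \<xi> * fourier (\<lambda>y. f (s, y)) \<xi>)) \<partial>lborel) \<partial>lborel)"
      unfolding symbol_def by (intro nn_integral_mono) (simp add: norm_mult[of "wave x _"] ennreal_norm_integral_le)
    also have "\<dots> = (\<integral>\<^sup>+s. (\<integral>\<^sup>+\<xi>. ennreal (norm (fourier (K t s) \<xi> * fourier (\<lambda>y. f (s, y)) \<xi>)) \<partial>lborel) \<partial>lborel)"
      by (rule lborel_pair.Fubini') measurable
    also have "\<dots> \<le> ?C"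
      by (rule nn_integral_symbol_le[OF t fm \<Phi>])
    finally have "enn2real (ennreal ((2 * pi) ^ CARD('n) * norm (kernel_op f (t, x)))) \<le> enn2real ?C"
      by (rule enn2real_mono) (use C in simp)
    then show ?thesis by (subst (asm) enn2real_ennreal) auto
  qed
  show thesis
  proof (rule that)
    show "norm (kernel_op f (t, x)) \<le> enn2real ?C / (2 * pi) ^ CARD('n)" if "t \<notin> N" for t x
      using *[OF that, of x] by (subst pos_le_divide_eq) (simp_all only: mult.commute, simp)
  qed
qed

text \<open>Off \<open>N\<close> the time integrals converge absolutely. At a time in
  \<open>N\<close> a divergent integral would have the value 0, which could destroy
  additivity.\<close>

lemma kernel_op_diff:
  assumes t: "t \<notin> N" and f: "regular f" and g: "regular g"
  shows "kernel_op (\<lambda>z. f z - g z) (t, x) = kernel_op f (t, x) - kernel_op g (t, x)"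
proof -
  have i: "integrable lborel (\<lambda>y. K t s (x - y) * h (s, y))" if h: "regular h" for h s
  proof -
    obtain B where B: "\<And>z. norm (h z) \<le> B"
      using h by (auto simp: regular_def)
    have "h \<in> borel_measurable borel"
      using h by (auto simp: regular_def)
    note [measurable] = input_measurable[OF this]
    show ?thesis
    proof (rule Bochner_Integration.integrable_bound)
      show "integrable lborel (\<lambda>y. K t s (x - y) * complex_of_real B)"
        by (intro integrable_mult_left integrable_lborel_diff K_integrable)
      show "AE y in lborel. norm (K t s (x - y) * h (s, y)) \<le> norm (K t s (x - y) * complex_of_real B)"
        by (auto simp: norm_mult intro!: mult_left_mono order.trans[OF B])
    qed measurable
  qed
  have "kernel_op (\<lambda>z. f z - g z) (t, x)
      = (LINT s|lborel. (LINT y|lborel. K t s (x - y) * f (s, y)) - (LINT y|lborel. K t s (x - y) * g (s, y)))"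
    unfolding kernel_op_def using i[OF f] i[OF g] by (simp add: right_diff_distrib)
  also have "\<dots> = kernel_op f (t, x) - kernel_op g (t, x)"
    unfolding kernel_op_def using integrable_op[OF t f] integrable_op[OF t g] by simp
  finally show ?thesis .
qed

text \<open>Cauchy-Schwarz in s for the measure with density \<open>H (t - s) \<xi>\<close>, whose
  mass is at most \<open>M\<close>.\<close>

lemma symbol_square_le:
  assumes t: "t \<notin> N" and f [measurable]: "f \<in> borel_measurable borel"
  shows "AE \<xi> in lborel. ennreal ((norm (symbol f t \<xi>))\<^sup>2)
    \<le> ennreal M * (\<integral>\<^sup>+s. H (t - s) \<xi> * ennreal ((norm (fourier (\<lambda>y. f (s, y)) \<xi>))\<^sup>2) \<partial>lborel)"
proof -
  note [measurable] = fourier_input_measurable[OF f]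
  \<comment> \<open>The quantifiers of \<open>majorant\<close> are exchanged because the time
    integral is estimated at a fixed frequency.\<close>
  have "AE \<xi> in lborel. AE s in lborel. ennreal (norm (fourier (K t s) \<xi>)) \<le> H (t - s) \<xi>"
    by (subst lborel_pair.AE_commute, measurable) (rule majorant[OF t])
  then show ?thesis
  proof eventually_elim
    case (elim \<xi>)
    let ?a = "\<lambda>s. ennreal (norm (fourier (\<lambda>y. f (s, y)) \<xi>))"
    let ?D = "density lborel (\<lambda>s. H (t - s) \<xi>)"
    have "ennreal (norm (symbol f t \<xi>)) \<le> (\<integral>\<^sup>+s. ennreal (norm (fourier (K t s) \<xi> * fourier (\<lambda>y. f (s, y)) \<xi>)) \<partial>lborel)"
      unfolding symbol_def by (rule ennreal_norm_integral_le)
    also have "\<dots> \<le> (\<integral>\<^sup>+s. H (t - s) \<xi> * ?a s \<partial>lborel)"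
      using elim by (intro nn_integral_mono_AE, eventually_elim) (auto simp: norm_mult ennreal_mult intro!: mult_right_mono)
    also have "\<dots> = (\<integral>\<^sup>+s. 1 * ?a s \<partial>?D)"
      by (subst nn_integral_density) auto
    finally have "(ennreal (norm (symbol f t \<xi>)))\<^sup>2 \<le> (\<integral>\<^sup>+s. 1 * ?a s \<partial>?D)\<^sup>2"
      by (intro power_mono) auto
    also have "\<dots> \<le> (\<integral>\<^sup>+s. 1\<^sup>2 \<partial>?D) * (\<integral>\<^sup>+s. (?a s)\<^sup>2 \<partial>?D)"
      by (rule Cauchy_Schwarz_nn_integral) auto
    also have "(\<integral>\<^sup>+s. 1\<^sup>2 \<partial>?D) = (\<integral>\<^sup>+s. H (t - s) \<xi> \<partial>lborel)"
      by (simp add: emeasure_density)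
    also have "\<dots> = (\<integral>\<^sup>+s. H s \<xi> \<partial>lborel)"
      by (rule nn_integral_lborel_diff) measurable
    also have "\<dots> * (\<integral>\<^sup>+s. (?a s)\<^sup>2 \<partial>?D) \<le> ennreal M * (\<integral>\<^sup>+s. (?a s)\<^sup>2 \<partial>?D)"
      by (intro mult_right_mono H_bound) auto
    also have "(\<integral>\<^sup>+s. (?a s)\<^sup>2 \<partial>?D) = (\<integral>\<^sup>+s. H (t - s) \<xi> * ennreal ((norm (fourier (\<lambda>y. f (s, y)) \<xi>))\<^sup>2) \<partial>lborel)"
      by (subst nn_integral_density) (auto simp: ennreal_power)
    finally show ?case
      by (simp add: ennreal_power)
  qed
qed

lemma AE_not_N: "AE t in lborel. t \<notin> N"
  using N_null by (rule AE_not_in)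

text \<open>\<open>bessel\<close> is applied at each time to \<open>symbol f t\<close>, whose
  Fourier transform at -x is (2 pi)^d times the operator, and again to the slices of
  \<open>f\<close>. One factor \<open>M\<close> comes from Cauchy-Schwarz in s, the other from
  integrating \<open>H (t - s) \<xi>\<close> over t. The powers of 2 pi balance.\<close>

lemma kernel_op_L2_bound:
  assumes f: "regular f"
  shows "(\<integral>\<^sup>+z. ennreal ((norm (kernel_op f z))\<^sup>2) \<partial>lborel) \<le> ennreal (M\<^sup>2) * (\<integral>\<^sup>+z. ennreal ((norm (f z))\<^sup>2) \<partial>lborel)"
proof -
  let ?P = "ennreal ((2 * pi) ^ CARD('n))"
  have P0: "?P \<noteq> 0" "?P \<noteq> \<infinity>" by simp_all
  have fi: "integrable lborel (\<lambda>y. f (s, y))" for s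
    using f by (auto simp: regular_def)
  have fm [measurable]: "f \<in> borel_measurable borel"
    using f by (auto simp: regular_def)
  note [measurable] = input_measurable[OF fm] fourier_input_measurable[OF fm]
  note [measurable] = kernel_op_borel_measurable[OF fm]
  have slice: "?P\<^sup>2 * (\<integral>\<^sup>+x. ennreal ((norm (kernel_op f (t, x)))\<^sup>2) \<partial>lborel)
      \<le> ?P * (ennreal M * (\<integral>\<^sup>+\<xi>. (\<integral>\<^sup>+s. H (t - s) \<xi> * ennreal ((norm (fourier (\<lambda>y. f (s, y)) \<xi>))\<^sup>2) \<partial>lborel) \<partial>lborel))"
    if t: "t \<notin> N" for t
  proof -
    \<comment> \<open>The argument is written \<open>0 - x\<close> to match the reflection rule
      \<open>nn_integral_lborel_diff\<close>.\<close>
    have eq: "?P\<^sup>2 * ennreal ((norm (kernel_op f (t, x)))\<^sup>2) = ennreal ((norm (fourier (symbol f t) (0 - x)))\<^sup>2)" for x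
    proof -
      have "complex_of_real ((2 * pi) ^ CARD('n)) * kernel_op f (t, x) = fourier (symbol f t) (0 - x)"
        unfolding kernel_op_eq_symbol[OF t f] using integrable_symbol[OF t f]
        by (subst fourier_eq) (auto simp: wave_minus wave_commute[of x] dest: borel_integrable)
      then have "(norm (fourier (symbol f t) (0 - x)))\<^sup>2 = ((2 * pi) ^ CARD('n))\<^sup>2 * (norm (kernel_op f (t, x)))\<^sup>2"
        by (metis (no_types, lifting) abs_of_nonneg norm_mult norm_of_real pi_ge_zero power_mult_distrib
            mult_nonneg_nonneg zero_le_numeral zero_le_power)
      then show ?thesis
        by (simp add: ennreal_mult ennreal_power[symmetric])
    qed
    have "?P\<^sup>2 * (\<integral>\<^sup>+x. ennreal ((norm (kernel_op f (t, x)))\<^sup>2) \<partial>lborel)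
        = (\<integral>\<^sup>+x. ennreal ((norm (fourier (symbol f t) (0 - x)))\<^sup>2) \<partial>lborel)"
      unfolding eq[symmetric] by (rule nn_integral_cmult[symmetric]) measurable
    also have "\<dots> = (\<integral>\<^sup>+x. ennreal ((norm (fourier (symbol f t) x))\<^sup>2) \<partial>lborel)"
      by (rule nn_integral_lborel_diff) measurable
    also have "\<dots> \<le> ?P * (\<integral>\<^sup>+\<xi>. ennreal ((norm (symbol f t \<xi>))\<^sup>2) \<partial>lborel)"
      by (rule bessel[OF integrable_symbol[OF t f]])
    also have "\<dots> \<le> ?P * (\<integral>\<^sup>+\<xi>. ennreal M * (\<integral>\<^sup>+s. H (t - s) \<xi> * ennreal ((norm (fourier (\<lambda>y. f (s, y)) \<xi>))\<^sup>2) \<partial>lborel) \<partial>lborel)"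
      by (intro mult_left_mono nn_integral_mono_AE symbol_square_le t fm) auto
    also have "\<dots> = ?P * (ennreal M * (\<integral>\<^sup>+\<xi>. (\<integral>\<^sup>+s. H (t - s) \<xi> * ennreal ((norm (fourier (\<lambda>y. f (s, y)) \<xi>))\<^sup>2) \<partial>lborel) \<partial>lborel))"
      by (subst nn_integral_cmult) auto
    finally show ?thesis .
  qed
  let ?g = "\<lambda>s \<xi>. ennreal ((norm (fourier (\<lambda>y. f (s, y)) \<xi>))\<^sup>2)"
  let ?F = "\<integral>\<^sup>+z. ennreal ((norm (f z))\<^sup>2) \<partial>lborel"
  have "(\<integral>\<^sup>+\<xi>. (\<integral>\<^sup>+s. ?g s \<xi> \<partial>lborel) \<partial>lborel) = (\<integral>\<^sup>+s. (\<integral>\<^sup>+\<xi>. ?g s \<xi> \<partial>lborel) \<partial>lborel)"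
    by (rule lborel_pair.Fubini') measurable
  also have "\<dots> \<le> (\<integral>\<^sup>+s. ?P * (\<integral>\<^sup>+y. ennreal ((norm (f (s, y)))\<^sup>2) \<partial>lborel) \<partial>lborel)"
    by (intro nn_integral_mono bessel fi)
  also have "\<dots> = ?P * (\<integral>\<^sup>+s. (\<integral>\<^sup>+y. ennreal ((norm (f (s, y)))\<^sup>2) \<partial>lborel) \<partial>lborel)"
    by (rule nn_integral_cmult) measurable
  also have "(\<integral>\<^sup>+s. (\<integral>\<^sup>+y. ennreal ((norm (f (s, y)))\<^sup>2) \<partial>lborel) \<partial>lborel) = (\<integral>\<^sup>+z. ennreal ((norm (f z))\<^sup>2) \<partial>lborel)"
    by (subst lborel_prod[symmetric], subst lborel.nn_integral_fst[symmetric])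
      (auto simp: lborel_prod)
  finally have plancherel: "(\<integral>\<^sup>+\<xi>. (\<integral>\<^sup>+s. ?g s \<xi> \<partial>lborel) \<partial>lborel) \<le> ?P * ?F" .
  have "(\<integral>\<^sup>+t. (\<integral>\<^sup>+\<xi>. (\<integral>\<^sup>+s. H (t - s) \<xi> * ?g s \<xi> \<partial>lborel) \<partial>lborel) \<partial>lborel)
      = (\<integral>\<^sup>+\<xi>. (\<integral>\<^sup>+t. (\<integral>\<^sup>+s. H (t - s) \<xi> * ?g s \<xi> \<partial>lborel) \<partial>lborel) \<partial>lborel)"
    by (rule lborel_pair.Fubini') measurable
  also have "\<dots> = (\<integral>\<^sup>+\<xi>. (\<integral>\<^sup>+s. (\<integral>\<^sup>+t. H (t - s) \<xi> * ?g s \<xi> \<partial>lborel) \<partial>lborel) \<partial>lborel)"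
    by (intro nn_integral_cong lborel_pair.Fubini') measurable
  also have "\<dots> = (\<integral>\<^sup>+\<xi>. (\<integral>\<^sup>+s. (\<integral>\<^sup>+t. H t \<xi> \<partial>lborel) * ?g s \<xi> \<partial>lborel) \<partial>lborel)"
    by (simp add: nn_integral_multc nn_integral_lborel_shift[of "\<lambda>s. H s _"])
  also have "\<dots> \<le> (\<integral>\<^sup>+\<xi>. (\<integral>\<^sup>+s. ennreal M * ?g s \<xi> \<partial>lborel) \<partial>lborel)"
    by (intro nn_integral_mono mult_right_mono H_bound) auto
  also have "\<dots> = ennreal M * (\<integral>\<^sup>+\<xi>. (\<integral>\<^sup>+s. ?g s \<xi> \<partial>lborel) \<partial>lborel)"
    by (simp add: nn_integral_cmult)
  also have "\<dots> \<le> ennreal M * (?P * ?F)"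
    by (intro mult_left_mono plancherel) auto
  finally have triple: "(\<integral>\<^sup>+t. (\<integral>\<^sup>+\<xi>. (\<integral>\<^sup>+s. H (t - s) \<xi> * ?g s \<xi> \<partial>lborel) \<partial>lborel) \<partial>lborel) \<le> ennreal M * (?P * ?F)" .
  have "?P\<^sup>2 * (\<integral>\<^sup>+z. ennreal ((norm (kernel_op f z))\<^sup>2) \<partial>lborel)
      = ?P\<^sup>2 * (\<integral>\<^sup>+t. (\<integral>\<^sup>+x. ennreal ((norm (kernel_op f (t, x)))\<^sup>2) \<partial>lborel) \<partial>lborel)"
    by (subst lborel_prod[symmetric], subst lborel.nn_integral_fst[symmetric])
      (auto simp: lborel_prod)
  also have "\<dots> = (\<integral>\<^sup>+t. ?P\<^sup>2 * (\<integral>\<^sup>+x. ennreal ((norm (kernel_op f (t, x)))\<^sup>2) \<partial>lborel) \<partial>lborel)"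
    by (rule nn_integral_cmult[symmetric]) measurable
  also have "\<dots> \<le> (\<integral>\<^sup>+t. ?P * (ennreal M * (\<integral>\<^sup>+\<xi>. (\<integral>\<^sup>+s. H (t - s) \<xi> * ?g s \<xi> \<partial>lborel) \<partial>lborel)) \<partial>lborel)"
    by (intro nn_integral_mono_AE eventually_mono[OF AE_not_N]) (rule slice)
  also have "\<dots> = ?P * (ennreal M * (\<integral>\<^sup>+t. (\<integral>\<^sup>+\<xi>. (\<integral>\<^sup>+s. H (t - s) \<xi> * ?g s \<xi> \<partial>lborel) \<partial>lborel) \<partial>lborel))"
    by (simp add: nn_integral_cmult)
  also have "\<dots> \<le> ?P * (ennreal M * (ennreal M * (?P * ?F)))"
    by (intro mult_left_mono triple) auto
  also have "\<dots> = ?P\<^sup>2 * (ennreal (M\<^sup>2) * ?F)"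
    using M_nonneg by (simp only: power2_eq_square ennreal_mult mult_ac)
  finally show ?thesis
    using P0 by (subst (asm) ennreal_mult_le_mult_iff) (auto simp: power2_eq_square ennreal_mult_eq_top_iff)
qed

end

section \<open>Mean oscillation\<close>

lemma open_cylinder: "open (cylinder \<gamma> c t x)"
  unfolding cylinder_def by (intro open_Times) auto

lemma emeasure_cylinder:
  assumes "c > 0"
  shows "emeasure lborel (cylinder \<gamma> c t (x :: real ^ 'n))
    = ennreal (2 * c powr \<gamma> * (unit_ball_vol (real CARD('n)) * c ^ CARD('n)))"
proof -
  have "emeasure lborel (cylinder \<gamma> c t x) = emeasure (lborel \<Otimes>\<^sub>M lborel) ({t - c powr \<gamma> <..< t + c powr \<gamma>} \<times> ball x c)"
    by (simp add: cylinder_def lborel_prod)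
  also have "\<dots> = emeasure lborel {t - c powr \<gamma> <..< t + c powr \<gamma>} * emeasure lborel (ball x c)"
    by (rule lborel.emeasure_pair_measure_Times) auto
  also have "\<dots> = ennreal (2 * c powr \<gamma> * (unit_ball_vol (real CARD('n)) * c ^ CARD('n)))"
    using assms by (simp add: emeasure_ball ennreal_mult[symmetric])
  finally show ?thesis .
qed

text \<open>The estimates are asked for only at times outside \<open>N\<close>, since a Borel
  version of a kernel inherits them only there. Causality, in contrast, is imposed
  everywhere.\<close>

locale causal_kernel_estimates = causal_kernel K H N M
  for K :: "real \<Rightarrow> real \<Rightarrow> real ^ 'n \<Rightarrow> complex" and H N M +
  fixes \<gamma> :: real and \<phi> :: "real \<Rightarrow> real"
  assumes \<gamma>_pos: "0 < \<gamma>"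
    and \<phi>_mono: "mono_on {0<..} \<phi>" and \<phi>_nonneg: "\<And>u. 0 < u \<Longrightarrow> 0 \<le> \<phi> u"
    and causal: "\<And>t s x. t \<le> s \<Longrightarrow> K t s x = 0"
    and tail_estimate: "\<And>t r c. t \<notin> N \<Longrightarrow> r < t \<Longrightarrow> 0 < c \<Longrightarrow>
      (\<integral>\<^sup>+\<tau>\<in>{r<..<t}. (\<integral>\<^sup>+z\<in>{z. c \<le> norm z}. ennreal (norm (K t \<tau> z)) \<partial>lborel) \<partial>lborel)
        \<le> ennreal (\<phi> ((t - r) * c powr (- \<gamma>)))"
    and time_estimate: "\<And>t r a. t \<notin> N \<Longrightarrow> r \<notin> N \<Longrightarrow> a < r \<Longrightarrow> r < t \<Longrightarrow>
      (\<integral>\<^sup>+\<tau>\<in>{..<a}. (\<integral>\<^sup>+z. ennreal (norm (K t \<tau> z - K r \<tau> z)) \<partial>lborel) \<partial>lborel)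
        \<le> ennreal (\<phi> ((t - r) / (r - a)))"
    and space_estimate: "\<And>t a h. t \<notin> N \<Longrightarrow> a < t \<Longrightarrow> h \<noteq> 0 \<Longrightarrow>
      (\<integral>\<^sup>+\<tau>\<in>{..<a}. (\<integral>\<^sup>+z. ennreal (norm (K t \<tau> (z + h) - K t \<tau> z)) \<partial>lborel) \<partial>lborel)
        \<le> ennreal (\<phi> (norm h * (t - a) powr (- 1 / \<gamma>)))"
begin

lemma \<phi>_le: "0 < u \<Longrightarrow> u \<le> v \<Longrightarrow> ennreal (\<phi> u) \<le> ennreal (\<phi> v)"
  using \<phi>_mono by (intro ennreal_leI) (auto simp: mono_on_def)

text \<open>Here \<open>c\<close> stands for the time scale of a cylinder. Both times come later
  than a + c and differ by less than 2c, so the quotient in the time estimate is at most 2; the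
  integrand is symmetric in the two times.\<close>

lemma time_difference_le:
  assumes "t \<notin> N" "r \<notin> N" "c > 0" "a + c < t" "a + c < r" "\<bar>t - r\<bar> < 2 * c"
  shows "(\<integral>\<^sup>+\<tau>\<in>{..<a}. (\<integral>\<^sup>+z. ennreal (norm (K t \<tau> z - K r \<tau> z)) \<partial>lborel) \<partial>lborel) \<le> ennreal (\<phi> 2)"
proof -
  have *: "(\<integral>\<^sup>+\<tau>\<in>{..<a}. (\<integral>\<^sup>+z. ennreal (norm (K t \<tau> z - K r \<tau> z)) \<partial>lborel) \<partial>lborel) \<le> ennreal (\<phi> 2)"
    if "t \<notin> N" "r \<notin> N" "r < t" "a + c < r" "t - r < 2 * c" for t r
  proof -
    have "(t - r) / (r - a) \<le> 2"
      using that \<open>c > 0\<close> by (simp add: divide_le_eq)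
    then show ?thesis
      using time_estimate[of t r a] that \<open>c > 0\<close>
      by (intro order.trans[OF time_estimate \<phi>_le]) auto
  qed
  consider "r < t" | "t < r" | "t = r" by linarith
  then show ?thesis
  proof cases
    case 2
    then show ?thesis using *[of r t] assms by (simp add: norm_minus_commute)
  qed (use *[of t r] assms in auto)
qed

text \<open>The quotient is even below 1; it is rounded up to 2 so that time and space differences
  cost the same value of \<phi>.\<close>

lemma space_difference_le:
  assumes "t \<notin> N" "c > 0" "a + c powr \<gamma> < t" "norm h < c"
  shows "(\<integral>\<^sup>+\<tau>\<in>{..<a}. (\<integral>\<^sup>+z. ennreal (norm (K t \<tau> (z + h) - K t \<tau> z)) \<partial>lborel) \<partial>lborel) \<le> ennreal (\<phi> 2)"
proof (cases "h = 0")
  case False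
  have "c = (c powr \<gamma>) powr (1 / \<gamma>)"
    using \<gamma>_pos assms by (simp add: powr_powr)
  also have "\<dots> \<le> (t - a) powr (1 / \<gamma>)"
    using \<gamma>_pos assms by (intro powr_mono2) auto
  finally have *: "c \<le> (t - a) powr (1 / \<gamma>)" .
  have "norm h * (t - a) powr (- 1 / \<gamma>) = norm h / (t - a) powr (1 / \<gamma>)"
    by (simp add: powr_minus_divide)
  also have "\<dots> \<le> 2"
    using * assms by (simp add: divide_le_eq)
  finally have "norm h * (t - a) powr (- 1 / \<gamma>) \<le> 2" .
  moreover have "a < t"
    using assms powr_ge_zero[of c \<gamma>] by linarith
  ultimately show ?thesis
    using False assms by (intro order.trans[OF space_estimate \<phi>_le]) auto
qed simp

lemma tail_le:
  assumes "t \<notin> N" "c > 0" "a < t" "t - a < 3 * c powr \<gamma>"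
  shows "(\<integral>\<^sup>+\<tau>\<in>{a<..<t}. (\<integral>\<^sup>+z\<in>{z. c \<le> norm z}. ennreal (norm (K t \<tau> z)) \<partial>lborel) \<partial>lborel) \<le> ennreal (\<phi> 3)"
proof -
  have "(t - a) * c powr (- \<gamma>) \<le> 3"
    using assms by (simp add: powr_minus_divide divide_le_eq)
  then show ?thesis
    using assms by (intro order.trans[OF tail_estimate \<phi>_le]) auto
qed

text \<open>With a = t0 - 2c^\<gamma>, the contribution of times before a is compared with its value
  at the reference point (r, x0), a constant on the cylinder: passing from t to r and from x to x0
  costs \<open>\<phi> 2\<close> each. Between a and t the input vanishes within 2c of x0, so only
  kernel values at distance at least c count, and the tail estimate costs \<open>\<phi> 3\<close>.
  The time r is left free because the centre may lie in \<open>N\<close>.\<close>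

lemma far_oscillation:
  fixes g :: "real \<times> (real ^ 'n) \<Rightarrow> complex"
  assumes g: "regular g" and B: "\<And>z. norm (g z) \<le> B" and c: "c > 0"
    and t: "t \<notin> N" "\<bar>t - t\<^sub>0\<bar> < c powr \<gamma>" and x: "dist x\<^sub>0 x < c"
    and r: "r \<notin> N" "\<bar>r - t\<^sub>0\<bar> < c powr \<gamma>"
    and g0: "\<And>s y. t\<^sub>0 - 2 * c powr \<gamma> < s \<Longrightarrow> s < t\<^sub>0 + c powr \<gamma> \<Longrightarrow> dist x\<^sub>0 y < 2 * c \<Longrightarrow> g (s, y) = 0"
  shows "norm (kernel_op g (t, x) - (LINT s|lborel. indicator {..<t\<^sub>0 - 2 * c powr \<gamma>} s * (LINT y|lborel. K r s (x\<^sub>0 - y) * g (s, y))))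
    \<le> (\<phi> 3 + 2 * \<phi> 2) * B"
proof -
  define a where "a = t\<^sub>0 - 2 * c powr \<gamma>"
  have c\<gamma>: "0 < c powr \<gamma>" using c by simp
  have ar: "a + c powr \<gamma> < r" "a + c powr \<gamma> < t" "a < t" "t - a < 3 * c powr \<gamma>" "\<bar>t - r\<bar> < 2 * c powr \<gamma>"
    using t r c\<gamma> by (auto simp: a_def)
  have B0: "0 \<le> B" using order.trans[OF norm_ge_zero B] .
  have gm: "g \<in> borel_measurable borel"
    using g by (auto simp: regular_def)
  note [measurable] = input_measurable[OF gm]
  let ?h = "x - x\<^sub>0"
  let ?D1 = "\<lambda>s. \<integral>\<^sup>+z. ennreal (norm (K t s z - K r s z)) \<partial>lborel"
  let ?D2 = "\<lambda>s. \<integral>\<^sup>+z. ennreal (norm (K r s (z + ?h) - K r s z)) \<partial>lborel"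
  let ?E = "\<lambda>s. \<integral>\<^sup>+z\<in>{z. c \<le> norm z}. ennreal (norm (K t s z)) \<partial>lborel"
  let ?u = "\<lambda>s. LINT y|lborel. K t s (x - y) * g (s, y)"
  let ?v = "\<lambda>s. LINT y|lborel. K r s (x\<^sub>0 - y) * g (s, y)"
  have ip: "integrable lborel (\<lambda>y. K t' s (x' - y) * g (s, y))" for t' s x'
  proof (rule Bochner_Integration.integrable_bound)
    show "integrable lborel (\<lambda>y. K t' s (x' - y) * complex_of_real B)"
      by (intro integrable_mult_left integrable_lborel_diff K_integrable)
    show "AE y in lborel. norm (K t' s (x' - y) * g (s, y)) \<le> norm (K t' s (x' - y) * complex_of_real B)"
      by (auto simp: norm_mult intro!: mult_left_mono order.trans[OF B])
  qed measurable
  \<comment> \<open>The intermediate kernel has the new time r and the old position x, which splits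
    the difference into a pure time part and a pure space part.\<close>
  have past: "ennreal (norm (?u s - ?v s)) \<le> ennreal B * (?D1 s + ?D2 s)" if "s < a" for s
  proof -
    have "?u s - ?v s = (LINT y|lborel. (K t s (x - y) - K r s (x\<^sub>0 - y)) * g (s, y))"
      using ip by (simp add: left_diff_distrib)
    then have "ennreal (norm (?u s - ?v s)) \<le> (\<integral>\<^sup>+y. ennreal (norm ((K t s (x - y) - K r s (x\<^sub>0 - y)) * g (s, y))) \<partial>lborel)"
      by (simp only: ennreal_norm_integral_le)
    also have "\<dots> \<le> (\<integral>\<^sup>+y. ennreal B * (ennreal (norm (K t s (x - y) - K r s (x - y))) + ennreal (norm (K r s (x\<^sub>0 - y + ?h) - K r s (x\<^sub>0 - y)))) \<partial>lborel)"
    proof (rule nn_integral_mono)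
      fix y
      have "norm (K t s (x - y) - K r s (x\<^sub>0 - y)) \<le> norm (K t s (x - y) - K r s (x - y)) + norm (K r s (x\<^sub>0 - y + ?h) - K r s (x\<^sub>0 - y))"
        using norm_triangle_ineq[of "K t s (x - y) - K r s (x - y)" "K r s (x\<^sub>0 - y + ?h) - K r s (x\<^sub>0 - y)"] by simp
      then have "norm ((K t s (x - y) - K r s (x\<^sub>0 - y)) * g (s, y)) \<le> (norm (K t s (x - y) - K r s (x - y)) + norm (K r s (x\<^sub>0 - y + ?h) - K r s (x\<^sub>0 - y))) * B"
        unfolding norm_mult by (intro mult_mono B) auto
      then have "ennreal (norm ((K t s (x - y) - K r s (x\<^sub>0 - y)) * g (s, y))) \<le> ennreal ((norm (K t s (x - y) - K r s (x - y)) + norm (K r s (x\<^sub>0 - y + ?h) - K r s (x\<^sub>0 - y))) * B)"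
        by (rule ennreal_leI)
      also have "\<dots> = ennreal B * (ennreal (norm (K t s (x - y) - K r s (x - y))) + ennreal (norm (K r s (x\<^sub>0 - y + ?h) - K r s (x\<^sub>0 - y))))"
        using B0 by (simp only: ennreal_mult ennreal_plus norm_ge_zero add_nonneg_nonneg mult.commute)
      finally show "ennreal (norm ((K t s (x - y) - K r s (x\<^sub>0 - y)) * g (s, y)))
        \<le> ennreal B * (ennreal (norm (K t s (x - y) - K r s (x - y))) + ennreal (norm (K r s (x\<^sub>0 - y + ?h) - K r s (x\<^sub>0 - y))))" .
    qed
    also have "\<dots> = ennreal B * ((\<integral>\<^sup>+y. ennreal (norm (K t s (x - y) - K r s (x - y))) \<partial>lborel)
        + (\<integral>\<^sup>+y. ennreal (norm (K r s (x\<^sub>0 - y + ?h) - K r s (x\<^sub>0 - y))) \<partial>lborel))"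
      by (subst nn_integral_cmult, measurable) (subst nn_integral_add, measurable)
    also have "(\<integral>\<^sup>+y. ennreal (norm (K t s (x - y) - K r s (x - y))) \<partial>lborel) = ?D1 s"
      by (rule nn_integral_lborel_diff) measurable
    also have "(\<integral>\<^sup>+y. ennreal (norm (K r s (x\<^sub>0 - y + ?h) - K r s (x\<^sub>0 - y))) \<partial>lborel) = ?D2 s"
      by (rule nn_integral_lborel_diff[of "\<lambda>z. ennreal (norm (K r s (z + ?h) - K r s z))"]) measurable
    finally show ?thesis .
  qed
  have recent: "ennreal (norm (?u s)) \<le> ennreal B * ?E s" if "a < s" "s < t" for s
  proof -
    have "ennreal (norm (?u s)) \<le> (\<integral>\<^sup>+y. ennreal (norm (K t s (x - y) * g (s, y))) \<partial>lborel)"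
      by (rule ennreal_norm_integral_le)
    also have "\<dots> \<le> (\<integral>\<^sup>+y. ennreal B * (ennreal (norm (K t s (x - y))) * indicator {z. c \<le> norm z} (x - y)) \<partial>lborel)"
    proof (rule nn_integral_mono)
      fix y
      show "ennreal (norm (K t s (x - y) * g (s, y))) \<le> ennreal B * (ennreal (norm (K t s (x - y))) * indicator {z. c \<le> norm z} (x - y))"
      proof (cases "dist x\<^sub>0 y < 2 * c")
        case True
        then have "g (s, y) = 0"
          using that t g0[of s y] by (auto simp: a_def)
        then show ?thesis by simp
      next
        case False
        then have "c \<le> norm (x - y)"
          using x dist_triangle[of x\<^sub>0 y x] by (auto simp: dist_norm)
        moreover have "ennreal (norm (K t s (x - y) * g (s, y))) \<le> ennreal (B * norm (K t s (x - y)))"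
          unfolding norm_mult using B by (intro ennreal_leI) (auto simp: mult.commute[of B] intro!: mult_left_mono)
        ultimately show ?thesis
          using B0 by (simp add: ennreal_mult)
      qed
    qed
    also have "\<dots> = ennreal B * (\<integral>\<^sup>+y. ennreal (norm (K t s (x - y))) * indicator {z. c \<le> norm z} (x - y) \<partial>lborel)"
      by (rule nn_integral_cmult) measurable
    also have "(\<integral>\<^sup>+y. ennreal (norm (K t s (x - y))) * indicator {z. c \<le> norm z} (x - y) \<partial>lborel) = ?E s"
      by (rule nn_integral_lborel_diff[of "\<lambda>z. ennreal (norm (K t s z)) * indicator {z. c \<le> norm z} z"]) measurable
    finally show ?thesis .
  qed
  have iu: "integrable lborel ?u"
    by (rule integrable_op[OF t(1) g])
  have iv: "integrable lborel (\<lambda>s. indicator {..<a} s * ?v s)"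
    by (rule Bochner_Integration.integrable_bound[OF integrable_op[OF r(1) g, of x\<^sub>0]])
      (auto simp: indicator_def)
  have "ennreal (norm (kernel_op g (t, x) - (LINT s|lborel. indicator {..<a} s * ?v s)))
      = ennreal (norm (LINT s|lborel. ?u s - indicator {..<a} s * ?v s))"
    using iu iv by (simp add: kernel_op_def)
  also have "\<dots> \<le> (\<integral>\<^sup>+s. ennreal (norm (?u s - indicator {..<a} s * ?v s)) \<partial>lborel)"
    by (rule ennreal_norm_integral_le)
  also have "\<dots> \<le> (\<integral>\<^sup>+s. ennreal B * ((?D1 s * indicator {..<a} s + ?D2 s * indicator {..<a} s) + ?E s * indicator {a<..<t} s) \<partial>lborel)"
  proof (rule nn_integral_mono_AE)
    show "AE s in lborel. ennreal (norm (?u s - indicator {..<a} s * ?v s))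
        \<le> ennreal B * ((?D1 s * indicator {..<a} s + ?D2 s * indicator {..<a} s) + ?E s * indicator {a<..<t} s)"
      \<comment> \<open>The single time a belongs to neither part of the splitting.\<close>
      using AE_lborel_singleton[of a]
    proof eventually_elim
      case (elim s)
      consider "s < a" | "a < s" "s < t" | "t \<le> s" using elim by linarith
      then show ?case
      proof cases
        case 3
        then have "?u s = 0" by (simp add: causal)
        then show ?thesis using 3 ar by (simp add: indicator_def)
      qed (use past recent ar in \<open>auto simp: indicator_def\<close>)
    qed
  qed
  also have "\<dots> = ennreal B * ((\<integral>\<^sup>+s\<in>{..<a}. ?D1 s \<partial>lborel) + (\<integral>\<^sup>+s\<in>{..<a}. ?D2 s \<partial>lborel) + (\<integral>\<^sup>+s\<in>{a<..<t}. ?E s \<partial>lborel))"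
    by (subst nn_integral_cmult, measurable) (subst nn_integral_add, measurable, subst nn_integral_add, measurable)
  also have "\<dots> \<le> ennreal B * (ennreal (\<phi> 2) + ennreal (\<phi> 2) + ennreal (\<phi> 3))"
  proof (intro mult_left_mono add_mono)
    show "(\<integral>\<^sup>+s\<in>{..<a}. ?D1 s \<partial>lborel) \<le> ennreal (\<phi> 2)"
      using t(1) r(1) c\<gamma> ar by (intro time_difference_le) auto
    show "(\<integral>\<^sup>+s\<in>{..<a}. ?D2 s \<partial>lborel) \<le> ennreal (\<phi> 2)"
      using r(1) c ar x by (intro space_difference_le) (auto simp: dist_norm norm_minus_commute)
    show "(\<integral>\<^sup>+s\<in>{a<..<t}. ?E s \<partial>lborel) \<le> ennreal (\<phi> 3)"
      using t(1) c ar by (intro tail_le) auto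
  qed simp
  also have "\<dots> = ennreal ((\<phi> 3 + 2 * \<phi> 2) * B)"
    using B0 \<phi>_nonneg[of 2] \<phi>_nonneg[of 3]
    by (simp add: ennreal_plus[symmetric] ennreal_mult[symmetric] mult_ac del: ennreal_plus)
  finally show ?thesis
    using B0 \<phi>_nonneg[of 2] \<phi>_nonneg[of 3] by (simp add: a_def)
qed

lemma AE_fst_not_N: "AE z in (lborel :: (real \<times> (real ^ 'n)) measure). fst z \<notin> N"
proof -
  have [measurable]: "N \<in> sets borel"
    using N_null by auto
  have "AE z in lborel \<Otimes>\<^sub>M (lborel :: (real ^ 'n) measure). fst z \<notin> N"
  proof (rule lborel_pair.AE_pair_measure)
    show "{z \<in> space (lborel \<Otimes>\<^sub>M (lborel :: (real ^ 'n) measure)). fst z \<notin> N} \<in> sets (lborel \<Otimes>\<^sub>M lborel)"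
      by measurable
    show "AE t in lborel. AE x in (lborel :: (real ^ 'n) measure). fst (t, x) \<notin> N"
      using AE_not_N by eventually_elim simp
  qed
  then show ?thesis unfolding lborel_prod .
qed

text \<open>The far part contributes the values of \<open>\<phi>\<close>; the rest is the near part, whose mean is
  at most \<open>B\<close> plus \<open>1 / B\<close> times its mean square.\<close>

definition bmo_const :: real where
  "bmo_const = 1 + M\<^sup>2 * (3 / 2 * 4 ^ CARD('n)) + (\<phi> 3 + 2 * \<phi> 2)"

text \<open>The cutoff is arranged so that the remainder \<open>f2\<close> vanishes exactly where
  \<open>far_oscillation\<close> demands it. The constant \<kappa> comes from there;
  \<open>mean_oscillation_le\<close> later passes to the mean, while \<open>good_lambda_box\<close>
  uses \<kappa> as it is.\<close>

lemma kernel_op_oscillation: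
  fixes f :: "real \<times> (real ^ 'n) \<Rightarrow> complex"
  assumes f: "regular f" and B: "\<And>z. norm (f z) \<le> B" "B > 0" and c: "c > 0"
  shows "\<exists>\<kappa>. (\<integral>\<^sup>+z\<in>cylinder \<gamma> c t\<^sub>0 x\<^sub>0. ennreal (norm (kernel_op f z - \<kappa>)) \<partial>lborel)
    \<le> ennreal (bmo_const * B) * emeasure lborel (cylinder \<gamma> c t\<^sub>0 x\<^sub>0)"
proof -
  let ?Q = "cylinder \<gamma> c t\<^sub>0 x\<^sub>0"
  have c\<gamma>: "0 < c powr \<gamma>" using c by simp
  define I where "I = {t\<^sub>0 - 2 * c powr \<gamma> <..< t\<^sub>0 + c powr \<gamma>}"
  obtain m \<eta> :: "real ^ 'n \<Rightarrow> complex" where m: "integrable lborel m" and \<eta>: "\<And>y. \<eta> y = (LINT \<zeta>|lborel. wave y \<zeta> * m \<zeta>)"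
    and \<eta>1: "\<And>y. norm (\<eta> y) \<le> 1" and \<eta>2: "\<And>y. norm (1 - \<eta> y) \<le> 1"
    and inside: "\<And>y. dist x\<^sub>0 y < 2 * c \<Longrightarrow> \<eta> y = 1" and outside: "\<And>y. 4 * c \<le> dist x\<^sub>0 y \<Longrightarrow> \<eta> y = 0"
    by (rule smooth_cutoff_exists[OF c, of x\<^sub>0]) (rule that)
  define f1 where "f1 = (\<lambda>(s, y). indicator I s * (\<eta> y * f (s, y)))"
  define f2 where "f2 = (\<lambda>z. f z - f1 z)"
  have f1: "regular f1"
    unfolding f1_def by (rule regular_cutoff[OF f _ m \<eta> \<eta>1]) (simp add: I_def)
  have f2: "regular f2"
    unfolding f2_def by (rule regular_diff[OF f f1])
  have f1m: "f1 \<in> borel_measurable borel" and fm: "f \<in> borel_measurable borel"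
    using f f1 by (auto simp: regular_def)
  note [measurable] = kernel_op_borel_measurable[OF f1m] kernel_op_borel_measurable[OF fm] f1m fm
  have Qm [measurable]: "?Q \<in> sets borel"
    by (rule borel_open[OF open_cylinder])
  have f2B: "norm (f2 z) \<le> B" for z
  proof -
    obtain s y where z: "z = (s, y)" by (cases z)
    have "f2 (s, y) = (if s \<in> I then (1 - \<eta> y) * f (s, y) else f (s, y))"
      by (simp add: f2_def f1_def algebra_simps)
    then show ?thesis
      using B(1)[of "(s, y)"] mult_left_le_one_le[OF norm_ge_zero norm_ge_zero \<eta>2[of y], of "f (s, y)"]
      by (simp add: z norm_mult)
  qed
  have f20: "f2 (s, y) = 0" if "t\<^sub>0 - 2 * c powr \<gamma> < s" "s < t\<^sub>0 + c powr \<gamma>" "dist x\<^sub>0 y < 2 * c" for s y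
    using that by (simp add: f2_def f1_def I_def inside)
  \<comment> \<open>An interval of positive length is not contained in the null set
    \<open>N\<close>.\<close>
  obtain r where r: "r \<notin> N" "\<bar>r - t\<^sub>0\<bar> < c powr \<gamma>"
  proof -
    have "\<not> {t\<^sub>0 - c powr \<gamma> <..< t\<^sub>0 + c powr \<gamma>} \<subseteq> N"
    proof
      assume "{t\<^sub>0 - c powr \<gamma> <..< t\<^sub>0 + c powr \<gamma>} \<subseteq> N"
      then have "emeasure lborel {t\<^sub>0 - c powr \<gamma> <..< t\<^sub>0 + c powr \<gamma>} \<le> emeasure lborel N"
        using N_null by (intro emeasure_mono) auto
      then show False
        using N_null c\<gamma> by (simp add: null_setsD1 ennreal_eq_0_iff)
    qed
    then obtain r where "r \<in> {t\<^sub>0 - c powr \<gamma> <..< t\<^sub>0 + c powr \<gamma>}" "r \<notin> N" by blast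
    then show ?thesis by (intro that[of r]) auto
  qed
  define \<kappa> where "\<kappa> = (LINT s|lborel. indicator {..<t\<^sub>0 - 2 * c powr \<gamma>} s * (LINT y|lborel. K r s (x\<^sub>0 - y) * f2 (s, y)))"
  let ?C2 = "\<phi> 3 + 2 * \<phi> 2"
  have C20: "0 \<le> ?C2" using \<phi>_nonneg[of 2] \<phi>_nonneg[of 3] by simp
  have far: "norm (kernel_op f2 (t, x) - \<kappa>) \<le> ?C2 * B" if "t \<notin> N" "(t, x) \<in> ?Q" for t x
    unfolding \<kappa>_def using that
    by (intro far_oscillation[OF f2 f2B c that(1) _ _ r f20]) (auto simp: cylinder_def)
  have "(\<integral>\<^sup>+z\<in>?Q. ennreal (norm (kernel_op f z - \<kappa>)) \<partial>lborel)
      \<le> (\<integral>\<^sup>+z. ennreal ((1 + ?C2) * B) * indicator ?Q z + ennreal (1 / B) * ennreal ((norm (kernel_op f1 z))\<^sup>2) \<partial>lborel)"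
  proof (rule nn_integral_mono_AE)
    show "AE z in lborel. ennreal (norm (kernel_op f z - \<kappa>)) * indicator ?Q z
        \<le> ennreal ((1 + ?C2) * B) * indicator ?Q z + ennreal (1 / B) * ennreal ((norm (kernel_op f1 z))\<^sup>2)"
      using AE_fst_not_N
    proof eventually_elim
      case (elim z)
      obtain t x where z: "z = (t, x)" by (cases z)
      have t: "t \<notin> N" using elim z by simp
      show ?case
      proof (cases "z \<in> ?Q")
        case True
        have "kernel_op f2 (t, x) = kernel_op f (t, x) - kernel_op f1 (t, x)"
          unfolding f2_def by (rule kernel_op_diff[OF t f f1])
        then have "norm (kernel_op f z - \<kappa>) \<le> norm (kernel_op f1 z) + ?C2 * B"
          using far[OF t, of x] True norm_triangle_ineq[of "kernel_op f1 (t, x)" "kernel_op f2 (t, x) - \<kappa>"] by (simp add: z)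
        \<comment> \<open>From 2ab \<le> a^2 + b^2 with b = B. The square may then be integrated
          over the whole space, where the L2 bound applies.\<close>
        moreover have "norm (kernel_op f1 z) \<le> B + 1 / B * (norm (kernel_op f1 z))\<^sup>2"
        proof -
          have "0 \<le> norm (kernel_op f1 z) * B"
            using B(2) by simp
          then have "norm (kernel_op f1 z) * B \<le> B * B + (norm (kernel_op f1 z))\<^sup>2"
            using sum_squares_bound[of "norm (kernel_op f1 z)" B] unfolding power2_eq_square by linarith
          then show ?thesis using B(2) by (simp add: field_simps)
        qed
        ultimately have "norm (kernel_op f z - \<kappa>) \<le> (1 + ?C2) * B + 1 / B * (norm (kernel_op f1 z))\<^sup>2"
          by (simp add: algebra_simps)
        then have "ennreal (norm (kernel_op f z - \<kappa>)) \<le> ennreal ((1 + ?C2) * B + 1 / B * (norm (kernel_op f1 z))\<^sup>2)"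
          by (rule ennreal_leI)
        also have "\<dots> = ennreal ((1 + ?C2) * B) + ennreal (1 / B) * ennreal ((norm (kernel_op f1 z))\<^sup>2)"
          using B(2) C20 by (subst ennreal_plus) (auto simp: ennreal_mult'[symmetric])
        finally show ?thesis using True by simp
      qed simp
    qed
  qed
  also have "\<dots> = ennreal ((1 + ?C2) * B) * emeasure lborel ?Q + ennreal (1 / B) * (\<integral>\<^sup>+z. ennreal ((norm (kernel_op f1 z))\<^sup>2) \<partial>lborel)"
    by (subst nn_integral_add) (auto simp: nn_integral_cmult)
  also have "(\<integral>\<^sup>+z. ennreal ((norm (kernel_op f1 z))\<^sup>2) \<partial>lborel) \<le> ennreal (M\<^sup>2) * (\<integral>\<^sup>+z. ennreal ((norm (f1 z))\<^sup>2) \<partial>lborel)"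
    by (rule kernel_op_L2_bound[OF f1])
  also have "(\<integral>\<^sup>+z. ennreal ((norm (f1 z))\<^sup>2) \<partial>lborel) \<le> (\<integral>\<^sup>+z. ennreal (B\<^sup>2) * indicator (I \<times> ball x\<^sub>0 (4 * c)) z \<partial>lborel)"
  proof (rule nn_integral_mono)
    fix z :: "real \<times> (real ^ 'n)"
    obtain s y where z: "z = (s, y)" by (cases z)
    have "norm (f1 z) \<le> B"
      using B(1)[of "(s, y)"] mult_left_le_one_le[OF norm_ge_zero norm_ge_zero \<eta>1[of y], of "f (s, y)"] B(2)
      by (simp add: z f1_def norm_mult indicator_def)
    then have "ennreal ((norm (f1 z))\<^sup>2) \<le> ennreal (B\<^sup>2)"
      by (intro ennreal_leI power_mono) auto
    moreover have "f1 z = 0" if "z \<notin> I \<times> ball x\<^sub>0 (4 * c)"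
      using that by (auto simp: z f1_def outside)
    ultimately show "ennreal ((norm (f1 z))\<^sup>2) \<le> ennreal (B\<^sup>2) * indicator (I \<times> ball x\<^sub>0 (4 * c)) z"
      by (cases "z \<in> I \<times> ball x\<^sub>0 (4 * c)") auto
  qed
  also have "\<dots> = ennreal (B\<^sup>2) * emeasure lborel (I \<times> ball x\<^sub>0 (4 * c))"
    by (rule nn_integral_cmult_indicator) (auto simp: I_def intro!: borel_open open_Times)
  \<comment> \<open>The interval \<open>I\<close> has length 3c^\<gamma> against 2c^\<gamma> for the
    cylinder, and the ball has four times its radius.\<close>
  also have "emeasure lborel (I \<times> ball x\<^sub>0 (4 * c)) = ennreal (3 / 2 * 4 ^ CARD('n)) * emeasure lborel ?Q"
  proof -
    have "emeasure lborel (I \<times> ball x\<^sub>0 (4 * c)) = emeasure (lborel \<Otimes>\<^sub>M lborel) (I \<times> ball x\<^sub>0 (4 * c))"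
      by (simp add: lborel_prod)
    also have "\<dots> = emeasure lborel I * emeasure lborel (ball x\<^sub>0 (4 * c))"
      by (rule lborel.emeasure_pair_measure_Times) (auto simp: I_def)
    also have "\<dots> = ennreal (3 / 2 * 4 ^ CARD('n)) * emeasure lborel ?Q"
      using c by (simp add: I_def emeasure_ball emeasure_cylinder ennreal_mult[symmetric] power_mult_distrib)
    finally show ?thesis .
  qed
  also have "ennreal ((1 + ?C2) * B) * emeasure lborel ?Q + ennreal (1 / B) * (ennreal (M\<^sup>2) * (ennreal (B\<^sup>2) * (ennreal (3 / 2 * 4 ^ CARD('n)) * emeasure lborel ?Q)))
      = (ennreal ((1 + ?C2) * B) + ennreal (1 / B) * ennreal (M\<^sup>2) * ennreal (B\<^sup>2) * ennreal (3 / 2 * 4 ^ CARD('n))) * emeasure lborel ?Q"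
    by (simp only: distrib_right mult.assoc)
  also have "ennreal ((1 + ?C2) * B) + ennreal (1 / B) * ennreal (M\<^sup>2) * ennreal (B\<^sup>2) * ennreal (3 / 2 * 4 ^ CARD('n))
      = ennreal ((1 + ?C2) * B + 1 / B * M\<^sup>2 * B\<^sup>2 * (3 / 2 * 4 ^ CARD('n)))"
    using B(2) C20 by (subst ennreal_plus) (auto simp: ennreal_mult[symmetric])
  also have "(1 + ?C2) * B + 1 / B * M\<^sup>2 * B\<^sup>2 * (3 / 2 * 4 ^ CARD('n)) = bmo_const * B"
    using B(2) by (simp add: bmo_const_def field_simps power2_eq_square)
  finally have "(\<integral>\<^sup>+z\<in>?Q. ennreal (norm (kernel_op f z - \<kappa>)) \<partial>lborel) \<le> ennreal (bmo_const * B) * emeasure lborel ?Q"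
    by (simp add: mult_left_mono)
  then show ?thesis ..
qed

end

section \<open>Anisotropic dyadic boxes\<close>

definition dyadic :: "int \<Rightarrow> real \<Rightarrow> int" where
  "dyadic k x = \<lfloor>2 powr real_of_int k * x\<rfloor>"

lemma dyadic_measurable [measurable]: "dyadic k \<in> measurable borel (count_space UNIV)"
  unfolding dyadic_def[abs_def] by measurable

text \<open>The index at the coarser level is the integer quotient of the finer index by a power of
  2, hence determined by it.\<close>

lemma dyadic_nested:
  assumes "k \<le> l" "dyadic l x = dyadic l y"
  shows "dyadic k x = dyadic k y"
proof -
  define b :: int where "b = 2 ^ nat (l - k)"
  have "real_of_int b = 2 powr real_of_int (l - k)"
    using assms(1) by (subst powr_real_of_int) (auto simp: b_def)
  then have eq: "2 powr real_of_int k * u = (2 powr real_of_int l * u) / real_of_int b" for u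
    by (simp add: powr_diff)
  have "0 \<le> b" by (simp add: b_def)
  then have "dyadic k u = dyadic l u div b" for u
    unfolding dyadic_def eq by (rule floor_divide_real_eq_div)
  then show ?thesis using assms(2) by simp
qed

lemma dyadic_eq_iff:
  "dyadic k x = j \<longleftrightarrow> real_of_int j * 2 powr - real_of_int k \<le> x \<and> x < (real_of_int j + 1) * 2 powr - real_of_int k"
  unfolding dyadic_def floor_eq_iff by (simp add: powr_minus field_simps)

lemma dyadic_eq_close:
  assumes "dyadic k x = dyadic k y"
  shows "\<bar>x - y\<bar> < 2 powr - real_of_int k"
  using assms dyadic_eq_iff[of k x "dyadic k y"] dyadic_eq_iff[of k y "dyadic k y"]
  by (auto simp: algebra_simps abs_less_iff)

text \<open>Side length \<open>2\<^sup>-\<^sup>k\<close> in space corresponds to \<open>2\<^sup>-\<^sup>k\<^sup>\<gamma>\<close> in time; rounding the exponent keeps the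
  boxes nested.\<close>

definition time_level :: "real \<Rightarrow> int \<Rightarrow> int" where
  "time_level \<gamma> k = \<lfloor>real_of_int k * \<gamma>\<rfloor>"

text \<open>A box is given by one of its points. Membership is equality of indices, an equivalence
  relation at each level, so each level is a partition and \<open>gridbox_eq\<close> is
  immediate.\<close>

definition gridbox :: "real \<Rightarrow> int \<Rightarrow> real \<times> (real ^ 'n) \<Rightarrow> (real \<times> (real ^ 'n)) set" where
  "gridbox \<gamma> k z = {t. dyadic (time_level \<gamma> k) t = dyadic (time_level \<gamma> k) (fst z)}
    \<times> {x. \<forall>i. dyadic k (x $ i) = dyadic k (snd z $ i)}"

lemma gridbox_self: "z \<in> gridbox \<gamma> k z"
  by (cases z) (simp add: gridbox_def)

lemma gridbox_eq: "w \<in> gridbox \<gamma> k z \<Longrightarrow> gridbox \<gamma> k w = gridbox \<gamma> k z"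
  by (auto simp: gridbox_def)

lemma gridbox_nested:
  assumes "0 < \<gamma>" "k \<le> l"
  shows "gridbox \<gamma> l z \<subseteq> gridbox \<gamma> k z"
proof -
  have "time_level \<gamma> k \<le> time_level \<gamma> l"
    unfolding time_level_def using assms by (intro floor_mono mult_right_mono) auto
  note le = dyadic_nested[OF this] dyadic_nested[OF assms(2)]
  show ?thesis
  proof
    fix w assume "w \<in> gridbox \<gamma> l z"
    then have w: "dyadic (time_level \<gamma> l) (fst w) = dyadic (time_level \<gamma> l) (fst z)"
      "\<And>i. dyadic l (snd w $ i) = dyadic l (snd z $ i)"
      by (auto simp: gridbox_def)
    have "dyadic (time_level \<gamma> k) (fst w) = dyadic (time_level \<gamma> k) (fst z)"
      "\<And>i. dyadic k (snd w $ i) = dyadic k (snd z $ i)"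
      by (rule le(1)[OF w(1)]) (rule le(2)[OF w(2)])
    then show "w \<in> gridbox \<gamma> k z"
      by (cases w) (simp add: gridbox_def)
  qed
qed

lemma gridbox_borel [measurable]: "gridbox \<gamma> k (z :: real \<times> (real ^ 'n)) \<in> sets borel"
proof -
  have "{t. dyadic (time_level \<gamma> k) t = dyadic (time_level \<gamma> k) (fst z)} \<in> sets borel"
    by measurable
  moreover have "{x :: real ^ 'n. \<forall>i. dyadic k (x $ i) = dyadic k (snd z $ i)} \<in> sets borel"
    by measurable
  ultimately show ?thesis
    unfolding gridbox_def borel_prod[symmetric] by (rule pair_measureI)
qed

lemma emeasure_gridbox:
  fixes z :: "real \<times> (real ^ 'n)"
  shows "emeasure lborel (gridbox \<gamma> k z)
    = ennreal (2 powr - real_of_int (time_level \<gamma> k) * (2 powr - real_of_int k) ^ CARD('n))"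
proof -
  let ?l = "time_level \<gamma> k"
  let ?T = "{t. dyadic ?l t = dyadic ?l (fst z)}"
  let ?X = "{x :: real ^ 'n. \<forall>i. dyadic k (x $ i) = dyadic k (snd z $ i)}"
  let ?h = "2 powr - real_of_int k"
  have "?T = {real_of_int (dyadic ?l (fst z)) * 2 powr - real_of_int ?l ..< (real_of_int (dyadic ?l (fst z)) + 1) * 2 powr - real_of_int ?l}"
    by (auto simp: dyadic_eq_iff)
  then have T: "emeasure lborel ?T = ennreal (2 powr - real_of_int ?l)"
    by (simp add: distrib_right)
  define a :: "real ^ 'n" where "a = (\<chi> i. real_of_int (dyadic k (snd z $ i)) * ?h)"
  define b :: "real ^ 'n" where "b = (\<chi> i. (real_of_int (dyadic k (snd z $ i)) + 1) * ?h)"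
  have [measurable]: "?X \<in> sets borel" by measurable
  have ab: "(b - a) \<bullet> e = ?h" if "e \<in> Basis" for e :: "real ^ 'n"
    using that by (auto simp: a_def b_def Basis_vec_def inner_axis distrib_right)
  then have le: "a \<bullet> e \<le> b \<bullet> e" if "e \<in> Basis" for e :: "real ^ 'n"
    using ab[OF that] powr_ge_zero[of 2 "- real_of_int k"] unfolding inner_diff_left by linarith
  \<comment> \<open>The set is half-open in every coordinate and is squeezed between an open and a
    closed box of equal volume.\<close>
  have "box a b \<subseteq> ?X"
    by (auto simp: mem_box_cart dyadic_eq_iff a_def b_def less_imp_le)
  then have "emeasure lborel (box a b) \<le> emeasure lborel ?X"
    by (intro emeasure_mono) auto
  moreover have "?X \<subseteq> cbox a b"
    by (auto simp: mem_box_cart dyadic_eq_iff a_def b_def less_imp_le)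
  then have "emeasure lborel ?X \<le> emeasure lborel (cbox a b)"
    by (intro emeasure_mono) auto
  ultimately have X: "emeasure lborel ?X = ennreal (?h ^ CARD('n))"
    using le ab by (simp add: emeasure_lborel_box emeasure_lborel_cbox)
  have "emeasure lborel (gridbox \<gamma> k z) = emeasure (lborel \<Otimes>\<^sub>M lborel) (?T \<times> ?X)"
    by (simp add: gridbox_def lborel_prod)
  also have "\<dots> = emeasure lborel ?T * emeasure lborel ?X"
    by (rule lborel.emeasure_pair_measure_Times) auto
  finally show ?thesis
    by (simp add: T X ennreal_mult)
qed

lemma emeasure_gridbox_pos_finite:
  "emeasure lborel (gridbox \<gamma> k z) \<noteq> 0" "emeasure lborel (gridbox \<gamma> k z) \<noteq> \<infinity>"
  by (simp_all add: emeasure_gridbox)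

lemma countable_gridboxes: "countable (range (\<lambda>(k, z :: real \<times> (real ^ 'n)). gridbox \<gamma> k z))"
proof -
  let ?B = "\<lambda>(k, j, J :: int ^ 'n). {t. dyadic (time_level \<gamma> k) t = j} \<times> {x :: real ^ 'n. \<forall>i. dyadic k (x $ i) = J $ i}"
  have eq: "gridbox \<gamma> k z = ?B (k, dyadic (time_level \<gamma> k) (fst z), \<chi> i. dyadic k (snd z $ i))" for k and z :: "real \<times> (real ^ 'n)"
    by (simp add: gridbox_def)
  have "range (\<lambda>(k, z :: real \<times> (real ^ 'n)). gridbox \<gamma> k z) \<subseteq> range ?B"
  proof (intro image_subsetI)
    fix x :: "int \<times> real \<times> (real ^ 'n)"
    obtain k z where x: "x = (k, z)" by (cases x)
    show "(case x of (k, z) \<Rightarrow> gridbox \<gamma> k z) \<in> range ?B"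
      unfolding x case_prod_conv by (subst eq) (rule rangeI)
  qed
  then show ?thesis
    by (rule countable_subset) (rule countable_image[OF countableI_type])
qed

text \<open>Bounds the volume of a parent box by that of its child: each of the n space sides
  doubles, and the time level, being rounded, drops by at most \<open>\<gamma> + 1\<close>.\<close>

definition grid_ratio :: "real \<Rightarrow> nat \<Rightarrow> real" where
  "grid_ratio \<gamma> n = 2 powr (\<gamma> + 1 + real n)"

lemma emeasure_parent_le:
  fixes z :: "real \<times> (real ^ 'n)"
  shows "emeasure lborel (gridbox \<gamma> (k - 1) z) \<le> ennreal (grid_ratio \<gamma> CARD('n)) * emeasure lborel (gridbox \<gamma> k z)"
proof -
  have "real_of_int (time_level \<gamma> k) - real_of_int (time_level \<gamma> (k - 1)) \<le> \<gamma> + 1"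
    unfolding time_level_def by (simp add: algebra_simps) linarith
  then have "- real_of_int (time_level \<gamma> (k - 1)) + real CARD('n) * (- real_of_int (k - 1))
      \<le> (\<gamma> + 1 + real CARD('n)) + (- real_of_int (time_level \<gamma> k) + real CARD('n) * (- real_of_int k))"
    by (simp add: algebra_simps)
  then have "2 powr (- real_of_int (time_level \<gamma> (k - 1)) + real CARD('n) * (- real_of_int (k - 1)))
      \<le> 2 powr ((\<gamma> + 1 + real CARD('n)) + (- real_of_int (time_level \<gamma> k) + real CARD('n) * (- real_of_int k)))"
    by (rule powr_mono) simp
  then have "2 powr - real_of_int (time_level \<gamma> (k - 1)) * (2 powr - real_of_int (k - 1)) ^ CARD('n)
      \<le> grid_ratio \<gamma> CARD('n) * (2 powr - real_of_int (time_level \<gamma> k) * (2 powr - real_of_int k) ^ CARD('n))"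
    by (simp only: powr_add grid_ratio_def powr_power powr_powr mult_ac)
  then show ?thesis
    by (simp add: emeasure_gridbox ennreal_mult[symmetric] grid_ratio_def ennreal_leI)
qed

text \<open>A crude bound, but unbounded as k tends to minus infinity. It excludes large averages of
  a square integrable function over very coarse boxes.\<close>

lemma gridbox_large:
  fixes z :: "real \<times> (real ^ 'n)"
  assumes "0 < \<gamma>" "k < 0"
  shows "ennreal (real_of_int (- k)) \<le> emeasure lborel (gridbox \<gamma> k z)"
proof -
  have "real_of_int k * \<gamma> \<le> 0"
    using assms by (simp add: mult_nonpos_nonneg)
  then have l: "time_level \<gamma> k \<le> 0"
    unfolding time_level_def by linarith
  have 1: "1 \<le> 2 powr - real_of_int (time_level \<gamma> k)"
    using l by (intro ge_one_powr_ge_zero) auto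
  have "real_of_int (- k) \<le> 2 powr - real_of_int k"
  proof -
    have eq: "- real_of_int k = real (nat (- k))"
      using assms(2) by simp
    have "real (nat (- k)) < 2 ^ nat (- k)"
      by (rule of_nat_less_two_power)
    also have "\<dots> = 2 powr real (nat (- k))"
      by (rule powr_realpow[symmetric]) simp
    finally show ?thesis
      unfolding of_int_minus eq by (rule less_imp_le)
  qed
  also have "\<dots> = (2 powr - real_of_int k) ^ 1" by simp
  also have "\<dots> \<le> (2 powr - real_of_int k) ^ CARD('n)"
    using assms(2) by (intro power_increasing ge_one_powr_ge_zero) (auto simp: Suc_le_eq)
  also have "\<dots> \<le> 2 powr - real_of_int (time_level \<gamma> k) * (2 powr - real_of_int k) ^ CARD('n)"
    using mult_right_mono[OF 1, of "(2 powr - real_of_int k) ^ CARD('n)"] by simp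
  finally show ?thesis
    unfolding emeasure_gridbox by (rule ennreal_leI)
qed

lemma gridbox_close:
  fixes z w :: "real \<times> (real ^ 'n)"
  assumes "w \<in> gridbox \<gamma> k z"
  shows "\<bar>fst w - fst z\<bar> < 2 powr - real_of_int (time_level \<gamma> k)"
    and "norm (snd w - snd z) < real CARD('n) * 2 powr - real_of_int k"
proof -
  show "\<bar>fst w - fst z\<bar> < 2 powr - real_of_int (time_level \<gamma> k)"
    using assms by (intro dyadic_eq_close) (auto simp: gridbox_def)
  have "norm (snd w - snd z) \<le> (\<Sum>i\<in>UNIV. \<bar>(snd w - snd z) $ i\<bar>)"
    by (rule norm_le_l1_cart)
  also have "\<dots> < (\<Sum>i\<in>(UNIV :: 'n set). 2 powr - real_of_int k)"
    using assms by (intro sum_strict_mono) (auto simp: gridbox_def intro: dyadic_eq_close)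
  finally show "norm (snd w - snd z) < real CARD('n) * 2 powr - real_of_int k"
    by simp
qed

text \<open>The restriction to k \<ge> 0 gives a stopping rule built on this inclusion a coarsest
  level.\<close>

lemma gridbox_small:
  fixes z :: "real \<times> (real ^ 'n)"
  assumes \<gamma>: "0 < \<gamma>" and U: "open U" "z \<in> U"
  shows "\<exists>k\<ge>0. gridbox \<gamma> k z \<subseteq> U"
proof -
  obtain e where e: "e > 0" "ball z e \<subseteq> U"
    using U by (auto simp: open_contains_ball)
  have lim: "(\<lambda>n. 2 * 2 powr - (real n * \<gamma>) + real CARD('n) * 2 powr - real n) \<longlonglongrightarrow> 2 * 0 + real CARD('n) * 0"
  proof (intro tendsto_intros)
    have 0: "(\<lambda>n. 2 powr - (real n * g)) \<longlonglongrightarrow> 0" if "0 < g" for g :: real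
    proof -
      have "2 powr - g < 2 powr 0"
        using that by (intro powr_less_mono) auto
      then have "(\<lambda>n. (2 powr - g) ^ n) \<longlonglongrightarrow> 0"
        by (intro LIMSEQ_realpow_zero) auto
      then show ?thesis
        by (simp add: powr_power mult.commute)
    qed
    show "(\<lambda>n. 2 powr - (real n * \<gamma>)) \<longlonglongrightarrow> 0"
      by (rule 0[OF \<gamma>])
    show "(\<lambda>n. 2 powr - real n) \<longlonglongrightarrow> 0"
      using 0[of 1] by simp
  qed
  obtain n where n: "2 * 2 powr - (real n * \<gamma>) + real CARD('n) * 2 powr - real n < e"
    using order_tendstoD(2)[OF lim, of e] e(1) by (auto simp: eventually_sequentially)
  have "gridbox \<gamma> (int n) z \<subseteq> ball z e"
  proof
    fix w assume w: "w \<in> gridbox \<gamma> (int n) z"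
    have "real n * \<gamma> - 1 < real_of_int (time_level \<gamma> (int n))"
      unfolding time_level_def by simp
    then have "2 powr - real_of_int (time_level \<gamma> (int n)) \<le> 2 powr (1 - real n * \<gamma>)"
      by (intro powr_mono) auto
    also have "\<dots> = 2 * 2 powr - (real n * \<gamma>)"
      by (simp add: powr_diff powr_minus divide_inverse)
    finally have "\<bar>fst w - fst z\<bar> + norm (snd w - snd z) < e"
      using gridbox_close[OF w] n by simp
    moreover have "dist z w \<le> \<bar>fst w - fst z\<bar> + norm (snd w - snd z)"
      using norm_Pair_le[of "fst z - fst w" "snd z - snd w"]
      by (cases z, cases w) (simp add: dist_norm abs_minus_commute norm_minus_commute)
    ultimately show "w \<in> ball z e" by simp
  qed
  then show ?thesis
    using e(2) by (intro exI[of _ "int n"]) auto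
qed

text \<open>Volume of a cylinder around a box of scale 1. In the radius, n comes from bounding the
  Euclidean norm by the sum of the coordinates, and the \<gamma>-th power of
  \<open>2 powr (1 / \<gamma>)\<close> is the factor 2 lost in rounding the time level.\<close>

definition cyl_ratio :: "real \<Rightarrow> nat \<Rightarrow> real" where
  "cyl_ratio \<gamma> n = 2 * (real n + 2 powr (1 / \<gamma>)) powr \<gamma> * (unit_ball_vol (real n) * (real n + 2 powr (1 / \<gamma>)) ^ n)"

lemma cyl_ratio_nonneg: "0 \<le> cyl_ratio \<gamma> n"
  by (simp add: cyl_ratio_def)

lemma gridbox_subset_cylinder:
  fixes z :: "real \<times> (real ^ 'n)"
  assumes \<gamma>: "0 < \<gamma>"
  obtains c where "0 < c" "gridbox \<gamma> k z \<subseteq> cylinder \<gamma> c (fst z) (snd z)"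
    "emeasure lborel (cylinder \<gamma> c (fst z) (snd z)) \<le> ennreal (cyl_ratio \<gamma> CARD('n)) * emeasure lborel (gridbox \<gamma> k z)"
proof -
  define a where "a = real CARD('n) + 2 powr (1 / \<gamma>)"
  have a: "0 < a" "real CARD('n) \<le> a"
    by (auto simp: a_def add_nonneg_pos)
  define c where "c = a * 2 powr - real_of_int k"
  have "2 = (2 powr (1 / \<gamma>)) powr \<gamma>"
    using \<gamma> by (simp add: powr_powr)
  also have "\<dots> \<le> a powr \<gamma>"
    using \<gamma> by (intro powr_mono2) (auto simp: a_def)
  finally have a2: "2 \<le> a powr \<gamma>" .
  have c\<gamma>: "c powr \<gamma> = a powr \<gamma> * 2 powr - (real_of_int k * \<gamma>)"
    using a by (simp add: c_def powr_mult powr_powr)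
  have lev: "real_of_int k * \<gamma> - 1 \<le> real_of_int (time_level \<gamma> k)" "real_of_int (time_level \<gamma> k) \<le> real_of_int k * \<gamma>"
    unfolding time_level_def by linarith+
  have "2 powr - real_of_int (time_level \<gamma> k) \<le> 2 powr (1 - real_of_int k * \<gamma>)"
    using lev by (intro powr_mono) auto
  also have "\<dots> = 2 * 2 powr - (real_of_int k * \<gamma>)"
    by (simp add: powr_diff powr_minus divide_inverse)
  also have "\<dots> \<le> c powr \<gamma>"
    unfolding c\<gamma> using a2 by (intro mult_right_mono) auto
  finally have 1: "2 powr - real_of_int (time_level \<gamma> k) \<le> c powr \<gamma>" .
  have 2: "real CARD('n) * 2 powr - real_of_int k \<le> c"
    unfolding c_def using a by (intro mult_right_mono) auto
  show thesis
  proof (rule that[of c])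
    show "0 < c" using a by (simp add: c_def)
    show "gridbox \<gamma> k z \<subseteq> cylinder \<gamma> c (fst z) (snd z)"
    proof
      fix w assume w: "w \<in> gridbox \<gamma> k z"
      show "w \<in> cylinder \<gamma> c (fst z) (snd z)"
        using gridbox_close[OF w] 1 2
        by (cases w) (auto simp: cylinder_def dist_norm norm_minus_commute abs_less_iff)
    qed
    have "2 * c powr \<gamma> * (unit_ball_vol (real CARD('n)) * c ^ CARD('n))
        = cyl_ratio \<gamma> CARD('n) * (2 powr - (real_of_int k * \<gamma>) * (2 powr - real_of_int k) ^ CARD('n))"
      unfolding c\<gamma> unfolding c_def cyl_ratio_def a_def[symmetric] by (simp add: power_mult_distrib)
    \<comment> \<open>Here the rounding helps: a level rounded down makes the box longer in
      time.\<close>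
    also have "\<dots> \<le> cyl_ratio \<gamma> CARD('n) * (2 powr - real_of_int (time_level \<gamma> k) * (2 powr - real_of_int k) ^ CARD('n))"
      using lev(2) by (intro mult_left_mono mult_right_mono powr_mono) (auto simp: cyl_ratio_def add_nonneg_pos less_imp_le)
    finally show "emeasure lborel (cylinder \<gamma> c (fst z) (snd z)) \<le> ennreal (cyl_ratio \<gamma> CARD('n)) * emeasure lborel (gridbox \<gamma> k z)"
      using \<open>0 < a\<close> by (subst emeasure_cylinder)
        (simp_all add: emeasure_gridbox ennreal_mult'[symmetric] cyl_ratio_nonneg ennreal_leI c_def)
  qed
qed

text \<open>Stopping-time selection: for each point, the coarsest box satisfying \<open>P\<close>.\<close>

lemma stopping_boxes:
  fixes P :: "int \<Rightarrow> real \<times> (real ^ 'n) \<Rightarrow> bool"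
  assumes \<gamma>: "0 < \<gamma>"
    and P: "\<And>k z w. w \<in> gridbox \<gamma> k z \<Longrightarrow> P k w = P k z"
    and below: "\<And>k z. P k z \<Longrightarrow> k\<^sub>0 \<le> k"
  obtains \<M> where "countable \<M>" "disjoint \<M>" "\<Union>\<M> = {z. \<exists>k. P k z}"
    "\<And>Q. Q \<in> \<M> \<Longrightarrow> \<exists>k z. Q = gridbox \<gamma> k z \<and> P k z \<and> (\<forall>j<k. \<not> P j z)"
proof -
  let ?R = "\<lambda>k z. P k z \<and> (\<forall>j<k. \<not> P j z)"
  define \<M> where "\<M> = {Q. \<exists>k z. Q = gridbox \<gamma> k z \<and> ?R k z}"
  have R: "?R k w = ?R k z" if "w \<in> gridbox \<gamma> k z" for k z w
  proof -
    have "P j w = P j z" if "j \<le> k" for j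
      by (rule P, rule subsetD[OF gridbox_nested[OF \<gamma> that]]) fact
    then show ?thesis by auto
  qed
  have ex: "\<exists>k. ?R k z" if "P k z" for k z
  proof -
    \<comment> \<open>Levels are integers; the lower bound \<open>k\<^sub>0\<close> shifts them to
      natural numbers, among which a least one exists.\<close>
    let ?m = "LEAST m. P (k\<^sub>0 + int m) z"
    have "P (k\<^sub>0 + int (nat (k - k\<^sub>0))) z"
      using that below[OF that] by simp
    then have 1: "P (k\<^sub>0 + int ?m) z" by (rule LeastI)
    moreover have "\<not> P j z" if "j < k\<^sub>0 + int ?m" for j
    proof
      assume Pj: "P j z"
      then have "P (k\<^sub>0 + int (nat (j - k\<^sub>0))) z"
        using below[OF Pj] by simp
      then have "?m \<le> nat (j - k\<^sub>0)" by (rule Least_le)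
      then show False using that below[OF Pj] by linarith
    qed
    ultimately show ?thesis by blast
  qed
  show thesis
  proof (rule that[of \<M>])
    show "countable \<M>"
      by (rule countable_subset[OF _ countable_gridboxes]) (auto simp: \<M>_def)
    show "\<Union>\<M> = {z. \<exists>k. P k z}"
    proof (intro set_eqI iffI)
      fix w assume "w \<in> \<Union>\<M>"
      then obtain k z where "w \<in> gridbox \<gamma> k z" "P k z" by (auto simp: \<M>_def)
      then show "w \<in> {z. \<exists>k. P k z}" using P[of w k z] by auto
    next
      fix w assume "w \<in> {z. \<exists>k. P k z}"
      then obtain k where "?R k w" using ex by blast
      then have "gridbox \<gamma> k w \<in> \<M>" unfolding \<M>_def by blast
      then show "w \<in> \<Union>\<M>" using gridbox_self by blast
    qed
    show "disjoint \<M>"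
    proof (rule disjointI)
      fix Q Q' assume Q: "Q \<in> \<M>" "Q' \<in> \<M>" "Q \<noteq> Q'"
      obtain k z where kz: "Q = gridbox \<gamma> k z" "?R k z" using Q(1) unfolding \<M>_def by blast
      obtain l y where ly: "Q' = gridbox \<gamma> l y" "?R l y" using Q(2) unfolding \<M>_def by blast
      show "Q \<inter> Q' = {}"
      proof (rule ccontr)
        assume "Q \<inter> Q' \<noteq> {}"
        then obtain w where w: "w \<in> gridbox \<gamma> k z" "w \<in> gridbox \<gamma> l y"
          using kz ly by auto
        \<comment> \<open>A common point transports minimality from both boxes to itself, and the
          minimal level of a point is unique.\<close>
        have "?R k w" using R[OF w(1)] kz by simp
        moreover have "?R l w" using R[OF w(2)] ly by simp
        ultimately have "k = l" by (meson linorder_neqE)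
        then show False
          using gridbox_eq[OF w(1)] gridbox_eq[OF w(2)] kz ly Q(3) by simp
      qed
    qed
    show "\<exists>k z. Q = gridbox \<gamma> k z \<and> ?R k z" if "Q \<in> \<M>" for Q
      using that unfolding \<M>_def by blast
  qed
qed

section \<open>Level sets of averages\<close>

text \<open>The integral is the measure of the union for the measure with that density, so countable
  additivity lets estimates on single boxes add up.\<close>

lemma nn_integral_Union_mono:
  fixes F G :: "'a::euclidean_space \<Rightarrow> ennreal"
  assumes [measurable]: "F \<in> borel_measurable borel" "G \<in> borel_measurable borel"
    and \<M>: "countable \<M>" "disjoint \<M>" "\<And>Q. Q \<in> \<M> \<Longrightarrow> Q \<in> sets borel"
    and le: "\<And>Q. Q \<in> \<M> \<Longrightarrow> (\<integral>\<^sup>+z\<in>Q. F z \<partial>lborel) \<le> (\<integral>\<^sup>+z\<in>Q. G z \<partial>lborel)"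
  shows "(\<integral>\<^sup>+z\<in>\<Union>\<M>. F z \<partial>lborel) \<le> (\<integral>\<^sup>+z\<in>\<Union>\<M>. G z \<partial>lborel)"
proof -
  have *: "(\<integral>\<^sup>+z\<in>\<Union>\<M>. H z \<partial>lborel) = (\<integral>\<^sup>+Q. (\<integral>\<^sup>+z\<in>Q. H z \<partial>lborel) \<partial>count_space \<M>)"
    if [measurable]: "H \<in> borel_measurable borel" for H :: "'a \<Rightarrow> ennreal"
  proof -
    have "\<Union>\<M> \<in> sets borel"
      using \<M> by (intro sets.countable_Union) auto
    then have "(\<integral>\<^sup>+z\<in>\<Union>\<M>. H z \<partial>lborel) = emeasure (density lborel H) (\<Union>((\<lambda>Q. Q) ` \<M>))"
      by (simp add: emeasure_density)
    also have "\<dots> = (\<integral>\<^sup>+Q. emeasure (density lborel H) Q \<partial>count_space \<M>)"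
      using \<M> by (intro emeasure_UN_countable) (auto simp: disjoint_family_on_def disjoint_def)
    also have "\<dots> = (\<integral>\<^sup>+Q. (\<integral>\<^sup>+z\<in>Q. H z \<partial>lborel) \<partial>count_space \<M>)"
      using \<M>(3) by (intro nn_integral_cong) (auto simp: emeasure_density)
    finally show ?thesis .
  qed
  show ?thesis
    unfolding *[OF assms(1)] *[OF assms(2)] by (rule nn_integral_mono) (simp add: le)
qed

text \<open>The average of \<open>F\<close> over the box exceeds l, written as a product to avoid
  division in \<open>ennreal\<close>. \<open>level_set\<close> is then a superlevel set of the
  dyadic maximal function of \<open>F\<close>.\<close>

definition high :: "real \<Rightarrow> (real \<times> (real ^ 'n) \<Rightarrow> ennreal) \<Rightarrow> real \<Rightarrow> int \<Rightarrow> real \<times> (real ^ 'n) \<Rightarrow> bool" where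
  "high \<gamma> F l k z \<longleftrightarrow> ennreal l * emeasure lborel (gridbox \<gamma> k z) < (\<integral>\<^sup>+y\<in>gridbox \<gamma> k z. F y \<partial>lborel)"

definition level_set :: "real \<Rightarrow> (real \<times> (real ^ 'n) \<Rightarrow> ennreal) \<Rightarrow> real \<Rightarrow> (real \<times> (real ^ 'n)) set" where
  "level_set \<gamma> F l = {z. \<exists>k. high \<gamma> F l k z}"

lemma high_cong: "w \<in> gridbox \<gamma> k z \<Longrightarrow> high \<gamma> F l k w = high \<gamma> F l k z"
  by (simp add: high_def gridbox_eq)

lemma high_antimono: "l \<le> l' \<Longrightarrow> high \<gamma> F l' k z \<Longrightarrow> high \<gamma> F l k z"
  unfolding high_def by (erule le_less_trans[rotated]) (intro mult_right_mono ennreal_leI, auto)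

lemma level_set_antimono: "l \<le> l' \<Longrightarrow> level_set \<gamma> F l' \<subseteq> level_set \<gamma> F l"
  unfolding level_set_def using high_antimono by blast

text \<open>Cauchy-Schwarz against the indicator of the box bounds the square of l |Q| by |Q| times
  the integral of F^2, and one factor |Q| is cancelled.\<close>

lemma high_measure_le:
  assumes [measurable]: "F \<in> borel_measurable borel" and l: "0 < l" and h: "high \<gamma> F l k z"
  shows "ennreal (l\<^sup>2) * emeasure lborel (gridbox \<gamma> k z) \<le> (\<integral>\<^sup>+y\<in>gridbox \<gamma> k z. (F y)\<^sup>2 \<partial>lborel)"
proof -
  let ?Q = "gridbox \<gamma> k z"
  let ?q = "emeasure lborel ?Q"
  have "(ennreal l * ?q)\<^sup>2 \<le> (\<integral>\<^sup>+y. indicator ?Q y * (F y * indicator ?Q y) \<partial>lborel)\<^sup>2"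
    using h unfolding high_def
    by (intro power_mono) (auto simp: mult_ac indicator_inter_arith[symmetric] elim!: order.trans[OF less_imp_le])
  also have "\<dots> \<le> (\<integral>\<^sup>+y. (indicator ?Q y)\<^sup>2 \<partial>lborel) * (\<integral>\<^sup>+y. (F y * indicator ?Q y)\<^sup>2 \<partial>lborel)"
    by (rule Cauchy_Schwarz_nn_integral) measurable
  also have "(\<integral>\<^sup>+y. (indicator ?Q y)\<^sup>2 \<partial>lborel) = (\<integral>\<^sup>+y. indicator ?Q y \<partial>lborel)"
    by (intro nn_integral_cong) (simp add: indicator_def)
  also have "\<dots> = ?q" by simp
  also have "(\<integral>\<^sup>+y. (F y * indicator ?Q y)\<^sup>2 \<partial>lborel) = (\<integral>\<^sup>+y\<in>?Q. (F y)\<^sup>2 \<partial>lborel)"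
    by (intro nn_integral_cong) (simp add: indicator_def)
  finally have "?q * (ennreal (l\<^sup>2) * ?q) \<le> ?q * (\<integral>\<^sup>+y\<in>?Q. (F y)\<^sup>2 \<partial>lborel)"
    using l by (simp add: power2_eq_square ennreal_mult mult_ac)
  then show ?thesis
    using emeasure_gridbox_pos_finite[of \<gamma> k z] by (subst (asm) ennreal_mult_le_mult_iff) auto
qed

context
  fixes \<gamma> :: real and F :: "real \<times> (real ^ 'n) \<Rightarrow> ennreal"
  assumes \<gamma>: "0 < \<gamma>" and F [measurable]: "F \<in> borel_measurable borel"
    and F2: "(\<integral>\<^sup>+z. (F z)\<^sup>2 \<partial>lborel) < \<infinity>"
begin

text \<open>A box of negative level k with average above l has volume at least -k by
  \<open>gridbox_large\<close>, and at most the integral of F^2 over l^2 by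
  \<open>high_measure_le\<close>. \<open>stopping_boxes\<close> asks for such a lower bound on
  levels.\<close>

lemma high_bounded_below:
  assumes l: "0 < l"
  shows "\<exists>k\<^sub>0. \<forall>k z. high \<gamma> F l k z \<longrightarrow> k\<^sub>0 \<le> k"
proof -
  let ?A = "\<integral>\<^sup>+z. (F z)\<^sup>2 \<partial>lborel"
  have *: "real_of_int (- k) \<le> enn2real ?A / l\<^sup>2" if h: "high \<gamma> F l k z" and k: "k < 0" for k z
  proof -
    have "ennreal (l\<^sup>2 * real_of_int (- k)) \<le> ennreal (l\<^sup>2) * emeasure lborel (gridbox \<gamma> k z)"
      unfolding ennreal_mult'[OF zero_le_power2] by (intro mult_left_mono gridbox_large \<gamma> k) simp
    also have "\<dots> \<le> (\<integral>\<^sup>+y\<in>gridbox \<gamma> k z. (F y)\<^sup>2 \<partial>lborel)"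
      by (rule high_measure_le[OF F l h])
    also have "\<dots> \<le> ?A"
      by (intro nn_integral_mono) (simp add: indicator_def)
    also have "\<dots> = ennreal (enn2real ?A)"
      using F2 by simp
    finally have "l\<^sup>2 * real_of_int (- k) \<le> enn2real ?A"
      by (subst (asm) ennreal_le_iff) auto
    then show ?thesis
      using l by (simp add: field_simps)
  qed
  show ?thesis
  proof (intro exI[of _ "\<lfloor>- (enn2real ?A / l\<^sup>2)\<rfloor>"] allI impI)
    fix k z assume h: "high \<gamma> F l k z"
    have "0 \<le> enn2real ?A / l\<^sup>2" by simp
    moreover have "0 \<le> real_of_int k" if "\<not> k < 0"
      using that by simp
    ultimately have "- (enn2real ?A / l\<^sup>2) \<le> real_of_int k"
      using *[OF h] unfolding of_int_minus by (cases "k < 0") linarith+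
    then show "\<lfloor>- (enn2real ?A / l\<^sup>2)\<rfloor> \<le> k"
      by linarith
  qed
qed

lemma level_set_boxes:
  assumes l: "0 < l"
  obtains \<M> where "countable \<M>" "disjoint \<M>" "\<Union>\<M> = level_set \<gamma> F l"
    "\<And>Q. Q \<in> \<M> \<Longrightarrow> \<exists>k z. Q = gridbox \<gamma> k z \<and> high \<gamma> F l k z \<and> (\<forall>j<k. \<not> high \<gamma> F l j z)"
proof -
  obtain k\<^sub>0 where k0: "\<And>k z. high \<gamma> F l k z \<Longrightarrow> k\<^sub>0 \<le> k"
    using high_bounded_below[OF l] by blast
  show thesis
    by (rule stopping_boxes[OF \<gamma>, where P = "high \<gamma> F l"], erule high_cong, erule k0)
      (rule that, auto simp: level_set_def)
qed

lemma level_set_borel [measurable]: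
  assumes l: "0 < l"
  shows "level_set \<gamma> F l \<in> sets borel"
proof -
  obtain \<M> where \<M>: "countable \<M>" "\<Union>\<M> = level_set \<gamma> F l"
    "\<And>Q. Q \<in> \<M> \<Longrightarrow> \<exists>k z. Q = gridbox \<gamma> k z \<and> high \<gamma> F l k z \<and> (\<forall>j<k. \<not> high \<gamma> F l j z)"
    by (rule level_set_boxes[OF l]) (rule that)
  have "Q \<in> sets borel" if "Q \<in> \<M>" for Q
    using \<M>(3)[OF that] by auto
  then show ?thesis
    unfolding \<M>(2)[symmetric] by (intro sets.countable_Union \<M>(1)) auto
qed

text \<open>Supplies the finiteness of truncated level integrals that makes absorption possible in
  \<open>lp_from_good_lambda\<close>.\<close>

lemma level_set_weak_type:
  assumes l: "0 < l"
  shows "ennreal (l\<^sup>2) * emeasure lborel (level_set \<gamma> F l) \<le> (\<integral>\<^sup>+z. (F z)\<^sup>2 \<partial>lborel)"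
proof -
  obtain \<M> where \<M>: "countable \<M>" "disjoint \<M>" "\<Union>\<M> = level_set \<gamma> F l"
    "\<And>Q. Q \<in> \<M> \<Longrightarrow> \<exists>k z. Q = gridbox \<gamma> k z \<and> high \<gamma> F l k z \<and> (\<forall>j<k. \<not> high \<gamma> F l j z)"
    by (rule level_set_boxes[OF l]) (rule that)
  note [measurable] = level_set_borel[OF l]
  have "ennreal (l\<^sup>2) * emeasure lborel (level_set \<gamma> F l) = (\<integral>\<^sup>+z\<in>\<Union>\<M>. ennreal (l\<^sup>2) \<partial>lborel)"
    unfolding \<M>(3) by (simp add: nn_integral_cmult_indicator)
  also have "\<dots> \<le> (\<integral>\<^sup>+z\<in>\<Union>\<M>. (F z)\<^sup>2 \<partial>lborel)"
  proof (rule nn_integral_Union_mono[OF _ _ \<M>(1,2)])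
    fix Q assume "Q \<in> \<M>"
    then obtain k z where Q: "Q = gridbox \<gamma> k z" "high \<gamma> F l k z"
      using \<M>(4) by blast
    show "Q \<in> sets borel" unfolding Q(1) by simp
    show "(\<integral>\<^sup>+z\<in>Q. ennreal (l\<^sup>2) \<partial>lborel) \<le> (\<integral>\<^sup>+z\<in>Q. (F z)\<^sup>2 \<partial>lborel)"
      using high_measure_le[OF F l Q(2)] unfolding Q(1) by (simp add: nn_integral_cmult_indicator)
  qed auto
  also have "\<dots> \<le> (\<integral>\<^sup>+z. (F z)\<^sup>2 \<partial>lborel)"
    by (intro nn_integral_mono) (simp add: indicator_def)
  finally show ?thesis .
qed

text \<open>Replaces Lebesgue's differentiation theorem: an open neighbourhood of the exceptional set,
  almost as small as the set, splits into boxes on which the mean of \<open>F\<close> is at most \<open>l\<close>.\<close>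

lemma AE_le_off_level_set:
  assumes l: "0 < l"
  shows "AE z in lborel. z \<notin> level_set \<gamma> F l \<longrightarrow> F z \<le> ennreal l"
proof -
  note [measurable] = level_set_borel[OF l]
  define G where "G = {z. ennreal l < F z} - level_set \<gamma> F l"
  have Gm [measurable]: "G \<in> sets borel"
    unfolding G_def by measurable
  \<comment> \<open>Chebyshev's inequality; finiteness allows l times the volume of \<open>G\<close>
    to be cancelled at the end.\<close>
  have Gfin: "emeasure lborel G < \<infinity>"
  proof -
    have "ennreal (l\<^sup>2) * emeasure lborel G = (\<integral>\<^sup>+z. ennreal (l\<^sup>2) * indicator G z \<partial>lborel)"
      by (simp add: nn_integral_cmult_indicator)
    also have "\<dots> \<le> (\<integral>\<^sup>+z. (F z)\<^sup>2 \<partial>lborel)"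
    proof (rule nn_integral_mono)
      fix z
      show "ennreal (l\<^sup>2) * indicator G z \<le> (F z)\<^sup>2"
        using l power_mono[of "ennreal l" "F z" 2]
        by (auto simp: G_def indicator_def ennreal_power[symmetric] less_imp_le)
    qed
    also note F2
    finally show ?thesis
      using l by (auto simp: ennreal_mult_less_top)
  qed
  have avg: "(\<integral>\<^sup>+y\<in>gridbox \<gamma> k z. F y \<partial>lborel) \<le> ennreal l * emeasure lborel (gridbox \<gamma> k z)" if "z \<in> G" for k z
    using that by (auto simp: G_def level_set_def high_def not_less)
  have main: "(\<integral>\<^sup>+z\<in>G. F z \<partial>lborel) \<le> ennreal l * emeasure lborel G"
  proof (rule ennreal_le_epsilon)
    fix e :: real assume e: "0 < e"
    obtain U where U: "open U" "G \<subseteq> U" "emeasure lborel (U - G) < ennreal (e / l)"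
      using outer_regular_lborel[OF Gm, of "e / l"] e l by auto
    have [measurable]: "U \<in> sets borel" using U(1) by simp
    let ?P = "\<lambda>k z. 0 \<le> k \<and> gridbox \<gamma> k z \<subseteq> U"
    obtain \<M> where \<M>: "countable \<M>" "disjoint \<M>" "\<Union>\<M> = {z. \<exists>k. ?P k z}"
      "\<And>Q. Q \<in> \<M> \<Longrightarrow> \<exists>k z. Q = gridbox \<gamma> k z \<and> ?P k z \<and> (\<forall>j<k. \<not> ?P j z)"
      by (rule stopping_boxes[OF \<gamma>, of ?P 0]) (auto simp: gridbox_eq intro: that)
    \<comment> \<open>Keeping only boxes that meet \<open>G\<close> makes each of them the box of a
      point outside the level set, where averages are at most l.\<close>
    define \<M>' where "\<M>' = {Q \<in> \<M>. Q \<inter> G \<noteq> {}}"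
    have "G \<subseteq> \<Union>\<M>'"
    proof
      fix z assume z: "z \<in> G"
      then have "\<exists>k\<ge>0. gridbox \<gamma> k z \<subseteq> U"
        using U by (intro gridbox_small \<gamma>) auto
      then have "z \<in> \<Union>\<M>" unfolding \<M>(3) by auto
      then show "z \<in> \<Union>\<M>'" using z by (auto simp: \<M>'_def)
    qed
    have sub: "\<Union>\<M>' \<subseteq> U"
    proof
      fix w assume "w \<in> \<Union>\<M>'"
      then obtain Q where "Q \<in> \<M>" "w \<in> Q" by (auto simp: \<M>'_def)
      then show "w \<in> U" using \<M>(4)[of Q] by auto
    qed
    have \<M>'b: "Q \<in> sets borel" if "Q \<in> \<M>'" for Q
      using that \<M>(4)[of Q] by (auto simp: \<M>'_def)
    have \<M>'c: "countable \<M>'" "disjoint \<M>'"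
      using \<M>(1,2) by (auto simp: \<M>'_def disjoint_def)
    have [measurable]: "\<Union>\<M>' \<in> sets borel"
      using \<M>'b \<M>'c by (intro sets.countable_Union) auto
    have "(\<integral>\<^sup>+z\<in>G. F z \<partial>lborel) \<le> (\<integral>\<^sup>+z\<in>\<Union>\<M>'. F z \<partial>lborel)"
      using \<open>G \<subseteq> \<Union>\<M>'\<close> by (intro nn_integral_mono mult_left_mono) (auto simp: indicator_def)
    also have "\<dots> \<le> (\<integral>\<^sup>+z\<in>\<Union>\<M>'. ennreal l \<partial>lborel)"
    proof (rule nn_integral_Union_mono[OF _ _ \<M>'c \<M>'b])
      fix Q assume Q: "Q \<in> \<M>'"
      then obtain k z where kz: "Q = gridbox \<gamma> k z"
        using \<M>(4)[of Q] by (auto simp: \<M>'_def)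
      obtain w where w: "w \<in> Q" "w \<in> G" using Q by (auto simp: \<M>'_def)
      have "Q = gridbox \<gamma> k w" using gridbox_eq[of w \<gamma> k z] w kz by simp
      then show "(\<integral>\<^sup>+z\<in>Q. F z \<partial>lborel) \<le> (\<integral>\<^sup>+z\<in>Q. ennreal l \<partial>lborel)"
        using avg[OF w(2), of k] by (simp add: nn_integral_cmult_indicator)
    qed auto
    also have "\<dots> = ennreal l * emeasure lborel (\<Union>\<M>')"
      by (simp add: nn_integral_cmult_indicator)
    also have "\<dots> \<le> ennreal l * emeasure lborel U"
      using sub by (intro mult_left_mono emeasure_mono) auto
    also have "emeasure lborel U = emeasure lborel G + emeasure lborel (U - G)"
      using U(2) by (subst plus_emeasure) (auto intro!: arg_cong[where f="emeasure lborel"])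
    also have "ennreal l * (emeasure lborel G + emeasure lborel (U - G)) \<le> ennreal l * (emeasure lborel G + ennreal (e / l))"
      using less_imp_le[OF U(3)] by (intro mult_left_mono add_left_mono) auto
    also have "\<dots> = ennreal l * emeasure lborel G + ennreal e"
      using l e by (simp add: distrib_left ennreal_mult[symmetric])
    finally show "(\<integral>\<^sup>+z\<in>G. F z \<partial>lborel) \<le> ennreal l * emeasure lborel G + ennreal e" .
  qed
  \<comment> \<open>On \<open>G\<close> the function is l plus a positive excess, and the bound on
    its integral leaves no room for the excess.\<close>
  have "(\<integral>\<^sup>+z\<in>G. F z \<partial>lborel) = (\<integral>\<^sup>+z. ennreal l * indicator G z + (F z - ennreal l) * indicator G z \<partial>lborel)"
    by (intro nn_integral_cong) (auto simp: G_def indicator_def less_imp_le add_diff_inverse_ennreal)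
  also have "\<dots> = ennreal l * emeasure lborel G + (\<integral>\<^sup>+z. (F z - ennreal l) * indicator G z \<partial>lborel)"
    by (subst nn_integral_add) (auto simp: nn_integral_cmult_indicator)
  finally have "ennreal l * emeasure lborel G + (\<integral>\<^sup>+z. (F z - ennreal l) * indicator G z \<partial>lborel) \<le> ennreal l * emeasure lborel G + 0"
    using main by simp
  moreover have "ennreal l * emeasure lborel G < \<infinity>"
    using Gfin by (simp add: ennreal_mult_less_top)
  ultimately have "(\<integral>\<^sup>+z. (F z - ennreal l) * indicator G z \<partial>lborel) = 0"
    by (subst (asm) ennreal_add_left_cancel_le) auto
  then have "AE z in lborel. (F z - ennreal l) * indicator G z = 0"
    by (subst (asm) nn_integral_0_iff_AE) auto
  then show ?thesis
  proof eventually_elim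
    case (elim z)
    show ?case
    proof (rule ccontr)
      assume "\<not> ?case"
      then have "z \<in> G" "ennreal l < F z" by (auto simp: G_def)
      then show False using elim by (auto simp: diff_eq_0_iff_ennreal)
    qed
  qed
qed

end

section \<open>A good-lambda inequality\<close>

lemma grid_ratio_pos: "0 < grid_ratio \<gamma> n"
  by (simp add: grid_ratio_def)

text \<open>Let J be the integral of |u - \<kappa>| over the stopping box Q, and S the part of Q at
  height (D + 2) l. On the boxes making up S the average of |u| exceeds this height, so (D + 2) l
  |S| \<le> J + |\<kappa>| |S|. The parent of Q is not high, so the mean of |u| on Q is at most D l,
  and |\<kappa>| \<le> D l + J / |Q|. Thus J enters twice, and the summand 2 in D + 2 pays for
  this.\<close>

lemma good_lambda_box:
  fixes u v w :: "real \<times> (real ^ 'n) \<Rightarrow> complex"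
  assumes \<gamma>: "0 < \<gamma>" and [measurable]: "u \<in> borel_measurable borel" "v \<in> borel_measurable borel" "w \<in> borel_measurable borel"
    and u2: "(\<integral>\<^sup>+z. ennreal ((norm (u z))\<^sup>2) \<partial>lborel) < \<infinity>"
    and l: "0 < l" and uvw: "AE z in lborel. u z = v z + w z"
    and osc: "\<And>c t x. 0 < c \<Longrightarrow> \<exists>\<kappa>. (\<integral>\<^sup>+z\<in>cylinder \<gamma> c t x. ennreal (norm (w z - \<kappa>)) \<partial>lborel)
      \<le> ennreal b * emeasure lborel (cylinder \<gamma> c t x)"
    and b: "0 \<le> b"
    and stop: "high \<gamma> (\<lambda>z. ennreal (norm (u z))) l k z" "\<And>j. j < k \<Longrightarrow> \<not> high \<gamma> (\<lambda>z. ennreal (norm (u z))) l j z"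
  shows "ennreal l * emeasure lborel (level_set \<gamma> (\<lambda>z. ennreal (norm (u z))) ((grid_ratio \<gamma> CARD('n) + 2) * l) \<inter> gridbox \<gamma> k z)
    \<le> (\<integral>\<^sup>+y\<in>gridbox \<gamma> k z. ennreal (norm (v y)) \<partial>lborel) + ennreal (b * cyl_ratio \<gamma> CARD('n)) * emeasure lborel (gridbox \<gamma> k z)"
proof -
  let ?F = "\<lambda>z. ennreal (norm (u z))"
  let ?Q = "gridbox \<gamma> k z"
  define D where "D = grid_ratio \<gamma> CARD('n)"
  have D: "0 < D" by (simp add: D_def grid_ratio_pos)
  let ?L = "(D + 2) * l"
  have L: "0 < ?L" "l \<le> ?L"
    using D l by (auto simp: mult_le_cancel_right1)
  have F2: "(\<integral>\<^sup>+z. (?F z)\<^sup>2 \<partial>lborel) < \<infinity>"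
    using u2 by (simp add: ennreal_power)
  have Fm: "?F \<in> borel_measurable borel" by measurable
  define S where "S = level_set \<gamma> ?F ?L \<inter> ?Q"
  have [measurable]: "S \<in> sets borel"
    unfolding S_def using level_set_borel[OF \<gamma> Fm F2 L(1)] by measurable
  obtain c where c: "0 < c" "?Q \<subseteq> cylinder \<gamma> c (fst z) (snd z)"
    "emeasure lborel (cylinder \<gamma> c (fst z) (snd z)) \<le> ennreal (cyl_ratio \<gamma> CARD('n)) * emeasure lborel ?Q"
    by (rule gridbox_subset_cylinder[OF \<gamma>])
  obtain \<kappa> where \<kappa>: "(\<integral>\<^sup>+z\<in>cylinder \<gamma> c (fst z) (snd z). ennreal (norm (w z - \<kappa>)) \<partial>lborel)
      \<le> ennreal b * emeasure lborel (cylinder \<gamma> c (fst z) (snd z))"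
    using osc[OF c(1)] by blast
  let ?J = "\<integral>\<^sup>+y\<in>?Q. ennreal (norm (u y - \<kappa>)) \<partial>lborel"
  have J: "?J \<le> (\<integral>\<^sup>+y\<in>?Q. ennreal (norm (v y)) \<partial>lborel) + ennreal (b * cyl_ratio \<gamma> CARD('n)) * emeasure lborel ?Q"
  proof -
    have "?J \<le> (\<integral>\<^sup>+y. ennreal (norm (v y)) * indicator ?Q y + ennreal (norm (w y - \<kappa>)) * indicator ?Q y \<partial>lborel)"
    proof (rule nn_integral_mono_AE)
      show "AE y in lborel. ennreal (norm (u y - \<kappa>)) * indicator ?Q y
          \<le> ennreal (norm (v y)) * indicator ?Q y + ennreal (norm (w y - \<kappa>)) * indicator ?Q y"
        using uvw
      proof eventually_elim
        case (elim y)
        have "norm (u y - \<kappa>) \<le> norm (v y) + norm (w y - \<kappa>)"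
          using norm_triangle_ineq[of "v y" "w y - \<kappa>"] elim by (simp add: algebra_simps)
        then show ?case
          by (simp add: indicator_def ennreal_plus[symmetric] ennreal_leI del: ennreal_plus)
      qed
    qed
    also have "\<dots> = (\<integral>\<^sup>+y\<in>?Q. ennreal (norm (v y)) \<partial>lborel) + (\<integral>\<^sup>+y\<in>?Q. ennreal (norm (w y - \<kappa>)) \<partial>lborel)"
      by (rule nn_integral_add) measurable
    also have "(\<integral>\<^sup>+y\<in>?Q. ennreal (norm (w y - \<kappa>)) \<partial>lborel) \<le> (\<integral>\<^sup>+z\<in>cylinder \<gamma> c (fst z) (snd z). ennreal (norm (w z - \<kappa>)) \<partial>lborel)"
      using c(2) by (intro nn_integral_mono mult_left_mono) (auto simp: indicator_def)
    also have "\<dots> \<le> ennreal b * (ennreal (cyl_ratio \<gamma> CARD('n)) * emeasure lborel ?Q)"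
      by (rule order.trans[OF \<kappa>]) (intro mult_left_mono c, simp)
    also have "\<dots> = ennreal (b * cyl_ratio \<gamma> CARD('n)) * emeasure lborel ?Q"
      using b cyl_ratio_nonneg by (simp add: ennreal_mult mult.assoc)
    finally show ?thesis by (simp add: add_left_mono)
  qed
  have s1: "ennreal ?L * emeasure lborel S \<le> (\<integral>\<^sup>+y\<in>S. ?F y \<partial>lborel)"
  proof -
    obtain \<M> where \<M>: "countable \<M>" "disjoint \<M>" "\<Union>\<M> = level_set \<gamma> ?F ?L"
      "\<And>Q. Q \<in> \<M> \<Longrightarrow> \<exists>k z. Q = gridbox \<gamma> k z \<and> high \<gamma> ?F ?L k z \<and> (\<forall>j<k. \<not> high \<gamma> ?F ?L j z)"
      by (rule level_set_boxes[OF \<gamma> Fm F2 L(1)]) (rule that)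
    define \<M>' where "\<M>' = {Q \<in> \<M>. Q \<subseteq> ?Q}"
    have "\<Union>\<M>' = S"
    proof (intro set_eqI iffI)
      fix y assume "y \<in> \<Union>\<M>'"
      then show "y \<in> S" unfolding S_def \<M>(3)[symmetric] by (auto simp: \<M>'_def)
    next
      fix y assume y: "y \<in> S"
      then obtain Q where Q: "Q \<in> \<M>" "y \<in> Q" unfolding S_def \<M>(3)[symmetric] by auto
      obtain k' z' where kz: "Q = gridbox \<gamma> k' z'" "high \<gamma> ?F ?L k' z'"
        using \<M>(4)[OF Q(1)] by blast
      have hy: "high \<gamma> ?F l k' y"
        using kz Q(2) high_cong[of y \<gamma> k' z' ?F ?L] by (intro high_antimono[OF L(2)]) simp
      have yQ: "y \<in> ?Q" using y by (simp add: S_def)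
      \<comment> \<open>Of a coarser level than k, the selected box through y would contain z and be
        high at l, against the minimality of k. Hence no selected box that meets Q sticks out of
        it.\<close>
      have "k \<le> k'"
      proof (rule ccontr)
        assume "\<not> k \<le> k'"
        then have "k' < k" by simp
        then have "y \<in> gridbox \<gamma> k' z"
          using yQ gridbox_nested[OF \<gamma>, of k' k z] by auto
        then have "high \<gamma> ?F l k' z"
          using hy high_cong by blast
        then show False using stop(2)[OF \<open>k' < k\<close>] by simp
      qed
      then have "gridbox \<gamma> k' y \<subseteq> gridbox \<gamma> k y"
        by (rule gridbox_nested[OF \<gamma>])
      then have "Q \<subseteq> ?Q"
        using gridbox_eq[OF yQ] gridbox_eq[of y \<gamma> k' z'] Q(2) kz(1) by simp
      then show "y \<in> \<Union>\<M>'" using Q by (auto simp: \<M>'_def)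
    qed
    have "(\<integral>\<^sup>+y\<in>\<Union>\<M>'. ennreal ?L \<partial>lborel) \<le> (\<integral>\<^sup>+y\<in>\<Union>\<M>'. ?F y \<partial>lborel)"
    proof (rule nn_integral_Union_mono)
      show "countable \<M>'" "disjoint \<M>'"
        using \<M>(1,2) by (auto simp: \<M>'_def disjoint_def)
      fix Q assume "Q \<in> \<M>'"
      then obtain k' z' where kz: "Q = gridbox \<gamma> k' z'" "high \<gamma> ?F ?L k' z'"
        using \<M>(4)[of Q] by (auto simp: \<M>'_def)
      then show "Q \<in> sets borel" by simp
      show "(\<integral>\<^sup>+y\<in>Q. ennreal ?L \<partial>lborel) \<le> (\<integral>\<^sup>+y\<in>Q. ?F y \<partial>lborel)"
        using kz(2) unfolding kz(1) high_def by (simp add: nn_integral_cmult_indicator less_imp_le)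
    qed auto
    then show ?thesis
      unfolding \<open>\<Union>\<M>' = S\<close> by (simp add: nn_integral_cmult_indicator)
  qed
  have s2: "(\<integral>\<^sup>+y\<in>S. ?F y \<partial>lborel) \<le> ?J + ennreal (norm \<kappa>) * emeasure lborel S"
  proof -
    have "(\<integral>\<^sup>+y\<in>S. ?F y \<partial>lborel) \<le> (\<integral>\<^sup>+y. ennreal (norm (u y - \<kappa>)) * indicator ?Q y + ennreal (norm \<kappa>) * indicator S y \<partial>lborel)"
    proof (rule nn_integral_mono)
      fix y
      have "norm (u y) \<le> norm (u y - \<kappa>) + norm \<kappa>"
        using norm_triangle_ineq[of "u y - \<kappa>" \<kappa>] by simp
      then show "?F y * indicator S y \<le> ennreal (norm (u y - \<kappa>)) * indicator ?Q y + ennreal (norm \<kappa>) * indicator S y"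
        by (auto simp: S_def indicator_def ennreal_plus[symmetric] ennreal_leI simp del: ennreal_plus)
    qed
    also have "\<dots> = ?J + ennreal (norm \<kappa>) * emeasure lborel S"
      by (subst nn_integral_add) (auto simp: nn_integral_cmult_indicator)
    finally show ?thesis .
  qed
  have s3: "ennreal (norm \<kappa>) * emeasure lborel ?Q \<le> ennreal (D * l) * emeasure lborel ?Q + ?J"
  proof -
    have "ennreal (norm \<kappa>) * emeasure lborel ?Q = (\<integral>\<^sup>+y. ennreal (norm \<kappa>) * indicator ?Q y \<partial>lborel)"
      by (simp add: nn_integral_cmult_indicator)
    also have "\<dots> \<le> (\<integral>\<^sup>+y. ?F y * indicator ?Q y + ennreal (norm (u y - \<kappa>)) * indicator ?Q y \<partial>lborel)"
    proof (rule nn_integral_mono)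
      fix y
      have "norm \<kappa> \<le> norm (u y) + norm (u y - \<kappa>)"
        using norm_triangle_ineq4[of "u y" "u y - \<kappa>"] by simp
      then show "ennreal (norm \<kappa>) * indicator ?Q y \<le> ?F y * indicator ?Q y + ennreal (norm (u y - \<kappa>)) * indicator ?Q y"
        by (auto simp: indicator_def ennreal_plus[symmetric] ennreal_leI simp del: ennreal_plus)
    qed
    also have "\<dots> = (\<integral>\<^sup>+y\<in>?Q. ?F y \<partial>lborel) + ?J"
      by (rule nn_integral_add) measurable
    \<comment> \<open>Passing to the parent, where the stopping rule bounds the average from above,
      costs the volume ratio D.\<close>
    also have "(\<integral>\<^sup>+y\<in>?Q. ?F y \<partial>lborel) \<le> (\<integral>\<^sup>+y\<in>gridbox \<gamma> (k - 1) z. ?F y \<partial>lborel)"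
      using gridbox_nested[OF \<gamma>, of "k - 1" k z] by (intro nn_integral_mono mult_left_mono) (auto simp: indicator_def)
    also have "\<dots> \<le> ennreal l * emeasure lborel (gridbox \<gamma> (k - 1) z)"
      using stop(2)[of "k - 1"] by (simp add: high_def not_less)
    also have "\<dots> \<le> ennreal l * (ennreal D * emeasure lborel ?Q)"
      unfolding D_def by (intro mult_left_mono emeasure_parent_le) simp
    also have "\<dots> = ennreal (D * l) * emeasure lborel ?Q"
      using D l by (simp add: ennreal_mult mult_ac)
    finally show ?thesis by (simp add: add_right_mono)
  qed
  have "ennreal l * emeasure lborel S \<le> ?J"
  proof (cases "?J = \<infinity>")
    case False
    then obtain j where j: "?J = ennreal j" "0 \<le> j"
      by (cases ?J) auto
    define q where "q = 2 powr - real_of_int (time_level \<gamma> k) * (2 powr - real_of_int k) ^ CARD('n)"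
    have q: "emeasure lborel ?Q = ennreal q" "0 < q"
      unfolding q_def by (rule emeasure_gridbox) simp
    have "emeasure lborel S \<le> ennreal q"
      unfolding q(1)[symmetric] by (intro emeasure_mono) (auto simp: S_def)
    then obtain s where s: "emeasure lborel S = ennreal s" "0 \<le> s" "s \<le> q"
      using q(2) by (cases "emeasure lborel S") (simp_all add: top_unique)
    have 1: "?L * s \<le> j + norm \<kappa> * s"
      using order.trans[OF s1 s2] L(1) s j
      by (simp add: ennreal_mult[symmetric] ennreal_plus[symmetric] del: ennreal_plus)
    have 2: "norm \<kappa> * q \<le> D * l * q + j"
      using s3 D l q j
      by (simp add: ennreal_mult[symmetric] ennreal_plus[symmetric] del: ennreal_plus)
    have "norm \<kappa> \<le> (D * l * q + j) / q"
      using 2 q(2) by (subst pos_le_divide_eq)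
    also have "\<dots> = D * l + j / q"
      using q(2) by (simp add: add_divide_distrib)
    finally have "norm \<kappa> \<le> D * l + j / q" .
    then have "norm \<kappa> * s \<le> (D * l + j / q) * s"
      using s(2) by (rule mult_right_mono)
    also have "\<dots> = D * l * s + j * (s / q)"
      by (simp add: algebra_simps)
    \<comment> \<open>S is a part of Q, so the second copy of J does not grow.\<close>
    also have "j * (s / q) \<le> j"
      using s(2,3) q(2) j(2) by (intro mult_left_le) auto
    finally have "norm \<kappa> * s \<le> D * l * s + j" by simp
    then have "l * s \<le> j" using 1 unfolding distrib_right by linarith
    then show ?thesis
      using l s by (simp add: j ennreal_mult[symmetric])
  qed simp
  then show ?thesis
    using J unfolding S_def D_def by (rule order.trans)
qed

text \<open>\<open>good_lambda_box\<close> is summed over the stopping boxes of level l. The linear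
  term in \<open>v\<close> is traded for a square, to which an L2 bound can be applied; \<delta> is
  the price paid in volume of the level set.\<close>

lemma good_lambda:
  fixes u v w :: "real \<times> (real ^ 'n) \<Rightarrow> complex"
  assumes \<gamma>: "0 < \<gamma>" and [measurable]: "u \<in> borel_measurable borel" "v \<in> borel_measurable borel" "w \<in> borel_measurable borel"
    and u2: "(\<integral>\<^sup>+z. ennreal ((norm (u z))\<^sup>2) \<partial>lborel) < \<infinity>"
    and l: "0 < l" and uvw: "AE z in lborel. u z = v z + w z"
    and osc: "\<And>c t x. 0 < c \<Longrightarrow> \<exists>\<kappa>. (\<integral>\<^sup>+z\<in>cylinder \<gamma> c t x. ennreal (norm (w z - \<kappa>)) \<partial>lborel)
      \<le> ennreal b * emeasure lborel (cylinder \<gamma> c t x)"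
    and b: "0 \<le> b" and \<delta>: "0 < \<delta>"
  shows "emeasure lborel (level_set \<gamma> (\<lambda>z. ennreal (norm (u z))) ((grid_ratio \<gamma> CARD('n) + 2) * l))
    \<le> ennreal (b * cyl_ratio \<gamma> CARD('n) / l + \<delta>) * emeasure lborel (level_set \<gamma> (\<lambda>z. ennreal (norm (u z))) l)
      + ennreal (1 / (\<delta> * l\<^sup>2)) * (\<integral>\<^sup>+z. ennreal ((norm (v z))\<^sup>2) \<partial>lborel)"
proof -
  let ?F = "\<lambda>z. ennreal (norm (u z))"
  define D where "D = grid_ratio \<gamma> CARD('n)"
  have D: "0 < D" by (simp add: D_def grid_ratio_pos)
  let ?L = "(D + 2) * l"
  have L: "0 < ?L" "l \<le> ?L"
    using D l by (auto simp: mult_le_cancel_right1)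
  have F2: "(\<integral>\<^sup>+z. (?F z)\<^sup>2 \<partial>lborel) < \<infinity>"
    using u2 by (simp add: ennreal_power)
  have Fm: "?F \<in> borel_measurable borel" by measurable
  note [measurable] = level_set_borel[OF \<gamma> Fm F2 l] level_set_borel[OF \<gamma> Fm F2 L(1)]
  let ?E = "level_set \<gamma> ?F ?L"
  define a where "a = b * cyl_ratio \<gamma> CARD('n) / l"
  have a: "0 \<le> a" using b l cyl_ratio_nonneg by (simp add: a_def)
  let ?G = "\<lambda>z. ennreal (a + \<delta>) + ennreal (1 / (\<delta> * l\<^sup>2)) * ennreal ((norm (v z))\<^sup>2)"
  obtain \<M> where \<M>: "countable \<M>" "disjoint \<M>" "\<Union>\<M> = level_set \<gamma> ?F l"
    "\<And>Q. Q \<in> \<M> \<Longrightarrow> \<exists>k z. Q = gridbox \<gamma> k z \<and> high \<gamma> ?F l k z \<and> (\<forall>j<k. \<not> high \<gamma> ?F l j z)"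
    by (rule level_set_boxes[OF \<gamma> Fm F2 l]) (rule that)
  have "emeasure lborel ?E = (\<integral>\<^sup>+z\<in>\<Union>\<M>. indicator ?E z \<partial>lborel)"
  proof -
    have "emeasure lborel ?E = (\<integral>\<^sup>+z. indicator ?E z \<partial>lborel)" by simp
    also have "\<dots> = (\<integral>\<^sup>+z\<in>\<Union>\<M>. indicator ?E z \<partial>lborel)"
      unfolding \<M>(3) using level_set_antimono[OF L(2), of \<gamma> ?F]
      by (intro nn_integral_cong) (auto simp: indicator_def)
    finally show ?thesis .
  qed
  also have "\<dots> \<le> (\<integral>\<^sup>+z\<in>\<Union>\<M>. ?G z \<partial>lborel)"
  proof (rule nn_integral_Union_mono[OF _ _ \<M>(1,2)])
    fix Q assume "Q \<in> \<M>"
    then obtain k z where Q: "Q = gridbox \<gamma> k z" and stop: "high \<gamma> ?F l k z" "\<And>j. j < k \<Longrightarrow> \<not> high \<gamma> ?F l j z"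
      using \<M>(4) by blast
    show "Q \<in> sets borel" by (simp add: Q)
    have "ennreal l * emeasure lborel (?E \<inter> Q) \<le> (\<integral>\<^sup>+y\<in>Q. ennreal (norm (v y)) \<partial>lborel) + ennreal (b * cyl_ratio \<gamma> CARD('n)) * emeasure lborel Q"
      unfolding Q D_def by (rule good_lambda_box[OF \<gamma> _ _ _ u2 l uvw osc b stop]) auto
    then have "ennreal (1 / l) * (ennreal l * emeasure lborel (?E \<inter> Q))
        \<le> ennreal (1 / l) * ((\<integral>\<^sup>+y\<in>Q. ennreal (norm (v y)) \<partial>lborel) + ennreal (b * cyl_ratio \<gamma> CARD('n)) * emeasure lborel Q)"
      by (rule mult_left_mono) simp
    also have "ennreal (1 / l) * (ennreal l * emeasure lborel (?E \<inter> Q)) = emeasure lborel (?E \<inter> Q)"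
      using l by (simp add: mult.assoc[symmetric] ennreal_mult[symmetric])
    also have "ennreal (1 / l) * ((\<integral>\<^sup>+y\<in>Q. ennreal (norm (v y)) \<partial>lborel) + ennreal (b * cyl_ratio \<gamma> CARD('n)) * emeasure lborel Q)
        = ennreal (1 / l) * (\<integral>\<^sup>+y\<in>Q. ennreal (norm (v y)) \<partial>lborel) + ennreal a * emeasure lborel Q"
    proof -
      have "ennreal (1 / l) * ennreal (b * cyl_ratio \<gamma> CARD('n)) = ennreal a"
        using l b cyl_ratio_nonneg[of \<gamma> "CARD('n)"] by (simp add: a_def ennreal_mult[symmetric])
      then show ?thesis
        by (simp only: distrib_left mult.assoc[symmetric])
    qed
    also have "\<dots> = (\<integral>\<^sup>+y. ennreal (1 / l) * (ennreal (norm (v y)) * indicator Q y) + ennreal a * indicator Q y \<partial>lborel)"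
    proof -
      have [measurable]: "Q \<in> sets borel" by (simp add: Q)
      show ?thesis
        by (subst nn_integral_add, measurable) (simp add: nn_integral_cmult nn_integral_cmult_indicator del: ennreal_mult')
    qed
    also have "\<dots> \<le> (\<integral>\<^sup>+z\<in>Q. ?G z \<partial>lborel)"
    proof (rule nn_integral_mono)
      fix y
      define r where "r = norm (v y) / l"
      have r: "0 \<le> r" using l by (simp add: r_def)
      \<comment> \<open>From 2ab \<le> a^2 + b^2 with a = r and b = \<delta>, divided by
        \<delta>.\<close>
      have "r \<le> \<delta> + r\<^sup>2 / \<delta>"
      proof -
        have "0 \<le> r * \<delta>" using r \<delta> by simp
        then have "r * \<delta> \<le> \<delta> * \<delta> + r\<^sup>2"
          using sum_squares_bound[of r \<delta>] unfolding power2_eq_square by linarith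
        then show ?thesis using \<delta> by (simp add: field_simps)
      qed
      then have "ennreal (r + a) \<le> ennreal (a + \<delta> + r\<^sup>2 / \<delta>)"
        by (intro ennreal_leI) simp
      moreover have "r\<^sup>2 / \<delta> = 1 / (\<delta> * l\<^sup>2) * (norm (v y))\<^sup>2"
        by (simp add: r_def power_divide)
      moreover have "ennreal (1 / l) * ennreal (norm (v y)) + ennreal a = ennreal (r + a)"
        using l a r by (simp add: ennreal_mult[symmetric] r_def)
      moreover have "ennreal (a + \<delta> + 1 / (\<delta> * l\<^sup>2) * (norm (v y))\<^sup>2) = ?G y"
        using a \<delta> by (simp add: ennreal_mult[symmetric] ennreal_plus[symmetric] del: ennreal_plus)
      ultimately show "ennreal (1 / l) * (ennreal (norm (v y)) * indicator Q y) + ennreal a * indicator Q y \<le> ?G y * indicator Q y"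
        by (cases "y \<in> Q") simp_all
    qed
    finally show "(\<integral>\<^sup>+z\<in>Q. indicator ?E z \<partial>lborel) \<le> (\<integral>\<^sup>+z\<in>Q. ?G z \<partial>lborel)"
      using Q by (simp add: indicator_inter_arith[symmetric])
  qed auto
  also have "\<dots> \<le> (\<integral>\<^sup>+z. ennreal (a + \<delta>) * indicator (level_set \<gamma> ?F l) z + ennreal (1 / (\<delta> * l\<^sup>2)) * ennreal ((norm (v z))\<^sup>2) \<partial>lborel)"
    unfolding \<M>(3) by (intro nn_integral_mono) (auto simp: indicator_def)
  also have "\<dots> = ennreal (a + \<delta>) * emeasure lborel (level_set \<gamma> ?F l) + ennreal (1 / (\<delta> * l\<^sup>2)) * (\<integral>\<^sup>+z. ennreal ((norm (v z))\<^sup>2) \<partial>lborel)"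
    by (subst nn_integral_add) (auto simp: nn_integral_cmult nn_integral_cmult_indicator)
  finally show ?thesis
    unfolding D_def a_def .
qed

section \<open>Power integrals and integration over levels\<close>

lemma nn_integral_powr:
  fixes q a :: real
  assumes q: "-1 < q" and a: "0 \<le> a"
  shows "(\<integral>\<^sup>+l\<in>{0<..<a}. ennreal (l powr q) \<partial>lborel) = ennreal (a powr (q + 1) / (q + 1))"
proof -
  have "(\<integral>\<^sup>+l\<in>{0<..<a}. ennreal (l powr q) \<partial>lborel) = (\<integral>\<^sup>+l. ennreal (indicator {0..a} l * l powr q) \<partial>lborel)"
  proof (rule nn_integral_cong_AE)
    show "AE l in lborel. ennreal (l powr q) * indicator {0<..<a} l = ennreal (indicator {0..a} l * l powr q)"
      using AE_lborel_singleton[of 0] AE_lborel_singleton[of a]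
      by eventually_elim (auto simp: indicator_def)
  qed
  also have "\<dots> = ennreal (a powr (q + 1) / (q + 1))"
    by (rule nn_integral_has_integral_lebesgue[OF _ has_integral_powr_from_0[OF q a]]) simp
  finally show ?thesis .
qed

lemma antimono_ennreal_borel:
  fixes m :: "real \<Rightarrow> ennreal"
  assumes "antimono m"
  shows "m \<in> borel_measurable borel"
proof (rule borel_measurableI_greater)
  fix y
  have "is_interval {x. y < m x}"
    unfolding is_interval_1
  proof (intro ballI allI impI)
    fix a b x assume "a \<in> {x. y < m x}" "b \<in> {x. y < m x}" "a \<le> x \<and> x \<le> b"
    then show "x \<in> {x. y < m x}"
      using antimonoD[OF assms, of x b] by auto
  qed
  then show "{x \<in> space borel. y < m x} \<in> sets borel"
    using real_interval_borel_measurable by simp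
qed

lemma nn_integral_powr_layer_cake:
  fixes u :: "'a::euclidean_space \<Rightarrow> complex"
  assumes [measurable]: "u \<in> borel_measurable borel" and p: "0 < p"
  shows "(\<integral>\<^sup>+z. ennreal (norm (u z) powr p) \<partial>lborel)
    = (\<integral>\<^sup>+l\<in>{0<..}. ennreal (p * l powr (p - 1)) * emeasure lborel {z. l < norm (u z)} \<partial>lborel)"
proof -
  have "(\<integral>\<^sup>+z. ennreal (norm (u z) powr p) \<partial>lborel)
      = (\<integral>\<^sup>+z. (\<integral>\<^sup>+l. ennreal (p * l powr (p - 1)) * indicator {0<..<norm (u z)} l \<partial>lborel) \<partial>lborel)"
  proof (rule nn_integral_cong)
    fix z
    have "(\<integral>\<^sup>+l. ennreal (p * l powr (p - 1)) * indicator {0<..<norm (u z)} l \<partial>lborel)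
        = ennreal p * (\<integral>\<^sup>+l\<in>{0<..<norm (u z)}. ennreal (l powr (p - 1)) \<partial>lborel)"
      using p by (subst nn_integral_cmult[symmetric]) (auto simp: ennreal_mult mult.assoc)
    also have "\<dots> = ennreal (norm (u z) powr p)"
      using p by (subst nn_integral_powr) (auto simp: ennreal_mult[symmetric])
    finally show "ennreal (norm (u z) powr p) = (\<integral>\<^sup>+l. ennreal (p * l powr (p - 1)) * indicator {0<..<norm (u z)} l \<partial>lborel)" ..
  qed
  also have "\<dots> = (\<integral>\<^sup>+z. (\<integral>\<^sup>+l. ennreal (p * l powr (p - 1)) * indicator {0<..} l * indicator {z. l < norm (u z)} z \<partial>lborel) \<partial>lborel)"
    by (intro nn_integral_cong) (auto simp: indicator_def)
  also have "\<dots> = (\<integral>\<^sup>+l. (\<integral>\<^sup>+z. ennreal (p * l powr (p - 1)) * indicator {0<..} l * indicator {z. l < norm (u z)} z \<partial>lborel) \<partial>lborel)"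
    by (rule lborel_pair.Fubini') measurable
  also have "\<dots> = (\<integral>\<^sup>+l\<in>{0<..}. ennreal (p * l powr (p - 1)) * emeasure lborel {z. l < norm (u z)} \<partial>lborel)"
    by (intro nn_integral_cong) (subst nn_integral_cmult_indicator, auto simp: mult_ac)
  finally show ?thesis .
qed

text \<open>Finiteness of \<open>x\<close> is essential; in the application it comes from truncating
  the level integral.\<close>

lemma ennreal_absorb_half:
  fixes x y :: ennreal
  assumes "x < \<infinity>" "x \<le> ennreal (1 / 2) * x + y"
  shows "x \<le> 2 * y"
proof (cases "y = \<infinity>")
  case True
  then show ?thesis by (simp add: ennreal_mult_eq_top_iff)
next
  case False
  then obtain b where b: "y = ennreal b" "0 \<le> b" by (cases y) auto
  obtain a where a: "x = ennreal a" "0 \<le> a" using assms(1) by (cases x) auto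
  have "ennreal (1 / 2 * a + b) = ennreal (1 / 2) * ennreal a + ennreal b"
    using a(2) b(2) by (simp only: ennreal_plus ennreal_mult zero_le_divide_1_iff zero_le_numeral mult_nonneg_nonneg)
  then have "ennreal a \<le> ennreal (1 / 2 * a + b)"
    using assms(2) by (simp only: a(1) b(1))
  then have "a \<le> 1 / 2 * a + b"
    using a(2) b(2) by (subst (asm) ennreal_le_iff) auto
  then have "a \<le> 2 * b" by simp
  then have "ennreal a \<le> ennreal (2 * b)" by (rule ennreal_leI)
  also have "\<dots> = 2 * y" using b by (simp add: ennreal_mult)
  finally show ?thesis by (simp add: a)
qed

text \<open>L is the height ratio of the good-lambda inequality. \<theta> gives L^p \<theta> = 1/2,
  so that term can be absorbed; \<epsilon> keeps the oscillation term below \<theta>/2, and \<delta>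
  is the other \<theta>/2, whence 2A/\<theta>. The outer p stems from the layer cake formula, the
  next 2 from absorption, and the last quotient from integrating the cut square of \<open>f\<close>
  over levels.\<close>

definition lp_const :: "real \<Rightarrow> real \<Rightarrow> nat \<Rightarrow> real \<Rightarrow> real" where
  "lp_const \<gamma> p n A =
    (let L = grid_ratio \<gamma> n + 2; \<theta> = L powr (- p) / 2; \<epsilon> = \<theta> / (2 * (A * cyl_ratio \<gamma> n + 1))
     in p * (2 * (L powr p * (2 * A / \<theta> * (\<epsilon> powr (2 - p) / (p - 2))))))"

text \<open>The operator enters only through \<open>split\<close>. Cutting at a height proportional
  to the level l makes the oscillation term, of size A \<epsilon> l, a fixed fraction of l, so the
  factor in front of the level set does not depend on l.\<close>

lemma lp_from_good_lambda:
  fixes u f :: "real \<times> (real ^ 'n) \<Rightarrow> complex"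
  assumes \<gamma>: "0 < \<gamma>" and p: "2 < p" and A: "0 \<le> A"
    and um [measurable]: "u \<in> borel_measurable borel" and fm [measurable]: "f \<in> borel_measurable borel"
    and u2: "(\<integral>\<^sup>+z. ennreal ((norm (u z))\<^sup>2) \<partial>lborel) < \<infinity>"
    and split: "\<And>\<mu>. 0 < \<mu> \<Longrightarrow> \<exists>v w. v \<in> borel_measurable borel \<and> w \<in> borel_measurable borel \<and>
      (AE z in lborel. u z = v z + w z) \<and>
      (\<integral>\<^sup>+z. ennreal ((norm (v z))\<^sup>2) \<partial>lborel) \<le> ennreal A * (\<integral>\<^sup>+z\<in>{z. \<mu> < norm (f z)}. ennreal ((norm (f z))\<^sup>2) \<partial>lborel) \<and>
      (\<forall>c>0. \<forall>t x. \<exists>\<kappa>. (\<integral>\<^sup>+z\<in>cylinder \<gamma> c t x. ennreal (norm (w z - \<kappa>)) \<partial>lborel)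
        \<le> ennreal (A * \<mu>) * emeasure lborel (cylinder \<gamma> c t x))"
  shows "(\<integral>\<^sup>+z. ennreal (norm (u z) powr p) \<partial>lborel)
    \<le> ennreal (lp_const \<gamma> p CARD('n) A) * (\<integral>\<^sup>+z. ennreal (norm (f z) powr p) \<partial>lborel)"
proof -
  define L where "L = grid_ratio \<gamma> CARD('n) + 2"
  define \<theta> where "\<theta> = L powr (- p) / 2"
  define \<epsilon> where "\<epsilon> = \<theta> / (2 * (A * cyl_ratio \<gamma> CARD('n) + 1))"
  define C where "C = 2 * A / \<theta>"
  let ?F = "\<lambda>z. ennreal (norm (u z))"
  have L: "1 < L" using grid_ratio_pos[of \<gamma> "CARD('n)"] by (simp add: L_def)
  then have \<theta>: "0 < \<theta>" by (simp add: \<theta>_def)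
  have Ac: "0 \<le> A * cyl_ratio \<gamma> CARD('n)" using A cyl_ratio_nonneg by simp
  then have \<epsilon>: "0 < \<epsilon>" using \<theta> by (simp add: \<epsilon>_def)
  have C: "0 \<le> C" using A \<theta> by (simp add: C_def)
  have F2: "(\<integral>\<^sup>+z. (?F z)\<^sup>2 \<partial>lborel) < \<infinity>"
    using u2 by (simp add: ennreal_power)
  have Fm: "?F \<in> borel_measurable borel" by measurable
  \<comment> \<open>The value \<infinity> at nonpositive levels keeps \<open>m\<close> antimonotone
    on the whole line, whence it is Borel.\<close>
  define m where "m l = (if 0 < l then emeasure lborel (level_set \<gamma> ?F l) else \<infinity>)" for l
  have "antimono m"
  proof (rule antimonoI)
    fix a b :: real assume "a \<le> b"
    then show "m b \<le> m a"
      using level_set_antimono[of a b \<gamma> ?F] level_set_borel[OF \<gamma> Fm F2]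
      by (auto simp: m_def intro!: emeasure_mono)
  qed
  then have [measurable]: "m \<in> borel_measurable borel" by (rule antimono_ennreal_borel)
  define X where "X l = (\<integral>\<^sup>+z\<in>{z. \<epsilon> * l < norm (f z)}. ennreal ((norm (f z))\<^sup>2) \<partial>lborel)" for l
  have [measurable]: "X \<in> borel_measurable borel"
    unfolding X_def[abs_def] by measurable
  have step: "m (L * l) \<le> ennreal \<theta> * m l + ennreal (C / l\<^sup>2) * X l" if l: "0 < l" for l
  proof -
    obtain v w where [measurable]: "v \<in> borel_measurable borel" "w \<in> borel_measurable borel"
      and uvw: "AE z in lborel. u z = v z + w z"
      and v: "(\<integral>\<^sup>+z. ennreal ((norm (v z))\<^sup>2) \<partial>lborel) \<le> ennreal A * X l"
      and osc: "\<And>c t x. 0 < c \<Longrightarrow> \<exists>\<kappa>. (\<integral>\<^sup>+z\<in>cylinder \<gamma> c t x. ennreal (norm (w z - \<kappa>)) \<partial>lborel)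
        \<le> ennreal (A * (\<epsilon> * l)) * emeasure lborel (cylinder \<gamma> c t x)"
      using split[OF mult_pos_pos[OF \<epsilon> l]] unfolding X_def by blast
    have "m (L * l) \<le> ennreal (A * (\<epsilon> * l) * cyl_ratio \<gamma> CARD('n) / l + \<theta> / 2) * m l
        + ennreal (1 / (\<theta> / 2 * l\<^sup>2)) * (\<integral>\<^sup>+z. ennreal ((norm (v z))\<^sup>2) \<partial>lborel)"
      using good_lambda[OF \<gamma> um _ _ u2 l uvw osc, of "\<theta> / 2"] l \<epsilon> \<theta> A L
      by (simp add: m_def L_def)
    also have "\<dots> \<le> ennreal \<theta> * m l + ennreal (1 / (\<theta> / 2 * l\<^sup>2)) * (ennreal A * X l)"
    proof (intro add_mono mult_right_mono mult_left_mono v ennreal_leI)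
      have "\<epsilon> * (A * cyl_ratio \<gamma> CARD('n)) \<le> \<epsilon> * (A * cyl_ratio \<gamma> CARD('n) + 1)"
        using \<epsilon> by simp
      also have "\<dots> = \<theta> / 2"
      proof -
        have "\<theta> / (2 * (W + 1)) * (W + 1) = \<theta> / 2" if "0 \<le> W" for W
          using that by (simp add: field_simps)
        then show ?thesis unfolding \<epsilon>_def using Ac by blast
      qed
      finally show "A * (\<epsilon> * l) * cyl_ratio \<gamma> CARD('n) / l + \<theta> / 2 \<le> \<theta>"
        using l by (simp add: mult_ac)
    qed auto
    also have "ennreal (1 / (\<theta> / 2 * l\<^sup>2)) * (ennreal A * X l) = ennreal (C / l\<^sup>2) * X l"
      using A \<theta> l by (simp add: C_def mult.assoc[symmetric] ennreal_mult[symmetric])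
    finally show ?thesis .
  qed
  define I where "I \<Lambda> = (\<integral>\<^sup>+l\<in>{0<..<\<Lambda>}. ennreal (l powr (p - 1)) * m l \<partial>lborel)" for \<Lambda>
  define Y where "Y = (\<integral>\<^sup>+l\<in>{0<..}. ennreal (l powr (p - 3)) * X l \<partial>lborel)"
  have pw: "l powr (p - 1) * (1 / l\<^sup>2) = l powr (p - 3)" if "0 < l" for l :: real
  proof -
    have "l powr (p - 1) = l powr (p - 3) * l powr 2"
      by (simp add: powr_add[symmetric])
    then show ?thesis using that by (simp add: powr_numeral)
  qed
  \<comment> \<open>By the weak type bound l^2 \<open>m l\<close> is bounded, and l^(p - 3) is
    integrable at 0 because p > 2.\<close>
  have I_fin: "I \<Lambda> < \<infinity>" if "0 < \<Lambda>" for \<Lambda>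
  proof -
    have "I \<Lambda> \<le> (\<integral>\<^sup>+l. (ennreal (l powr (p - 3)) * indicator {0<..<\<Lambda>} l) * (\<integral>\<^sup>+z. (?F z)\<^sup>2 \<partial>lborel) \<partial>lborel)"
      unfolding I_def
    proof (rule nn_integral_mono)
      fix l
      show "ennreal (l powr (p - 1)) * m l * indicator {0<..<\<Lambda>} l
          \<le> (ennreal (l powr (p - 3)) * indicator {0<..<\<Lambda>} l) * (\<integral>\<^sup>+z. (?F z)\<^sup>2 \<partial>lborel)"
      proof (cases "l \<in> {0<..<\<Lambda>}")
        case True
        then have l: "0 < l" by simp
        have "ennreal (l powr (p - 1)) * m l = ennreal (l powr (p - 3)) * (ennreal (l\<^sup>2) * m l)"
          using l pw[OF l] by (simp add: mult.assoc[symmetric] ennreal_mult[symmetric]) (simp add: field_simps)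
        also have "\<dots> \<le> ennreal (l powr (p - 3)) * (\<integral>\<^sup>+z. (?F z)\<^sup>2 \<partial>lborel)"
          using level_set_weak_type[OF \<gamma> Fm F2 l] l by (intro mult_left_mono) (auto simp: m_def)
        finally show ?thesis using True by simp
      qed simp
    qed
    also have "\<dots> = ennreal (\<Lambda> powr (p - 3 + 1) / (p - 3 + 1)) * (\<integral>\<^sup>+z. (?F z)\<^sup>2 \<partial>lborel)"
      using p that by (subst nn_integral_multc, measurable) (subst nn_integral_powr, auto)
    also have "\<dots> < \<infinity>"
      using F2 by (simp add: ennreal_mult_less_top)
    finally show ?thesis .
  qed
  have I_le: "I \<Lambda> \<le> 2 * (ennreal (L powr p * C) * Y)" if \<Lambda>: "0 < \<Lambda>" for \<Lambda>
  proof (rule ennreal_absorb_half[OF I_fin[OF \<Lambda>]])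
    \<comment> \<open>With the range enlarged first, the substitution of L l for l lands on the
      range of \<open>I \<Lambda>\<close> again.\<close>
    have "I \<Lambda> \<le> I (L * \<Lambda>)"
      unfolding I_def using L \<Lambda>
      by (intro nn_integral_mono mult_left_mono) (auto simp: indicator_def less_le_trans[of _ \<Lambda> "L * \<Lambda>"])
    also have "\<dots> = ennreal L * (\<integral>\<^sup>+l. ennreal ((0 + L * l) powr (p - 1)) * m (0 + L * l) * indicator {0<..<L * \<Lambda>} (0 + L * l) \<partial>lborel)"
      unfolding I_def using L by (subst nn_integral_real_affine[where c=L and t=0]) auto
    also have "\<dots> = (\<integral>\<^sup>+l. ennreal L * (ennreal ((0 + L * l) powr (p - 1)) * m (0 + L * l) * indicator {0<..<L * \<Lambda>} (0 + L * l)) \<partial>lborel)"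
      by (rule nn_integral_cmult[symmetric]) measurable
    also have "\<dots> \<le> (\<integral>\<^sup>+l. ennreal (1 / 2) * (ennreal (l powr (p - 1)) * m l * indicator {0<..<\<Lambda>} l)
        + ennreal (L powr p * C) * (ennreal (l powr (p - 3)) * X l * indicator {0<..} l) \<partial>lborel)"
    proof (rule nn_integral_mono)
      fix l
      show "ennreal L * (ennreal ((0 + L * l) powr (p - 1)) * m (0 + L * l) * indicator {0<..<L * \<Lambda>} (0 + L * l))
          \<le> ennreal (1 / 2) * (ennreal (l powr (p - 1)) * m l * indicator {0<..<\<Lambda>} l)
        + ennreal (L powr p * C) * (ennreal (l powr (p - 3)) * X l * indicator {0<..} l)"
      proof (cases "0 < l \<and> l < \<Lambda>")
        case True
        then have l: "0 < l" by simp
        have e1: "L * (L * l) powr (p - 1) = L powr p * l powr (p - 1)"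
          using L l by (simp add: powr_mult powr_diff)
        have e2: "L powr p * \<theta> = 1 / 2"
          using L by (simp add: \<theta>_def powr_minus)
        have "ennreal L * (ennreal ((L * l) powr (p - 1)) * m (L * l))
            = ennreal (L powr p * l powr (p - 1)) * m (L * l)"
          using L by (simp add: e1[symmetric] ennreal_mult mult.assoc)
        also have "\<dots> \<le> ennreal (L powr p * l powr (p - 1)) * (ennreal \<theta> * m l + ennreal (C / l\<^sup>2) * X l)"
          by (intro mult_left_mono step[OF l]) simp
        also have "\<dots> = ennreal (L powr p * l powr (p - 1) * \<theta>) * m l + ennreal (L powr p * l powr (p - 1) * (C / l\<^sup>2)) * X l"
          using \<theta> C by (simp only: distrib_left mult.assoc[symmetric] ennreal_mult[symmetric] mult_nonneg_nonneg powr_ge_zero divide_nonneg_nonneg zero_le_power2 less_imp_le)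
        also have "L powr p * l powr (p - 1) * \<theta> = 1 / 2 * l powr (p - 1)"
          using e2 by (simp add: mult_ac)
        also have "L powr p * l powr (p - 1) * (C / l\<^sup>2) = L powr p * C * l powr (p - 3)"
          by (simp add: pw[OF l, symmetric])
        finally have "ennreal L * (ennreal ((L * l) powr (p - 1)) * m (L * l))
            \<le> ennreal (1 / 2 * l powr (p - 1)) * m l + ennreal (L powr p * C * l powr (p - 3)) * X l" .
        also have "\<dots> = ennreal (1 / 2) * (ennreal (l powr (p - 1)) * m l) + ennreal (L powr p * C) * (ennreal (l powr (p - 3)) * X l)"
          using C by (simp only: mult.assoc[symmetric] ennreal_mult[symmetric] mult_nonneg_nonneg powr_ge_zero zero_le_divide_1_iff zero_le_numeral)
        finally show ?thesis using True L \<Lambda> by simp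
      next
        case False
        then have "0 + L * l \<notin> {0<..<L * \<Lambda>}"
          using L \<Lambda> by (auto simp: zero_less_mult_iff)
        then show ?thesis by simp
      qed
    qed
    also have "\<dots> = ennreal (1 / 2) * I \<Lambda> + ennreal (L powr p * C) * Y"
      unfolding I_def Y_def by (subst nn_integral_add, measurable) (subst nn_integral_cmult, measurable, subst nn_integral_cmult, measurable)
    finally show "I \<Lambda> \<le> ennreal (1 / 2) * I \<Lambda> + ennreal (L powr p * C) * Y" .
  qed
  \<comment> \<open>Tonelli: for fixed z the levels with \<epsilon> l < |f z| form the interval
    below |f z| / \<epsilon>, whose integral raises the square to the power p.\<close>
  have Y: "Y = ennreal (\<epsilon> powr (2 - p) / (p - 2)) * (\<integral>\<^sup>+z. ennreal (norm (f z) powr p) \<partial>lborel)"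
  proof -
    have "Y = (\<integral>\<^sup>+l. (\<integral>\<^sup>+z. ennreal (l powr (p - 3)) * indicator {0<..} l * (ennreal ((norm (f z))\<^sup>2) * indicator {z. \<epsilon> * l < norm (f z)} z) \<partial>lborel) \<partial>lborel)"
      unfolding Y_def X_def by (intro nn_integral_cong) (subst nn_integral_cmult, measurable, simp add: mult_ac)
    also have "\<dots> = (\<integral>\<^sup>+z. (\<integral>\<^sup>+l. ennreal (l powr (p - 3)) * indicator {0<..} l * (ennreal ((norm (f z))\<^sup>2) * indicator {z. \<epsilon> * l < norm (f z)} z) \<partial>lborel) \<partial>lborel)"
      by (rule lborel_pair.Fubini') measurable
    also have "\<dots> = (\<integral>\<^sup>+z. ennreal (\<epsilon> powr (2 - p) / (p - 2)) * ennreal (norm (f z) powr p) \<partial>lborel)"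
    proof (rule nn_integral_cong)
      fix z
      have "(\<integral>\<^sup>+l. ennreal (l powr (p - 3)) * indicator {0<..} l * (ennreal ((norm (f z))\<^sup>2) * indicator {z. \<epsilon> * l < norm (f z)} z) \<partial>lborel)
          = (\<integral>\<^sup>+l. ennreal ((norm (f z))\<^sup>2) * (ennreal (l powr (p - 3)) * indicator {0<..<norm (f z) / \<epsilon>} l) \<partial>lborel)"
        using \<epsilon> by (intro nn_integral_cong) (auto simp: indicator_def field_simps)
      also have "\<dots> = ennreal ((norm (f z))\<^sup>2) * ennreal ((norm (f z) / \<epsilon>) powr (p - 2) / (p - 2))"
        using p \<epsilon> by (subst nn_integral_cmult, measurable) (subst nn_integral_powr, auto)
      also have "\<dots> = ennreal ((norm (f z))\<^sup>2 * ((norm (f z) / \<epsilon>) powr (p - 2) / (p - 2)))"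
        using p by (subst ennreal_mult) auto
      also have "(norm (f z))\<^sup>2 * ((norm (f z) / \<epsilon>) powr (p - 2) / (p - 2)) = \<epsilon> powr (2 - p) / (p - 2) * norm (f z) powr p"
      proof (cases "f z = 0")
        case False
        have "norm (f z) powr ((p - 2) + 2) = norm (f z) powr (p - 2) * norm (f z) powr 2"
          by (rule powr_add)
        then have "norm (f z) powr p = norm (f z) powr (p - 2) * (norm (f z))\<^sup>2"
          using False by simp
        moreover have "\<epsilon> powr (2 - p) = 1 / \<epsilon> powr (p - 2)"
          by (simp add: powr_minus_divide[symmetric])
        ultimately show ?thesis
          using \<epsilon> by (simp add: powr_divide)
      qed (use p in simp)
      also have "ennreal (\<epsilon> powr (2 - p) / (p - 2) * norm (f z) powr p) = ennreal (\<epsilon> powr (2 - p) / (p - 2)) * ennreal (norm (f z) powr p)"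
        using p by (subst ennreal_mult) auto
      finally show "(\<integral>\<^sup>+l. ennreal (l powr (p - 3)) * indicator {0<..} l * (ennreal ((norm (f z))\<^sup>2) * indicator {z. \<epsilon> * l < norm (f z)} z) \<partial>lborel)
          = ennreal (\<epsilon> powr (2 - p) / (p - 2)) * ennreal (norm (f z) powr p)" .
    qed
    also have "\<dots> = ennreal (\<epsilon> powr (2 - p) / (p - 2)) * (\<integral>\<^sup>+z. ennreal (norm (f z) powr p) \<partial>lborel)"
      by (rule nn_integral_cmult) measurable
    finally show ?thesis .
  qed
  have "(\<integral>\<^sup>+z. ennreal (norm (u z) powr p) \<partial>lborel)
      = (\<integral>\<^sup>+l\<in>{0<..}. ennreal (p * l powr (p - 1)) * emeasure lborel {z. l < norm (u z)} \<partial>lborel)"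
    using p by (intro nn_integral_powr_layer_cake um) simp
  also have "\<dots> \<le> (\<integral>\<^sup>+l\<in>{0<..}. ennreal (p * l powr (p - 1)) * m l \<partial>lborel)"
  proof (rule nn_integral_mono)
    fix l
    have "emeasure lborel {z. l < norm (u z)} \<le> m l" if l: "0 < l"
    proof -
      note [measurable] = level_set_borel[OF \<gamma> Fm F2 l]
      have "AE z in lborel. z \<in> {z. l < norm (u z)} \<longrightarrow> z \<in> level_set \<gamma> ?F l"
        using AE_le_off_level_set[OF \<gamma> Fm F2 l] by eventually_elim (use l in \<open>auto simp: not_le\<close>)
      then have "emeasure lborel {z. l < norm (u z)} \<le> emeasure lborel (level_set \<gamma> ?F l)"
        by (intro emeasure_mono_AE) auto
      then show ?thesis using l by (simp add: m_def)
    qed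
    then show "ennreal (p * l powr (p - 1)) * emeasure lborel {z. l < norm (u z)} * indicator {0<..} l
        \<le> ennreal (p * l powr (p - 1)) * m l * indicator {0<..} l"
      by (auto simp: indicator_def intro!: mult_left_mono)
  qed
  also have "\<dots> = (\<integral>\<^sup>+l. ennreal p * (ennreal (l powr (p - 1)) * m l * indicator {0<..} l) \<partial>lborel)"
    using p by (intro nn_integral_cong) (simp add: ennreal_mult mult.assoc)
  also have "\<dots> = ennreal p * (\<integral>\<^sup>+l\<in>{0<..}. ennreal (l powr (p - 1)) * m l \<partial>lborel)"
    by (rule nn_integral_cmult) measurable
  also have "(\<integral>\<^sup>+l\<in>{0<..}. ennreal (l powr (p - 1)) * m l \<partial>lborel) \<le> 2 * (ennreal (L powr p * C) * Y)"
  proof -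
    \<comment> \<open>The bound on \<open>I\<close> does not depend on the truncation height, which
      Fatou's lemma sends to infinity.\<close>
    let ?g = "\<lambda>n l. ennreal (l powr (p - 1)) * m l * indicator {0<..<real n} l"
    have "(\<lambda>n. ?g n l) \<longlonglongrightarrow> ennreal (l powr (p - 1)) * m l * indicator {0<..} l" for l
    proof (rule tendsto_eventually)
      obtain n0 :: nat where "l < real n0" using reals_Archimedean2 by blast
      then show "\<forall>\<^sub>F n in sequentially. ?g n l = ennreal (l powr (p - 1)) * m l * indicator {0<..} l"
        by (intro eventually_sequentiallyI[of n0]) (auto simp: indicator_def)
    qed
    then have "liminf (\<lambda>n. ?g n l) = ennreal (l powr (p - 1)) * m l * indicator {0<..} l" for l
      by (simp add: lim_imp_Liminf)
    then have "(\<integral>\<^sup>+l\<in>{0<..}. ennreal (l powr (p - 1)) * m l \<partial>lborel) = (\<integral>\<^sup>+l. liminf (\<lambda>n. ?g n l) \<partial>lborel)"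
      by simp
    also have "\<dots> \<le> liminf (\<lambda>n. \<integral>\<^sup>+l. ?g n l \<partial>lborel)"
      by (rule nn_integral_liminf) measurable
    also have "\<dots> \<le> liminf (\<lambda>n::nat. 2 * (ennreal (L powr p * C) * Y))"
    proof (rule Liminf_mono, rule eventually_sequentiallyI[of 1])
      fix n :: nat assume "1 \<le> n"
      then show "(\<integral>\<^sup>+l. ?g n l \<partial>lborel) \<le> 2 * (ennreal (L powr p * C) * Y)"
        using I_le[of "real n"] by (simp add: I_def)
    qed
    also have "\<dots> = 2 * (ennreal (L powr p * C) * Y)"
      by (simp add: Liminf_const)
    finally show ?thesis .
  qed
  finally have "(\<integral>\<^sup>+z. ennreal (norm (u z) powr p) \<partial>lborel) \<le> ennreal p * (2 * (ennreal (L powr p * C) * Y))"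
    by (simp add: mult_left_mono)
  also have "\<dots> = ennreal (p * (2 * (L powr p * (C * (\<epsilon> powr (2 - p) / (p - 2)))))) * (\<integral>\<^sup>+z. ennreal (norm (f z) powr p) \<partial>lborel)"
  proof -
    have "(2 :: ennreal) = ennreal 2" by simp
    moreover have "0 \<le> \<epsilon> powr (2 - p) / (p - 2)" "0 \<le> L powr p * C" using p C by auto
    ultimately show ?thesis
      using p C unfolding Y by (simp only: mult.assoc[symmetric] ennreal_mult[symmetric] mult_nonneg_nonneg zero_le_numeral)
  qed
  also have "p * (2 * (L powr p * (C * (\<epsilon> powr (2 - p) / (p - 2))))) = lp_const \<gamma> p CARD('n) A"
    unfolding lp_const_def Let_def L_def[symmetric] \<theta>_def[symmetric] \<epsilon>_def[symmetric] C_def[symmetric] ..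
  finally show ?thesis .
qed

section \<open>Bounds on Lebesgue spaces\<close>

text \<open>A class closed under cutting at a height, as test functions are not; mollification leads
  from it to \<open>regular\<close>.\<close>

definition bounded_compact_support :: "(real \<times> (real ^ 'n) \<Rightarrow> complex) \<Rightarrow> bool" where
  "bounded_compact_support f \<longleftrightarrow> f \<in> borel_measurable borel \<and>
     (\<exists>B. \<forall>z. norm (f z) \<le> B) \<and> (\<exists>R. \<forall>z. R < norm z \<longrightarrow> f z = 0)"

lemma bounded_compact_supportE:
  assumes "bounded_compact_support f"
  obtains B R where "f \<in> borel_measurable borel" "\<And>z. norm (f z) \<le> B" "\<And>z. R < norm z \<Longrightarrow> f z = 0"
  using assms unfolding bounded_compact_support_def by blast

lemma bounded_compact_support_restrict:
  assumes f: "bounded_compact_support f" and [measurable]: "S \<in> sets borel"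
  shows "bounded_compact_support (\<lambda>z. indicator S z * f z)"
proof -
  obtain B R where [measurable]: "f \<in> borel_measurable borel" and B: "\<And>z. norm (f z) \<le> B"
    and R: "\<And>z. R < norm z \<Longrightarrow> f z = 0"
    by (rule bounded_compact_supportE[OF f]) (rule that)
  have "norm (indicator S z * f z) \<le> B" for z
    using B[of z] order.trans[OF norm_ge_zero B] by (auto simp: indicator_def)
  moreover have "(\<lambda>z. indicator S z * f z) \<in> borel_measurable borel"
    by measurable
  ultimately show ?thesis
    unfolding bounded_compact_support_def using R by (intro conjI exI[of _ B] exI[of _ R]) auto
qed

lemma bounded_compact_support_slice:
  fixes f :: "real \<times> (real ^ 'n) \<Rightarrow> complex"
  assumes f: "bounded_compact_support f"
  obtains C where "\<And>s. integrable lborel (\<lambda>y. f (s, y))" "\<And>s. (LINT y|lborel. norm (f (s, y))) \<le> C"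
proof -
  obtain B R where fm: "f \<in> borel_measurable borel" and B: "\<And>z. norm (f z) \<le> B"
    and R: "\<And>z. R < norm z \<Longrightarrow> f z = 0"
    by (rule bounded_compact_supportE[OF f]) (rule that)
  note [measurable] = borel_measurable_Pair_section[OF fm]
  have supp: "f (s, y) = 0" if "y \<notin> cball 0 R" for s y
    using that norm_ge_zero[of s] by (intro R) (auto simp: norm_Pair intro: less_le_trans[OF _ real_sqrt_sum_squares_ge2])
  have i: "integrable lborel (\<lambda>y. f (s, y))" for s
    by (rule integrable_indicator_bounded[where B=B and S="cball 0 R"]) (use B supp in auto)
  have B0: "0 \<le> B" using order.trans[OF norm_ge_zero B] .
  have "(LINT y|lborel. norm (f (s, y))) \<le> (LINT y|lborel. B * indicator (cball (0 :: real ^ 'n) R) y)" for s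
  proof (rule integral_mono)
    show "integrable lborel (\<lambda>y. B * indicator (cball (0 :: real ^ 'n) R) y)"
      using emeasure_lborel_cball_finite[of "0 :: real ^ 'n" R] by (intro integrable_mult_right) auto
    show "norm (f (s, y)) \<le> B * indicator (cball 0 R) y" for y
      using B[of "(s, y)"] supp[of y s] B0 by (auto simp: indicator_def)
  qed (use i in simp)
  then show thesis
    by (intro that[of "LINT y|lborel. B * indicator (cball (0 :: real ^ 'n) R) y"] i)
qed

lemma bounded_compact_support_L2:
  fixes f :: "real \<times> (real ^ 'n) \<Rightarrow> complex"
  assumes f: "bounded_compact_support f"
  shows "(\<integral>\<^sup>+z. ennreal ((norm (f z))\<^sup>2) \<partial>lborel) < \<infinity>"
proof -
  obtain B R where [measurable]: "f \<in> borel_measurable borel" and B: "\<And>z. norm (f z) \<le> B"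
    and R: "\<And>z. R < norm z \<Longrightarrow> f z = 0"
    by (rule bounded_compact_supportE[OF f]) (rule that)
  have "(\<integral>\<^sup>+z. ennreal ((norm (f z))\<^sup>2) \<partial>lborel) \<le> (\<integral>\<^sup>+z. ennreal (B\<^sup>2) * indicator (cball (0 :: real \<times> (real ^ 'n)) R) z \<partial>lborel)"
  proof (rule nn_integral_mono)
    fix z
    show "ennreal ((norm (f z))\<^sup>2) \<le> ennreal (B\<^sup>2) * indicator (cball 0 R) z"
      using R[of z] B[of z] by (cases "norm z \<le> R") (auto intro!: ennreal_leI power_mono)
  qed
  also have "\<dots> = ennreal (B\<^sup>2) * emeasure lborel (cball (0 :: real \<times> (real ^ 'n)) R)"
    by (rule nn_integral_cmult_indicator) simp
  also have "\<dots> < \<infinity>"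
    using emeasure_lborel_cball_finite[of "0 :: real \<times> (real ^ 'n)" R] by (simp add: ennreal_mult_less_top)
  finally show ?thesis .
qed

text \<open>Acts slice by slice in space, so that at each time it is multiplication by a Gaussian on
  the Fourier side.\<close>

definition smoothing :: "real \<Rightarrow> (real \<times> (real ^ 'n) \<Rightarrow> complex) \<Rightarrow> real \<times> (real ^ 'n) \<Rightarrow> complex" where
  "smoothing \<sigma> f = (\<lambda>(s, y). mollify \<sigma> (\<lambda>w. f (s, w)) y)"

lemma regular_smoothing:
  assumes f: "bounded_compact_support f" and \<sigma>: "0 < \<sigma>"
  shows "regular (smoothing \<sigma> f)"
proof -
  obtain B R where fm: "f \<in> borel_measurable borel" and B: "\<And>z. norm (f z) \<le> B"
    and R: "\<And>z. R < norm z \<Longrightarrow> f z = 0"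
    by (rule bounded_compact_supportE[OF f]) (rule that)
  obtain C where C: "\<And>s. integrable lborel (\<lambda>y. f (s, y))" "\<And>s. (LINT y|lborel. norm (f (s, y))) \<le> C"
    by (rule bounded_compact_support_slice[OF f]) (rule that)
  show ?thesis
    unfolding smoothing_def by (rule regular_mollify[OF fm B C \<sigma>])
qed

lemma smoothing_L2:
  fixes f :: "real \<times> (real ^ 'n) \<Rightarrow> complex"
  assumes f: "bounded_compact_support f" and \<sigma>: "0 < \<sigma>"
  shows "(\<integral>\<^sup>+z. ennreal ((norm (smoothing \<sigma> f z))\<^sup>2) \<partial>lborel) \<le> (\<integral>\<^sup>+z. ennreal ((norm (f z))\<^sup>2) \<partial>lborel)"
proof -
  have fm [measurable]: "f \<in> borel_measurable borel"
    using f by (auto simp: bounded_compact_support_def)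
  have [measurable]: "smoothing \<sigma> f \<in> borel_measurable borel"
    using regular_smoothing[OF assms] by (auto simp: regular_def)
  have *: "(\<integral>\<^sup>+z. ennreal ((norm (h z))\<^sup>2) \<partial>lborel) = (\<integral>\<^sup>+s. (\<integral>\<^sup>+y. ennreal ((norm (h (s, y)))\<^sup>2) \<partial>lborel) \<partial>lborel)"
    if [measurable]: "h \<in> borel_measurable borel" for h :: "real \<times> (real ^ 'n) \<Rightarrow> complex"
    by (subst lborel_prod[symmetric], subst lborel.nn_integral_fst[symmetric]) (auto simp: lborel_prod)
  have "(\<integral>\<^sup>+y. ennreal ((norm (smoothing \<sigma> f (s, y)))\<^sup>2) \<partial>lborel) \<le> (\<integral>\<^sup>+y. ennreal ((norm (f (s, y)))\<^sup>2) \<partial>lborel)" for s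
    using mollify_L2[OF borel_measurable_Pair_section[OF fm] \<sigma>, of s] by (simp add: smoothing_def)
  then show ?thesis
    by (subst (1 2) *) (auto intro: nn_integral_mono)
qed

lemma smoothing_diff:
  assumes f: "bounded_compact_support f" and g: "bounded_compact_support g" and \<sigma>: "0 < \<sigma>"
  shows "smoothing \<sigma> (\<lambda>z. f z - g z) z = smoothing \<sigma> f z - smoothing \<sigma> g z"
proof -
  obtain s y where z: "z = (s, y)" by (cases z)
  have i: "integrable lborel (\<lambda>w. complex_of_real (gkernel \<sigma> (y - w)) * h (s, w))" if h: "bounded_compact_support h" for h
  proof -
    obtain B R where hm: "h \<in> borel_measurable borel" and B: "\<And>z. norm (h z) \<le> B"
      using h unfolding bounded_compact_support_def by blast
    note [measurable] = borel_measurable_Pair_section[OF hm]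
    show ?thesis
    proof (rule Bochner_Integration.integrable_bound)
      show "integrable lborel (\<lambda>w. complex_of_real (gkernel \<sigma> (y - w)) * complex_of_real B)"
        by (intro integrable_mult_left integrable_lborel_diff integrable_gkernel \<sigma>)
      show "AE w in lborel. norm (complex_of_real (gkernel \<sigma> (y - w)) * h (s, w)) \<le> norm (complex_of_real (gkernel \<sigma> (y - w)) * complex_of_real B)"
        by (auto simp: norm_mult intro!: mult_left_mono order.trans[OF B])
    qed measurable
  qed
  show ?thesis
    using i[OF f] i[OF g] by (simp add: z smoothing_def mollify_def right_diff_distrib diff_divide_distrib)
qed

context causal_kernel_estimates
begin

lemma bmo_const_pos: "0 < bmo_const"
  using \<phi>_nonneg[of 2] \<phi>_nonneg[of 3] unfolding bmo_const_def by (simp add: add_pos_nonneg)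

text \<open>The cut at height \<mu> precedes the mollification, which contracts the L2 norm of the
  large part and keeps the small part below \<mu>. The constant is independent of \<sigma>, as the
  later limit requires; the sum of the L2 and BMO constants serves both demands of
  \<open>split\<close>.\<close>

lemma kernel_op_smoothing_Lp:
  fixes f :: "real \<times> (real ^ 'n) \<Rightarrow> complex"
  assumes f: "bounded_compact_support f" and \<sigma>: "0 < \<sigma>" and p: "2 < p"
  shows "(\<integral>\<^sup>+z. ennreal (norm (kernel_op (smoothing \<sigma> f) z) powr p) \<partial>lborel)
    \<le> ennreal (lp_const \<gamma> p CARD('n) (M\<^sup>2 + bmo_const)) * (\<integral>\<^sup>+z. ennreal (norm (f z) powr p) \<partial>lborel)"
proof (rule lp_from_good_lambda[OF \<gamma>_pos p])
  have fm [measurable]: "f \<in> borel_measurable borel"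
    using f by (auto simp: bounded_compact_support_def)
  have opm: "kernel_op (smoothing \<sigma> h) \<in> borel_measurable borel" if "bounded_compact_support h" for h
    using regular_smoothing[OF that \<sigma>] by (intro kernel_op_borel_measurable) (auto simp: regular_def)
  show "0 \<le> M\<^sup>2 + bmo_const" using bmo_const_pos by simp
  show "kernel_op (smoothing \<sigma> f) \<in> borel_measurable borel" by (rule opm[OF f])
  show "f \<in> borel_measurable borel" by (rule fm)
  have L2: "(\<integral>\<^sup>+z. ennreal ((norm (kernel_op (smoothing \<sigma> h) z))\<^sup>2) \<partial>lborel) \<le> ennreal (M\<^sup>2) * (\<integral>\<^sup>+z. ennreal ((norm (h z))\<^sup>2) \<partial>lborel)"
    if "bounded_compact_support h" for h
    by (rule order.trans[OF kernel_op_L2_bound[OF regular_smoothing[OF that \<sigma>]]])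
      (intro mult_left_mono smoothing_L2 that \<sigma>, simp)
  show "(\<integral>\<^sup>+z. ennreal ((norm (kernel_op (smoothing \<sigma> f) z))\<^sup>2) \<partial>lborel) < \<infinity>"
    by (rule le_less_trans[OF L2[OF f]]) (use bounded_compact_support_L2[OF f] in \<open>simp add: ennreal_mult_less_top\<close>)
  fix \<mu> :: real assume \<mu>: "0 < \<mu>"
  define b where "b = (\<lambda>z. indicator {z. \<mu> < norm (f z)} z * f z)"
  define g where "g = (\<lambda>z. f z - b z)"
  have bs: "bounded_compact_support b"
    unfolding b_def by (intro bounded_compact_support_restrict f) measurable
  have g_eq: "g = (\<lambda>z. indicator {z. norm (f z) \<le> \<mu>} z * f z)"
    by (auto simp: g_def b_def indicator_def)
  have gs: "bounded_compact_support g"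
    unfolding g_eq by (intro bounded_compact_support_restrict f) measurable
  have g\<mu>: "norm (smoothing \<sigma> g z) \<le> \<mu>" for z
  proof -
    obtain s y where z: "z = (s, y)" by (cases z)
    have "norm (mollify \<sigma> (\<lambda>w. g (s, w)) y) \<le> \<mu>"
      using gs \<mu> by (intro norm_mollify_le \<sigma> borel_measurable_Pair_section)
        (auto simp: bounded_compact_support_def g_eq indicator_def)
    then show ?thesis by (simp add: z smoothing_def)
  qed
  show "\<exists>v w. v \<in> borel_measurable borel \<and> w \<in> borel_measurable borel \<and>
      (AE z in lborel. kernel_op (smoothing \<sigma> f) z = v z + w z) \<and>
      (\<integral>\<^sup>+z. ennreal ((norm (v z))\<^sup>2) \<partial>lborel) \<le> ennreal (M\<^sup>2 + bmo_const) * (\<integral>\<^sup>+z\<in>{z. \<mu> < norm (f z)}. ennreal ((norm (f z))\<^sup>2) \<partial>lborel) \<and>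
      (\<forall>c>0. \<forall>t x. \<exists>\<kappa>. (\<integral>\<^sup>+z\<in>cylinder \<gamma> c t x. ennreal (norm (w z - \<kappa>)) \<partial>lborel)
        \<le> ennreal ((M\<^sup>2 + bmo_const) * \<mu>) * emeasure lborel (cylinder \<gamma> c t x))"
  proof (rule exI[of _ "kernel_op (smoothing \<sigma> b)"], rule exI[of _ "kernel_op (smoothing \<sigma> g)"], intro conjI allI impI)
    show "kernel_op (smoothing \<sigma> b) \<in> borel_measurable borel" "kernel_op (smoothing \<sigma> g) \<in> borel_measurable borel"
      by (rule opm[OF bs]) (rule opm[OF gs])
    show "AE z in lborel. kernel_op (smoothing \<sigma> f) z = kernel_op (smoothing \<sigma> b) z + kernel_op (smoothing \<sigma> g) z"
      using AE_fst_not_N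
    proof eventually_elim
      case (elim z)
      obtain t x where z: "z = (t, x)" by (cases z)
      have t: "t \<notin> N" using elim z by simp
      have "smoothing \<sigma> g = (\<lambda>z. smoothing \<sigma> f z - smoothing \<sigma> b z)"
        unfolding g_def by (intro ext smoothing_diff f bs \<sigma>)
      then have "kernel_op (smoothing \<sigma> g) (t, x) = kernel_op (smoothing \<sigma> f) (t, x) - kernel_op (smoothing \<sigma> b) (t, x)"
        using kernel_op_diff[OF t regular_smoothing[OF f \<sigma>] regular_smoothing[OF bs \<sigma>]] by simp
      then show ?case by (simp add: z)
    qed
    have "(\<integral>\<^sup>+z. ennreal ((norm (kernel_op (smoothing \<sigma> b) z))\<^sup>2) \<partial>lborel) \<le> ennreal (M\<^sup>2) * (\<integral>\<^sup>+z. ennreal ((norm (b z))\<^sup>2) \<partial>lborel)"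
      by (rule L2[OF bs])
    also have "\<dots> \<le> ennreal (M\<^sup>2 + bmo_const) * (\<integral>\<^sup>+z. ennreal ((norm (b z))\<^sup>2) \<partial>lborel)"
      using bmo_const_pos by (intro mult_right_mono ennreal_leI) auto
    also have "(\<integral>\<^sup>+z. ennreal ((norm (b z))\<^sup>2) \<partial>lborel) = (\<integral>\<^sup>+z\<in>{z. \<mu> < norm (f z)}. ennreal ((norm (f z))\<^sup>2) \<partial>lborel)"
      by (intro nn_integral_cong) (simp add: b_def indicator_def)
    finally show "(\<integral>\<^sup>+z. ennreal ((norm (kernel_op (smoothing \<sigma> b) z))\<^sup>2) \<partial>lborel)
        \<le> ennreal (M\<^sup>2 + bmo_const) * (\<integral>\<^sup>+z\<in>{z. \<mu> < norm (f z)}. ennreal ((norm (f z))\<^sup>2) \<partial>lborel)" .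
    fix c :: real and t x assume c: "0 < c"
    obtain \<kappa> where "(\<integral>\<^sup>+z\<in>cylinder \<gamma> c t x. ennreal (norm (kernel_op (smoothing \<sigma> g) z - \<kappa>)) \<partial>lborel)
        \<le> ennreal (bmo_const * \<mu>) * emeasure lborel (cylinder \<gamma> c t x)"
      using kernel_op_oscillation[OF regular_smoothing[OF gs \<sigma>] g\<mu> \<mu> c] by blast
    also have "\<dots> \<le> ennreal ((M\<^sup>2 + bmo_const) * \<mu>) * emeasure lborel (cylinder \<gamma> c t x)"
      using \<mu> by (intro mult_right_mono ennreal_leI) auto
    finally show "\<exists>\<kappa>. (\<integral>\<^sup>+z\<in>cylinder \<gamma> c t x. ennreal (norm (kernel_op (smoothing \<sigma> g) z - \<kappa>)) \<partial>lborel)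
        \<le> ennreal ((M\<^sup>2 + bmo_const) * \<mu>) * emeasure lborel (cylinder \<gamma> c t x)" ..
  qed
qed

text \<open>Mollification multiplies \<open>symbol f t\<close> by a Gaussian that tends to 1, with
  the symbol itself as dominating function.\<close>

lemma kernel_op_smoothing_tendsto:
  fixes f :: "real \<times> (real ^ 'n) \<Rightarrow> complex"
  assumes f: "bounded_compact_support f" "regular f" and t: "t \<notin> N"
  shows "(\<lambda>n. kernel_op (smoothing (1 / real (Suc n)) f) (t, x)) \<longlonglongrightarrow> kernel_op f (t, x)"
proof -
  let ?P = "complex_of_real ((2 * pi) ^ CARD('n))"
  let ?s = "\<lambda>n. 1 / real (Suc n)"
  have fi: "integrable lborel (\<lambda>y. f (s, y))" for s
    using f(2) by (auto simp: regular_def)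
  have fm [measurable]: "f \<in> borel_measurable borel"
    using f(2) by (auto simp: regular_def)
  have sym: "symbol (smoothing \<sigma> f) t \<xi> = complex_of_real (gauss \<sigma> \<xi>) * symbol f t \<xi>" if \<sigma>: "0 < \<sigma>" for \<sigma> \<xi>
  proof -
    have "symbol (smoothing \<sigma> f) t \<xi> = (LINT s|lborel. complex_of_real (gauss \<sigma> \<xi>) * (fourier (K t s) \<xi> * fourier (\<lambda>y. f (s, y)) \<xi>))"
      unfolding symbol_def smoothing_def by (simp add: fourier_mollify[OF fi \<sigma>] mult_ac)
    then show ?thesis
      unfolding symbol_def by (simp only: integral_mult_right_zero)
  qed
  have "(\<lambda>n. LINT \<xi>|lborel. wave x \<xi> * (complex_of_real (gauss (?s n) \<xi>) * symbol f t \<xi>))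
      \<longlonglongrightarrow> (LINT \<xi>|lborel. wave x \<xi> * symbol f t \<xi>)"
  proof (rule integral_dominated_convergence)
    show "integrable lborel (\<lambda>\<xi>. norm (symbol f t \<xi>))"
      using integrable_symbol[OF t f(2)] by simp
    show "AE \<xi> in lborel. (\<lambda>n. wave x \<xi> * (complex_of_real (gauss (?s n) \<xi>) * symbol f t \<xi>)) \<longlonglongrightarrow> wave x \<xi> * symbol f t \<xi>"
    proof (rule AE_I2)
      fix \<xi>
      have "(\<lambda>n. wave x \<xi> * (complex_of_real (gauss (?s n) \<xi>) * symbol f t \<xi>)) \<longlonglongrightarrow> wave x \<xi> * (complex_of_real 1 * symbol f t \<xi>)"
        by (intro tendsto_intros gauss_tendsto_1)
      then show "(\<lambda>n. wave x \<xi> * (complex_of_real (gauss (?s n) \<xi>) * symbol f t \<xi>)) \<longlonglongrightarrow> wave x \<xi> * symbol f t \<xi>" by simp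
    qed
    show "AE \<xi> in lborel. norm (wave x \<xi> * (complex_of_real (gauss (?s n) \<xi>) * symbol f t \<xi>)) \<le> norm (symbol f t \<xi>)" for n
      using gauss_le_1[of "?s n"] gauss_pos[of "?s n"]
      by (intro AE_I2) (simp only: norm_mult norm_wave norm_of_real mult_1, rule mult_left_le_one_le, auto simp: less_imp_le abs_of_pos gauss_pos)
  qed measurable
  moreover have "(LINT \<xi>|lborel. wave x \<xi> * (complex_of_real (gauss (?s n) \<xi>) * symbol f t \<xi>)) = ?P * kernel_op (smoothing (?s n) f) (t, x)" for n
  proof -
    have "?P * kernel_op (smoothing (?s n) f) (t, x) = (LINT \<xi>|lborel. wave x \<xi> * symbol (smoothing (?s n) f) t \<xi>)"
      by (rule kernel_op_eq_symbol[OF t regular_smoothing[OF f(1)]]) simp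
    then show ?thesis by (subst (asm) sym) simp_all
  qed
  ultimately have "(\<lambda>n. ?P * kernel_op (smoothing (?s n) f) (t, x)) \<longlonglongrightarrow> ?P * kernel_op f (t, x)"
    by (simp only: kernel_op_eq_symbol[OF t f(2)])
  then have "(\<lambda>n. inverse ?P * (?P * kernel_op (smoothing (?s n) f) (t, x))) \<longlonglongrightarrow> inverse ?P * (?P * kernel_op f (t, x))"
    by (rule tendsto_mult_left)
  then show ?thesis
    by (simp add: mult.assoc[symmetric])
qed

text \<open>At p = 2, where \<open>lp_const\<close> would divide by 0, the L2 bound is taken
  directly.\<close>

definition strong_const :: "real \<Rightarrow> real" where
  "strong_const p = (if p = 2 then M\<^sup>2 else lp_const \<gamma> p CARD('n) (M\<^sup>2 + bmo_const))"

lemma kernel_op_Lp: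
  fixes f :: "real \<times> (real ^ 'n) \<Rightarrow> complex"
  assumes f: "bounded_compact_support f" "regular f" and p: "2 \<le> p"
  shows "(\<integral>\<^sup>+z. ennreal (norm (kernel_op f z) powr p) \<partial>lborel) \<le> ennreal (strong_const p) * (\<integral>\<^sup>+z. ennreal (norm (f z) powr p) \<partial>lborel)"
proof (cases "p = 2")
  case True
  then show ?thesis
    using kernel_op_L2_bound[OF f(2)] by (simp add: strong_const_def)
next
  case False
  then have p2: "2 < p" using p by simp
  let ?s = "\<lambda>n. 1 / real (Suc n)"
  let ?u = "\<lambda>n z. ennreal (norm (kernel_op (smoothing (?s n) f) z) powr p)"
  have um: "kernel_op (smoothing (?s n) f) \<in> borel_measurable borel" for n
    using regular_smoothing[OF f(1), of "?s n"] by (intro kernel_op_borel_measurable) (auto simp: regular_def)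
  note [measurable] = um
  have "AE z in lborel. ennreal (norm (kernel_op f z) powr p) = liminf (\<lambda>n. ?u n z)"
    using AE_fst_not_N
  proof eventually_elim
    case (elim z)
    have "(\<lambda>n. kernel_op (smoothing (?s n) f) z) \<longlonglongrightarrow> kernel_op f z"
      using kernel_op_smoothing_tendsto[OF f, of "fst z" "snd z"] elim by simp
    then have "(\<lambda>n. ?u n z) \<longlonglongrightarrow> ennreal (norm (kernel_op f z) powr p)"
      using p by (intro tendsto_intros tendsto_ennrealI tendsto_powr2) auto
    then show ?case
      by (rule lim_imp_Liminf[OF sequentially_bot, symmetric])
  qed
  then have "(\<integral>\<^sup>+z. ennreal (norm (kernel_op f z) powr p) \<partial>lborel) = (\<integral>\<^sup>+z. liminf (\<lambda>n. ?u n z) \<partial>lborel)"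
    by (rule nn_integral_cong_AE)
  also have "\<dots> \<le> liminf (\<lambda>n. \<integral>\<^sup>+z. ?u n z \<partial>lborel)"
    by (rule nn_integral_liminf) measurable
  also have "\<dots> \<le> liminf (\<lambda>n::nat. ennreal (strong_const p) * (\<integral>\<^sup>+z. ennreal (norm (f z) powr p) \<partial>lborel))"
    using False by (intro Liminf_mono always_eventually allI) (auto simp: strong_const_def intro!: kernel_op_smoothing_Lp f p2)
  also have "\<dots> = ennreal (strong_const p) * (\<integral>\<^sup>+z. ennreal (norm (f z) powr p) \<partial>lborel)"
    by (simp add: Liminf_const)
  finally show ?thesis .
qed

end

section \<open>Test functions\<close>

text \<open>Off the closed support \<open>f\<close> vanishes on an open set, so its derivative
  vanishes there and the support cannot grow.\<close>

lemma test_function_deriv: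
  fixes f :: "'a::real_normed_vector \<Rightarrow> 'b::real_normed_vector"
  assumes f: "f \<in> test_functions"
  shows "(\<lambda>x. frechet_derivative f (at x) v) \<in> test_functions"
proof -
  let ?g = "\<lambda>x. frechet_derivative f (at x) v"
  have Ck: "Ck k f" for k
    using f by (auto simp: test_functions_def)
  have supp: "compact (closure (support_on UNIV f))"
    using f by (auto simp: test_functions_def)
  have Ckg: "Ck k ?g" for k
    using Ck[of "Suc k"] by simp
  have out: "f y = 0" if "y \<notin> closure (support_on UNIV f)" for y
    using that closure_subset[of "support_on UNIV f"] unfolding support_on_def by blast
  have zero: "?g x = 0" if x: "x \<in> - closure (support_on UNIV f)" for x
  proof -
    have "(f has_derivative (\<lambda>_. 0)) (at x)"
      by (rule has_derivative_transform_within_open[OF has_derivative_const open_Compl[OF closed_closure] x])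
        (simp add: out)
    from frechet_derivative_at[OF this] show ?thesis
      by (rule arg_cong[where f="\<lambda>D. D v", symmetric])
  qed
  then have "support_on UNIV ?g \<subseteq> closure (support_on UNIV f)"
    unfolding support_on_def by blast
  then have "closure (support_on UNIV ?g) \<subseteq> closure (support_on UNIV f)"
    by (rule closure_minimal[OF _ closed_closure])
  then have "closure (support_on UNIV f) \<inter> closure (support_on UNIV ?g) = closure (support_on UNIV ?g)"
    by (rule Int_absorb1)
  then have "compact (closure (support_on UNIV ?g))"
    using compact_Int_closed[OF supp closed_closure[of "support_on UNIV ?g"]] by (simp only:)
  then show ?thesis
    unfolding test_functions_def using Ckg by blast
qed

lemma test_function_continuous:
  assumes "f \<in> test_functions"
  shows "continuous_on UNIV f"
proof -
  have "Ck 0 f" using assms unfolding test_functions_def by blast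
  then show ?thesis by simp
qed

lemma test_function_bounded_compact_support:
  fixes f :: "real \<times> (real ^ 'n) \<Rightarrow> complex"
  assumes f: "f \<in> test_functions"
  shows "bounded_compact_support f"
proof -
  let ?S = "closure (support_on UNIV f)"
  have S: "compact ?S" using f by (simp add: test_functions_def)
  have c: "continuous_on UNIV f" by (rule test_function_continuous[OF f])
  have out: "f z = 0" if "z \<notin> ?S" for z
    using that closure_subset[of "support_on UNIV f"] by (auto simp: support_on_def)
  obtain R where R: "\<forall>z\<in>?S. norm z \<le> R"
    using compact_imp_bounded[OF S] unfolding bounded_iff by blast
  have "compact (f ` ?S)"
    by (rule compact_continuous_image[OF continuous_on_subset[OF c subset_UNIV] S])
  then obtain B where B: "\<forall>w\<in>f ` ?S. norm w \<le> B"
    using compact_imp_bounded[of "f ` ?S"] unfolding bounded_iff by blast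
  have "norm (f z) \<le> max B 0" for z
  proof (cases "z \<in> ?S")
    case True
    then show ?thesis using bspec[OF B imageI[OF True]] by linarith
  qed (simp add: out)
  moreover have "f z = 0" if "R < norm z" for z
    using bspec[OF R, of z] that by (intro out) linarith
  ultimately show ?thesis
    unfolding bounded_compact_support_def
    by (intro conjI borel_measurable_continuous_onI[OF c] exI[of _ "max B 0"] exI[of _ R] allI impI)
qed

section \<open>Spatial derivatives and decay of Fourier transforms\<close>

lemma test_function_has_derivative:
  fixes f :: "'a::real_normed_vector \<Rightarrow> 'b::real_normed_vector"
  assumes f: "f \<in> test_functions"
  shows "((\<lambda>h. f (z + h *\<^sub>R v)) has_derivative (\<lambda>k. k *\<^sub>R frechet_derivative f (at (z + h *\<^sub>R v)) v)) (at h)"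
proof -
  have "Ck (Suc 0) f" using f unfolding test_functions_def by blast
  then have "f differentiable (at x)" for x
    by simp
  then have d: "(f has_derivative frechet_derivative f (at x)) (at x)" for x
    by (simp only: frechet_derivative_works[symmetric])
  have "((\<lambda>h. z + h *\<^sub>R v) has_derivative (\<lambda>k. k *\<^sub>R v)) (at h)"
    by (rule derivative_eq_intros refl | simp)+
  from has_derivative_compose[OF this d]
  have "((\<lambda>h. f (z + h *\<^sub>R v)) has_derivative (\<lambda>k. frechet_derivative f (at (z + h *\<^sub>R v)) (k *\<^sub>R v))) (at h)" .
  then show ?thesis
    using has_derivative_bounded_linear[OF d] by (simp add: linear_cmul[OF bounded_linear.linear])
qed

lemma difference_quotient_tendsto:
  fixes \<phi> :: "real \<Rightarrow> 'b::real_normed_vector"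
  assumes "(\<phi> has_derivative (\<lambda>k. k *\<^sub>R g)) (at 0)"
  shows "(\<lambda>n. real (Suc n) *\<^sub>R (\<phi> (1 / real (Suc n)) - \<phi> 0)) \<longlonglongrightarrow> g"
proof -
  have "(\<lambda>h. norm (\<phi> (0 + h) - \<phi> 0 - h *\<^sub>R g) / norm h) \<midarrow>0\<rightarrow> 0"
    using assms unfolding has_derivative_at by blast
  moreover have "filterlim (\<lambda>n. 1 / real (Suc n)) (at 0) sequentially"
    unfolding filterlim_at using LIMSEQ_Suc[OF lim_1_over_n] by auto
  ultimately have "(\<lambda>n. norm (\<phi> (0 + 1 / real (Suc n)) - \<phi> 0 - (1 / real (Suc n)) *\<^sub>R g) / norm (1 / real (Suc n))) \<longlonglongrightarrow> 0"
    by (rule filterlim_compose)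
  moreover have "norm (\<phi> (0 + 1 / real (Suc n)) - \<phi> 0 - (1 / real (Suc n)) *\<^sub>R g) / norm (1 / real (Suc n))
      = norm (real (Suc n) *\<^sub>R (\<phi> (1 / real (Suc n)) - \<phi> 0) - g)" for n
  proof -
    have "norm (real (Suc n) *\<^sub>R (\<phi> (1 / real (Suc n)) - \<phi> 0) - g)
        = norm (real (Suc n) *\<^sub>R (\<phi> (1 / real (Suc n)) - \<phi> 0 - (1 / real (Suc n)) *\<^sub>R g))"
      by (simp add: scaleR_diff_right del: of_nat_Suc)
    then show ?thesis
      by (simp add: del: of_nat_Suc)
  qed
  ultimately have "(\<lambda>n. norm (real (Suc n) *\<^sub>R (\<phi> (1 / real (Suc n)) - \<phi> 0) - g)) \<longlonglongrightarrow> 0"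
    by simp
  then show ?thesis
    by (simp only: tendsto_norm_zero_iff LIM_zero_iff)
qed

text \<open>Difference quotients replace integration by parts: by translation invariance the
  transform of a quotient of \<open>f\<close> is a quotient of waves times the transform of
  \<open>f\<close>, and dominated convergence handles the limit of the integrals.\<close>

lemma fourier_space_derivative:
  fixes f :: "real \<times> (real ^ 'n) \<Rightarrow> complex" and e \<xi> :: "real ^ 'n"
  assumes f: "f \<in> test_functions"
  shows "fourier (\<lambda>y. frechet_derivative f (at (s, y)) (0, e)) \<xi> = \<i> * complex_of_real (e \<bullet> \<xi>) * fourier (\<lambda>y. f (s, y)) \<xi>"
proof -
  define g where "g z = frechet_derivative f (at z) (0, e)" for z
  have g: "g \<in> test_functions"
    unfolding g_def by (rule test_function_deriv[OF f])
  obtain B R where fm: "f \<in> borel_measurable borel" and B: "\<And>z. norm (f z) \<le> B"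
    and R: "\<And>z. R < norm z \<Longrightarrow> f z = 0"
    by (rule bounded_compact_supportE[OF test_function_bounded_compact_support[OF f]]) (rule that)
  obtain B' R' where gm: "g \<in> borel_measurable borel" and B': "\<And>z. norm (g z) \<le> B'"
    and R': "\<And>z. R' < norm z \<Longrightarrow> g z = 0"
    by (rule bounded_compact_supportE[OF test_function_bounded_compact_support[OF g]]) (rule that)
  note [measurable] = borel_measurable_Pair_section[OF fm] borel_measurable_Pair_section[OF gm]
  have fi: "integrable lborel (\<lambda>y. f (s, y))"
    by (rule bounded_compact_support_slice[OF test_function_bounded_compact_support[OF f]]) blast
  have fwi: "integrable lborel (\<lambda>y. cnj (wave y \<xi>) * f (s, y))"
    by (rule Bochner_Integration.integrable_bound[OF fi]) (auto simp: norm_mult)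
  let ?h = "\<lambda>n. 1 / real (Suc n)"
  let ?q = "\<lambda>n y. real (Suc n) *\<^sub>R (f (s, y + ?h n *\<^sub>R e) - f (s, y))"
  have h01: "0 \<le> ?h n" "?h n \<le> 1" for n by auto
  have B'0: "0 \<le> B'" using order.trans[OF norm_ge_zero B'] .
  have norm2: "norm y \<le> norm (s, y)" for y :: "real ^ 'n"
    by (simp add: norm_Pair real_sqrt_sum_squares_ge2)
  \<comment> \<open>The mean value inequality along the segment; all steps are at most 1, so the
    shifted supports stay within radius \<open>R + norm e\<close>.\<close>
  have q_bound: "norm (?q n y) \<le> B' * indicator (cball 0 (R + norm e)) y" for n y
  proof (cases "norm y \<le> R + norm e")
    case True
    have "norm (f ((s, y) + ?h n *\<^sub>R (0, e)) - f ((s, y) + 0 *\<^sub>R (0, e))) \<le> B' * norm (?h n - 0)"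
    proof (rule differentiable_bound[where S=UNIV])
      show "((\<lambda>h. f ((s, y) + h *\<^sub>R (0, e))) has_derivative (\<lambda>k. k *\<^sub>R g ((s, y) + h *\<^sub>R (0, e)))) (at h within UNIV)" for h
        unfolding g_def by (simp only: test_function_has_derivative[OF f])
      show "onorm (\<lambda>k. k *\<^sub>R g ((s, y) + h *\<^sub>R (0, e))) \<le> B'" for h
      proof (rule onorm_le)
        fix k :: real
        have "\<bar>k\<bar> * norm (g ((s, y) + h *\<^sub>R (0, e))) \<le> \<bar>k\<bar> * B'"
          by (intro mult_left_mono B') simp
        then show "norm (k *\<^sub>R g ((s, y) + h *\<^sub>R (0, e))) \<le> B' * norm k"
          by (simp add: mult.commute)
      qed
    qed auto
    then have "norm (f (s, y + ?h n *\<^sub>R e) - f (s, y)) \<le> B' * ?h n"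
      by simp
    then have "real (Suc n) * norm (f (s, y + ?h n *\<^sub>R e) - f (s, y)) \<le> real (Suc n) * (B' * ?h n)"
      by (rule mult_left_mono) simp
    then have "norm (?q n y) \<le> B'"
      by (simp del: of_nat_Suc)
    then show ?thesis using True by simp
  next
    case False
    have "f (s, y) = 0"
      using False norm2[of y] norm_ge_zero[of e] by (intro R) linarith
    moreover have "f (s, y + ?h n *\<^sub>R e) = 0"
    proof (rule R)
      have "norm (?h n *\<^sub>R e) \<le> norm e"
        unfolding norm_scaleR using h01[of n] by (intro mult_left_le_one_le) auto
      then have "R < norm (y + ?h n *\<^sub>R e)"
        using False norm_diff_ineq[of y "?h n *\<^sub>R e"] by linarith
      then show "R < norm (s, y + ?h n *\<^sub>R e)"
        using norm2[of "y + ?h n *\<^sub>R e"] by linarith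
    qed
    ultimately show ?thesis using False by simp
  qed
  have "(\<lambda>n. LINT y|lborel. cnj (wave y \<xi>) * ?q n y) \<longlonglongrightarrow> (LINT y|lborel. cnj (wave y \<xi>) * g (s, y))"
  proof (rule integral_dominated_convergence)
    show "integrable lborel (\<lambda>y. B' * indicator (cball (0 :: real ^ 'n) (R + norm e)) y)"
      using emeasure_lborel_cball_finite[of "0 :: real ^ 'n" "R + norm e"] by (intro integrable_mult_right) auto
    show "AE y in lborel. (\<lambda>n. cnj (wave y \<xi>) * ?q n y) \<longlonglongrightarrow> cnj (wave y \<xi>) * g (s, y)"
    proof (intro AE_I2 tendsto_mult tendsto_const)
      fix y
      have "((\<lambda>h. f ((s, y) + h *\<^sub>R (0, e))) has_derivative (\<lambda>k. k *\<^sub>R g (s, y))) (at 0)"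
        using test_function_has_derivative[OF f, of "(s, y)" "(0, e)" 0] by (simp add: g_def)
      from difference_quotient_tendsto[OF this]
      show "(\<lambda>n. ?q n y) \<longlonglongrightarrow> g (s, y)" by simp
    qed
    show "AE y in lborel. norm (cnj (wave y \<xi>) * ?q n y) \<le> B' * indicator (cball 0 (R + norm e)) y" for n
      using q_bound by (intro AE_I2) (simp only: norm_mult complex_mod_cnj norm_wave mult_1)
  qed (auto intro: measurable_compose[OF _ borel_measurable_Pair_section[OF fm]])
  \<comment> \<open>The second wave is 1, written with step 0 to fit
    \<open>difference_quotient_tendsto\<close>.\<close>
  moreover have "(LINT y|lborel. cnj (wave y \<xi>) * ?q n y)
      = (real (Suc n) *\<^sub>R (wave (?h n *\<^sub>R e) \<xi> - wave (0 *\<^sub>R e) \<xi>)) * fourier (\<lambda>y. f (s, y)) \<xi>" for n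
  proof -
    let ?v = "?h n *\<^sub>R e"
    let ?k = "\<lambda>y. wave ?v \<xi> * (cnj (wave y \<xi>) * f (s, y))"
    have ki: "integrable lborel ?k" by (intro integrable_mult_right fwi)
    then have "integrable (distr lborel borel ((+) ?v)) ?k" by (simp add: lborel_distr_plus)
    then have si: "integrable lborel (\<lambda>y. ?k (?v + y))"
      by (subst (asm) integrable_distr_eq) auto
    have sh: "(LINT y|lborel. ?k (?v + y)) = (LINT y|lborel. ?k y)"
      by (subst (2) lborel_distr_plus[symmetric, of ?v], subst integral_distr) auto
    have "cnj (wave y \<xi>) * ?q n y = real (Suc n) *\<^sub>R (?k (?v + y) - cnj (wave y \<xi>) * f (s, y))" for y
      by (simp add: wave_add_left scaleR_conv_of_real right_diff_distrib add.commute[of y] mult_ac del: of_nat_Suc)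
    then have "(LINT y|lborel. cnj (wave y \<xi>) * ?q n y) = (LINT y|lborel. real (Suc n) *\<^sub>R (?k (?v + y) - cnj (wave y \<xi>) * f (s, y)))"
      by (simp only:)
    also have "\<dots> = real (Suc n) *\<^sub>R ((LINT y|lborel. ?k (?v + y)) - (LINT y|lborel. cnj (wave y \<xi>) * f (s, y)))"
      by (simp only: integral_scaleR_right Bochner_Integration.integral_diff[OF si fwi])
    also have "(LINT y|lborel. ?k (?v + y)) = wave ?v \<xi> * (LINT y|lborel. cnj (wave y \<xi>) * f (s, y))"
      unfolding sh by (rule integral_mult_right_zero)
    also have "(LINT y|lborel. cnj (wave y \<xi>) * f (s, y)) = fourier (\<lambda>y. f (s, y)) \<xi>"
      by (rule fourier_eq[symmetric]) measurable
    finally show ?thesis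
      by (simp add: left_diff_distrib scaleR_conv_of_real right_diff_distrib mult_ac del: of_nat_Suc)
  qed
  moreover have "(\<lambda>n. (real (Suc n) *\<^sub>R (wave (?h n *\<^sub>R e) \<xi> - wave (0 *\<^sub>R e) \<xi>)) * fourier (\<lambda>y. f (s, y)) \<xi>)
      \<longlonglongrightarrow> (\<i> * complex_of_real (e \<bullet> \<xi>)) * fourier (\<lambda>y. f (s, y)) \<xi>"
  proof (intro tendsto_mult tendsto_const difference_quotient_tendsto)
    have "((\<lambda>h::real. exp (h *\<^sub>R (\<i> * complex_of_real (e \<bullet> \<xi>)))) has_vector_derivative
        exp (0 *\<^sub>R (\<i> * complex_of_real (e \<bullet> \<xi>))) * (\<i> * complex_of_real (e \<bullet> \<xi>))) (at 0)"
      by (rule exp_scaleR_has_vector_derivative_right)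
    moreover have "wave (h *\<^sub>R e) \<xi> = exp (h *\<^sub>R (\<i> * complex_of_real (e \<bullet> \<xi>)))" for h
      unfolding wave_def inner_scaleR_left by (simp add: scaleR_conv_of_real mult_ac)
    ultimately show "((\<lambda>h. wave (h *\<^sub>R e) \<xi>) has_derivative (\<lambda>k. k *\<^sub>R (\<i> * complex_of_real (e \<bullet> \<xi>)))) (at 0)"
      by (simp add: has_vector_derivative_def)
  qed
  ultimately have "(LINT y|lborel. cnj (wave y \<xi>) * g (s, y)) = (\<i> * complex_of_real (e \<bullet> \<xi>)) * fourier (\<lambda>y. f (s, y)) \<xi>"
    using LIMSEQ_unique by (simp only:)
  moreover have "(LINT y|lborel. cnj (wave y \<xi>) * g (s, y)) = fourier (\<lambda>y. g (s, y)) \<xi>"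
    by (rule fourier_eq[symmetric]) measurable
  ultimately show ?thesis
    by (simp add: g_def)
qed

text \<open>A second derivative in direction e multiplies the transform by minus the square of \<xi>
  \<bullet> e. The induction hypothesis is applied to \<open>f\<close> and to this derivative, hence
  the generalisation over \<open>f\<close>.\<close>

lemma fourier_test_function_decay:
  fixes f :: "real \<times> (real ^ 'n) \<Rightarrow> complex"
  assumes "finite J" "f \<in> test_functions"
  shows "\<exists>C. \<forall>s \<xi>. (\<Prod>e\<in>J. 1 + (\<xi> \<bullet> e)\<^sup>2) * norm (fourier (\<lambda>y. f (s, y)) \<xi>) \<le> C"
  using assms
proof (induction J arbitrary: f rule: finite_induct)
  case empty
  obtain C where "\<And>s. integrable lborel (\<lambda>y. f (s, y))" "\<And>s. (LINT y|lborel. norm (f (s, y))) \<le> C"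
    by (rule bounded_compact_support_slice[OF test_function_bounded_compact_support[OF empty]]) (rule that)
  then show ?case
    by (intro exI[of _ C]) (auto intro: order.trans[OF norm_fourier_le])
next
  case (insert e J)
  define g where "g = (\<lambda>z. frechet_derivative f (at z) (0, e))"
  define h where "h = (\<lambda>z. frechet_derivative g (at z) (0, e))"
  have g: "g \<in> test_functions" unfolding g_def by (rule test_function_deriv[OF insert.prems])
  have h: "h \<in> test_functions" unfolding h_def by (rule test_function_deriv[OF g])
  have "fourier (\<lambda>y. h (s, y)) \<xi> = (\<i> * complex_of_real (e \<bullet> \<xi>)) * ((\<i> * complex_of_real (e \<bullet> \<xi>)) * fourier (\<lambda>y. f (s, y)) \<xi>)" for s \<xi>
    using fourier_space_derivative[OF g, of s e \<xi>] fourier_space_derivative[OF insert.prems, of s e \<xi>]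
    by (simp add: h_def g_def)
  then have hf: "norm (fourier (\<lambda>y. h (s, y)) \<xi>) = (\<xi> \<bullet> e)\<^sup>2 * norm (fourier (\<lambda>y. f (s, y)) \<xi>)" for s \<xi>
    by (simp add: norm_mult power2_eq_square inner_commute)
  obtain C where C: "\<And>s \<xi>. (\<Prod>e\<in>J. 1 + (\<xi> \<bullet> e)\<^sup>2) * norm (fourier (\<lambda>y. f (s, y)) \<xi>) \<le> C"
    using insert.IH[OF insert.prems] by blast
  obtain C' where C': "\<And>s \<xi>. (\<Prod>e\<in>J. 1 + (\<xi> \<bullet> e)\<^sup>2) * norm (fourier (\<lambda>y. h (s, y)) \<xi>) \<le> C'"
    using insert.IH[OF h] by blast
  show ?case
  proof (intro exI[of _ "C + C'"] allI)
    fix s \<xi>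
    have "(\<Prod>e\<in>insert e J. 1 + (\<xi> \<bullet> e)\<^sup>2) * norm (fourier (\<lambda>y. f (s, y)) \<xi>)
        = (\<Prod>e\<in>J. 1 + (\<xi> \<bullet> e)\<^sup>2) * norm (fourier (\<lambda>y. f (s, y)) \<xi>) + (\<Prod>e\<in>J. 1 + (\<xi> \<bullet> e)\<^sup>2) * norm (fourier (\<lambda>y. h (s, y)) \<xi>)"
      using insert.hyps by (simp add: hf algebra_simps)
    also have "\<dots> \<le> C + C'" by (intro add_mono C C')
    finally show "(\<Prod>e\<in>insert e J. 1 + (\<xi> \<bullet> e)\<^sup>2) * norm (fourier (\<lambda>y. f (s, y)) \<xi>) \<le> C + C'" .
  qed
qed

text \<open>The decay weight is a product over coordinates so that its reciprocal is integrable by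
  one-dimensional integration; the bound is uniform in s.\<close>

lemma regular_test_function:
  fixes f :: "real \<times> (real ^ 'n) \<Rightarrow> complex"
  assumes f: "f \<in> test_functions"
  shows "regular f"
proof -
  note bcs = test_function_bounded_compact_support[OF f]
  obtain C where C: "\<And>s \<xi>. (\<Prod>e\<in>Basis. 1 + (\<xi> \<bullet> e)\<^sup>2) * norm (fourier (\<lambda>y. f (s, y)) \<xi>) \<le> C"
    using fourier_test_function_decay[OF finite_Basis f] by blast
  obtain C' where i: "\<And>s. integrable lborel (\<lambda>y. f (s, y))" "\<And>s. (LINT y|lborel. norm (f (s, y))) \<le> C'"
    by (rule bounded_compact_support_slice[OF bcs]) (rule that)
  have "integrable lborel (\<lambda>t::real. inverse (1 + t\<^sup>2))"
    using integrable_inverse_1_plus_square by (simp add: set_integrable_def)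
  then have 1: "integrable lborel (\<lambda>t::real. complex_of_real (inverse (1 + t\<^sup>2)))"
    by (simp only: complex_of_real_integrable_eq)
  have "integrable lborel (\<lambda>\<xi>::real^'n. \<Prod>e\<in>Basis. complex_of_real (inverse (1 + (\<xi> \<bullet> e)\<^sup>2)))"
    by (rule integrable_lborel_prod) (rule 1)
  then have "integrable lborel (\<lambda>\<xi>::real^'n. complex_of_real (\<Prod>e\<in>Basis. inverse (1 + (\<xi> \<bullet> e)\<^sup>2)))"
    by (simp only: of_real_prod)
  then have 2: "integrable lborel (\<lambda>\<xi>::real^'n. C * (\<Prod>e\<in>Basis. inverse (1 + (\<xi> \<bullet> e)\<^sup>2)))"
    by (intro integrable_mult_right) (simp only: complex_of_real_integrable_eq)
  have "norm (fourier (\<lambda>y. f (s, y)) \<xi>) \<le> C * (\<Prod>e\<in>Basis. inverse (1 + (\<xi> \<bullet> e)\<^sup>2))" for s \<xi>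
  proof -
    have "0 < (\<Prod>e\<in>Basis. 1 + (\<xi> \<bullet> e)\<^sup>2)"
      by (intro prod_pos) (simp add: add_pos_nonneg)
    then have "norm (fourier (\<lambda>y. f (s, y)) \<xi>) \<le> C / (\<Prod>e\<in>Basis. 1 + (\<xi> \<bullet> e)\<^sup>2)"
      using C[where s=s and \<xi>=\<xi>] by (simp add: pos_le_divide_eq mult.commute)
    then show ?thesis
      using prod_inversef[of "\<lambda>e. 1 + (\<xi> \<bullet> e)\<^sup>2" Basis] by (simp add: o_def divide_inverse)
  qed
  then have "\<exists>\<Phi>. integrable lborel \<Phi> \<and> (\<forall>s. AE \<xi> in lborel. norm (fourier (\<lambda>y. f (s, y)) \<xi>) \<le> \<Phi> \<xi>)"
    using 2 by (intro exI[of _ "\<lambda>\<xi>. C * (\<Prod>e\<in>Basis. inverse (1 + (\<xi> \<bullet> e)\<^sup>2))"]) auto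
  moreover have "continuous_on UNIV (\<lambda>y. f (s, y))" for s
    by (rule continuous_on_compose2[OF test_function_continuous[OF f]]) (auto intro!: continuous_intros)
  ultimately show ?thesis
    using bcs i(1) unfolding regular_def bounded_compact_support_def by blast
qed

section \<open>Borel versions of the kernel\<close>

lemma borel_measurable_lebesgue_AE:
  fixes f g :: "'a::euclidean_space \<Rightarrow> 'b::topological_space"
  assumes g: "g \<in> borel_measurable borel" and eq: "AE x in lborel. f x = g x"
  shows "f \<in> borel_measurable lebesgue"
proof (rule measurableI)
  fix A :: "'b set" assume A: "A \<in> sets borel"
  have "g -` A \<in> sets borel"
    using measurable_sets[OF g A] by simp
  then have gA: "g -` A \<in> sets lebesgue" by simp
  have "AE x in lebesgue. f x = g x"
    using eq by (rule AE_completion)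
  then have ae: "AE x in lebesgue. x \<in> g -` A \<longleftrightarrow> x \<in> f -` A"
    by eventually_elim simp
  have "f -` A \<in> sets lebesgue"
    by (rule completion.in_sets_AE[OF ae gA]) simp
  then show "f -` A \<inter> space lebesgue \<in> sets lebesgue" by simp
qed simp

lemma
  fixes f g :: "'a::euclidean_space \<Rightarrow> complex"
  assumes g: "g \<in> borel_measurable borel" and eq: "AE x in lborel. f x = g x"
  shows integral_lebesgue_AE: "(LINT x|lebesgue. f x) = (LINT x|lborel. g x)"
    and integrable_lebesgue_AE: "integrable lebesgue f \<longleftrightarrow> integrable lborel g"
proof -
  have gl: "g \<in> borel_measurable lborel" using g by simp
  have fm: "f \<in> borel_measurable lebesgue"
    by (rule borel_measurable_lebesgue_AE[OF g eq])
  have gm: "g \<in> borel_measurable lebesgue"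
    using gl by (rule measurable_completion)
  have "AE x in lebesgue. f x = g x"
    using eq by (rule AE_completion)
  then show "(LINT x|lebesgue. f x) = (LINT x|lborel. g x)"
    unfolding integral_completion[OF gl, symmetric] by (rule integral_cong_AE[OF fm gm])
  show "integrable lebesgue f \<longleftrightarrow> integrable lborel g"
    unfolding integrable_completion[OF gl, symmetric]
    by (rule integrable_cong_AE[OF fm gm]) fact
qed

section \<open>Null sets under translation and slicing\<close>

lemma AE_lborel_diff:
  assumes "AE x in lborel. P x"
  shows "AE y in lborel. P (a - y :: 'a::euclidean_space)"
  by (rule AE_distrD[of "\<lambda>y. a - y" lborel borel P]) (simp, unfold lborel_distr_diff, rule assms)

lemma AE_lborel_add:
  assumes "AE x in lborel. P x"
  shows "AE y in lborel. P (y + a :: 'a::euclidean_space)"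
proof -
  have "AE x in distr lborel borel ((+) a). P x"
    unfolding lborel_distr_plus by (rule assms)
  then have "AE y in lborel. P (a + y)"
    by (rule AE_distrD[rotated]) simp
  then show ?thesis by (simp add: add.commute)
qed

lemma completion_ex_borel_measurable_complex:
  fixes f :: "'a::euclidean_space \<Rightarrow> complex"
  assumes f: "f \<in> borel_measurable lebesgue"
  shows "\<exists>g\<in>borel_measurable borel. AE x in lborel. f x = g x"
proof -
  obtain a where a: "a \<in> borel_measurable lborel" "AE x in lborel. Re (f x) = a x"
    using completion_ex_borel_measurable_real[of "\<lambda>x. Re (f x)" lborel] f by auto
  obtain b where b: "b \<in> borel_measurable lborel" "AE x in lborel. Im (f x) = b x"
    using completion_ex_borel_measurable_real[of "\<lambda>x. Im (f x)" lborel] f by auto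
  show ?thesis
  proof (rule bexI[of _ "\<lambda>x. complex_of_real (a x) + \<i> * complex_of_real (b x)"])
    show "AE x in lborel. f x = complex_of_real (a x) + \<i> * complex_of_real (b x)"
      using a(2) b(2) by eventually_elim (simp add: complex_eq_iff)
    show "(\<lambda>x. complex_of_real (a x) + \<i> * complex_of_real (b x)) \<in> borel_measurable borel"
      using a(1) b(1) by simp
  qed
qed

lemma AE_borel_null_cover:
  assumes "AE x in lborel. P x"
  obtains Z where "Z \<in> null_sets lborel" "\<And>x. x \<notin> Z \<Longrightarrow> P x"
  using assms by (elim AE_E) (auto simp: null_sets_def)

lemma AE_lborel_pair:
  fixes Z :: "('a::euclidean_space \<times> 'b::euclidean_space) set"
  assumes "AE z in lborel. P z"
  shows "AE x in lborel. AE y in lborel. P (x :: 'a, y :: 'b)"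
  using assms unfolding lborel_prod[symmetric] by (rule lborel_pair.AE_pair)

text \<open>\<open>P\<close> may be non-measurable, so its exceptional set is covered by a Borel
  null set before the quantifiers are exchanged.\<close>

lemma AE_lborel_pair_swap:
  assumes "AE z in lborel. P z"
  shows "AE y in lborel. AE x in lborel. P (x :: 'a::euclidean_space, y :: 'b::euclidean_space)"
proof -
  obtain Z where Z: "Z \<in> null_sets lborel" "\<And>z. z \<notin> Z \<Longrightarrow> P z"
    by (rule AE_borel_null_cover[OF assms]) (rule that)
  have "AE z in (lborel :: ('a \<times> 'b) measure). z \<notin> Z"
    using Z(1) by (rule AE_not_in)
  then have "AE x in lborel. AE y in lborel. (x :: 'a, y :: 'b) \<notin> Z"
    by (rule AE_lborel_pair)
  moreover have "{z \<in> space (lborel \<Otimes>\<^sub>M lborel). (fst z, snd z) \<notin> Z} \<in> sets (lborel \<Otimes>\<^sub>M lborel)"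
  proof -
    have "{z \<in> space (lborel \<Otimes>\<^sub>M lborel). (fst z, snd z) \<notin> Z} = - Z"
      by (auto simp: space_pair_measure)
    then show ?thesis
      unfolding lborel_prod using Z(1) by (auto simp: null_sets_def borel_comp)
  qed
  ultimately have "AE y in lborel. AE x in lborel. (x, y) \<notin> Z"
    by (subst lborel_pair.AE_commute[symmetric])
  then show ?thesis
  proof eventually_elim
    case (elim y)
    then show ?case by eventually_elim (rule Z(2))
  qed
qed

text \<open>By Fubini almost every time slice of a Borel version agrees almost everywhere with the
  original; the remaining times are covered by \<open>N\<close>. Two truncations to 0 then make the
  integrability of \<open>K'\<close> and the bound on \<open>H'\<close> hold everywhere.\<close>

lemma borel_modification:
  fixes K :: "real \<Rightarrow> real \<Rightarrow> real ^ 'n \<Rightarrow> complex" and H :: "real \<Rightarrow> real ^ 'n \<Rightarrow> real" and \<phi> :: "real \<Rightarrow> real"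
  assumes K: "admissible_kernel K" and H: "fourier_majorant H K" and M: "majorant_bound H = ennreal M" "0 \<le> M"
    and est: "kernel_estimates \<gamma> \<phi> K" and \<gamma>: "0 < \<gamma>"
  obtains K' H' N where "causal_kernel_estimates K' H' N M \<gamma> \<phi>"
    "\<And>f t x. f \<in> borel_measurable borel \<Longrightarrow> t \<notin> N \<Longrightarrow>
      kernel_operator K f (t, x) = (LINT s|lborel. LINT y|lborel. K' t s (x - y) * f (s, y))"
proof -
  obtain k where km: "k \<in> borel_measurable borel"
    and kK: "AE z in lborel. (\<lambda>(t, s, x). K t s x) z = k z"
    using K completion_ex_borel_measurable_complex[of "\<lambda>(t, s, x). K t s x"] unfolding admissible_kernel_def by blast
  obtain h where hm: "h \<in> borel_measurable lborel" and hH: "AE z in lborel. (\<lambda>(t, \<xi>). H t \<xi>) z = h z"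
    using H completion_ex_borel_measurable_real[of "\<lambda>(t, \<xi>). H t \<xi>" lborel] unfolding fourier_majorant_def by blast
  have Ki: "integrable lebesgue (K t s)" if "s < t" for t s
    using K that unfolding admissible_kernel_def by blast
  have HK: "norm (fourier (K t s) \<xi>) \<le> H (t - s) \<xi>" if "s < t" for t s \<xi>
    using H that unfolding fourier_majorant_def by blast
  have k_meas [measurable]: "(\<lambda>z. k (a z, b z, c z)) \<in> borel_measurable A"
    if [measurable]: "a \<in> borel_measurable A" "b \<in> borel_measurable A" "c \<in> borel_measurable A"
    for a b and c :: "'z \<Rightarrow> real ^ 'n" and A
    by (rule measurable_compose[OF _ km]) (simp add: borel_prod[symmetric])
  have h_meas [measurable]: "(\<lambda>z. h (a z, b z)) \<in> borel_measurable A"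
    if [measurable]: "a \<in> borel_measurable A" "b \<in> borel_measurable A"
    for a and b :: "'z \<Rightarrow> real ^ 'n" and A
    by (rule measurable_compose[OF _ hm]) (simp add: borel_prod[symmetric])
  \<comment> \<open>Future and non-integrable slices are set to 0. Both conditions are Borel in (t,
    s), so joint measurability survives.\<close>
  define K' where "K' t s x = (if s < t \<and> (\<integral>\<^sup>+x. ennreal (norm (k (t, s, x))) \<partial>lborel) < \<infinity> then k (t, s, x) else 0)" for t s x
  \<comment> \<open>Frequencies at which the time integral exceeds \<open>M\<close> are suppressed;
    since \<open>h\<close> agrees with the given majorant almost everywhere, they form a null
    set.\<close>
  define H' where "H' t \<xi> = (if 0 < t \<and> (\<integral>\<^sup>+\<tau>. ennreal (h (\<tau>, \<xi>)) * indicator {0<..} \<tau> \<partial>lborel) \<le> ennreal M then ennreal (h (t, \<xi>)) else 0)" for t \<xi>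
  have "AE t in lborel. AE w in lborel. (\<lambda>(t, s, x). K t s x) (t, w) = k (t, w)"
    by (rule AE_lborel_pair[OF kK])
  then obtain N where N: "N \<in> null_sets lborel" "\<And>t. t \<notin> N \<Longrightarrow> AE w in lborel. (\<lambda>(t, s, x). K t s x) (t, w) = k (t, w)"
    by (rule AE_borel_null_cover) (rule that)
  have K'_meas: "(\<lambda>(t, s, x). K' t s x) \<in> borel_measurable borel"
    unfolding K'_def by (simp add: borel_prod[symmetric])
  have K'_comp [measurable]: "(\<lambda>z. K' (a z) (b z) (c z)) \<in> borel_measurable A"
    if [measurable]: "a \<in> borel_measurable A" "b \<in> borel_measurable A" "c \<in> borel_measurable A"
    for a b and c :: "'z \<Rightarrow> real ^ 'n" and A
    unfolding K'_def by measurable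
  have K'_slice [measurable]: "K' t s \<in> borel_measurable borel" for t s
    using K'_comp[of "\<lambda>_. t" borel "\<lambda>_. s" "\<lambda>x. x"] by simp
  have eqK: "AE s in lborel. s < t \<longrightarrow> (AE x in lborel. K t s x = K' t s x)" if t: "t \<notin> N" for t
  proof -
    have "AE s in lborel. AE x in lborel. (\<lambda>(t, s, x). K t s x) (t, s, x) = k (t, s, x)"
      by (rule AE_lborel_pair[OF N(2)[OF t]])
    then show ?thesis
    proof eventually_elim
      case (elim s)
      then have eq: "AE x in lborel. K t s x = k (t, s, x)" by simp
      show ?case
      proof
        assume st: "s < t"
        have "(\<lambda>x. k (t, s, x)) \<in> borel_measurable borel"
          by (rule measurable_compose[OF _ km]) (simp add: borel_prod[symmetric])
        from integrable_lebesgue_AE[OF this eq] Ki[OF st]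
        have "(\<integral>\<^sup>+x. ennreal (norm (k (t, s, x))) \<partial>lborel) < \<infinity>"
          by (simp add: integrable_iff_bounded)
        then have "K' t s x = k (t, s, x)" for x using st by (simp add: K'_def)
        then show "AE x in lborel. K t s x = K' t s x" using eq by simp
      qed
    qed
  qed
  have K'0: "K' t s x = 0" if "t \<le> s" for t s x
    using that by (simp add: K'_def)
  show thesis
  proof (rule that[of K' H' N])
    show "kernel_operator K f (t, x) = (LINT s|lborel. LINT y|lborel. K' t s (x - y) * f (s, y))"
      if fm: "f \<in> borel_measurable borel" and t: "t \<notin> N" for f t x
    proof -
      have f_comp [measurable]: "(\<lambda>z. f (a z, b z)) \<in> borel_measurable A"
        if [measurable]: "a \<in> borel_measurable A" "b \<in> borel_measurable A"
        for a and b :: "'z \<Rightarrow> real ^ 'n" and A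
        by (rule measurable_compose[OF _ fm]) (simp add: borel_prod[symmetric])
      have m: "(\<lambda>s. LINT y|lborel. K' t s (x - y) * f (s, y)) \<in> borel_measurable borel"
      proof -
        have "(\<lambda>(s, y). K' t s (x - y) * f (s, y)) \<in> borel_measurable (borel \<Otimes>\<^sub>M borel)"
          using K'_meas fm by (auto intro!: borel_measurable_times measurable_compose[OF _ K'_meas, of "\<lambda>z. (t, fst z, x - snd z)", simplified]
            measurable_compose[OF _ fm] simp: borel_prod[symmetric] case_prod_beta)
        then show ?thesis by (intro lborel.borel_measurable_lebesgue_integral) simp
      qed
      have "AE s in lborel. indicator {..<t} s *\<^sub>R space_convolution (K t s) (\<lambda>y. f (s, y)) x = (LINT y|lborel. K' t s (x - y) * f (s, y))"
        using eqK[OF t]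
      proof eventually_elim
        case (elim s)
        show ?case
        proof (cases "s < t")
          case True
          then have "AE x in lborel. K t s x = K' t s x" using elim by simp
          then have "AE y in lborel. K t s (x - y) = K' t s (x - y)"
            by (rule AE_lborel_diff)
          then have eq: "AE y in lborel. K t s (x - y) * f (s, y) = K' t s (x - y) * f (s, y)"
            by eventually_elim simp
          have "(\<lambda>y. K' t s (x - y) * f (s, y)) \<in> borel_measurable borel"
            by (intro borel_measurable_times measurable_compose[OF _ K'_slice] borel_measurable_Pair_section fm) simp
          from integral_lebesgue_AE[OF this eq] show ?thesis
            using True by (simp add: space_convolution_def)
        qed (simp add: K'0)
      qed
      from integral_lebesgue_AE[OF m this] show ?thesis
        by (simp add: kernel_operator_def set_lebesgue_integral_def)
    qed
    have est1: "\<And>s r c. r < s \<Longrightarrow> 0 < c \<Longrightarrow>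
        (\<integral>\<^sup>+ \<tau>\<in>{r<..<s}. (\<integral>\<^sup>+ z\<in>{z. c \<le> norm z}. ennreal (norm (K s \<tau> z)) \<partial>lebesgue) \<partial>lebesgue)
          \<le> ennreal (\<phi> ((s - r) * c powr (- \<gamma>)))"
      and est2: "\<And>s r a. a < r \<Longrightarrow> r < s \<Longrightarrow>
        (\<integral>\<^sup>+ \<tau>\<in>{..<a}. (\<integral>\<^sup>+ z. ennreal (norm (K s \<tau> z - K r \<tau> z)) \<partial>lebesgue) \<partial>lebesgue)
          \<le> ennreal (\<phi> ((s - r) / (r - a)))"
      and est3: "\<And>s a h. a < s \<Longrightarrow> h \<noteq> 0 \<Longrightarrow>
        (\<integral>\<^sup>+ \<tau>\<in>{..<a}. (\<integral>\<^sup>+ z. ennreal (norm (K s \<tau> (z + h) - K s \<tau> z)) \<partial>lebesgue) \<partial>lebesgue)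
          \<le> ennreal (\<phi> (norm h * (s - a) powr (- 1 / \<gamma>)))"
      and \<phi>: "mono_on {0<..} \<phi>" "\<And>u. 0 < u \<Longrightarrow> 0 \<le> \<phi> u"
      using est unfolding kernel_estimates_def by blast+
    show "causal_kernel_estimates K' H' N M \<gamma> \<phi>"
    proof
      show "(\<lambda>(t, s, x). K' t s x) \<in> borel_measurable borel" by (rule K'_meas)
      show "integrable lborel (K' t s)" for t s
      proof (rule integrableI_bounded)
        show "(\<integral>\<^sup>+x. ennreal (norm (K' t s x)) \<partial>lborel) < \<infinity>"
          by (cases "s < t \<and> (\<integral>\<^sup>+x. ennreal (norm (k (t, s, x))) \<partial>lborel) < \<infinity>") (auto simp: K'_def)
      qed (use K'_slice in simp)
      show "(\<lambda>(t, \<xi>). H' t \<xi>) \<in> borel_measurable borel"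
        unfolding H'_def by (simp add: borel_prod[symmetric])
      show "(\<integral>\<^sup>+t. H' t \<xi> \<partial>lborel) \<le> ennreal M" for \<xi>
      proof (cases "(\<integral>\<^sup>+\<tau>. ennreal (h (\<tau>, \<xi>)) * indicator {0<..} \<tau> \<partial>lborel) \<le> ennreal M")
        case True
        then have "H' t \<xi> = ennreal (h (t, \<xi>)) * indicator {0<..} t" for t
          by (simp add: H'_def)
        then show ?thesis using True by simp
      qed (simp add: H'_def)
      show "0 \<le> M" by (rule M(2))
      show "N \<in> null_sets lborel" by (rule N(1))
      show "0 < \<gamma>" by (rule \<gamma>)
      show "mono_on {0<..} \<phi>" by (rule \<phi>(1))
      show "0 \<le> \<phi> u" if "0 < u" for u using that by (rule \<phi>(2))
      show "K' t s x = 0" if "t \<le> s" for t s x using that by (rule K'0)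
      show "AE s in lborel. AE \<xi> in lborel. ennreal (norm (fourier (K' t s) \<xi>)) \<le> H' (t - s) \<xi>" if t: "t \<notin> N" for t
      proof -
        have cond: "AE \<xi> in lborel. (\<integral>\<^sup>+\<tau>. ennreal (h (\<tau>, \<xi>)) * indicator {0<..} \<tau> \<partial>lborel) \<le> ennreal M"
          using AE_lborel_pair_swap[OF hH]
        proof eventually_elim
          case (elim \<xi>)
          have "(\<integral>\<^sup>+\<tau>. ennreal (h (\<tau>, \<xi>)) * indicator {0<..} \<tau> \<partial>lborel) = (\<integral>\<^sup>+\<tau>\<in>{0<..}. ennreal (H \<tau> \<xi>) \<partial>lborel)"
          proof (rule nn_integral_cong_AE)
            show "AE \<tau> in lborel. ennreal (h (\<tau>, \<xi>)) * indicator {0<..} \<tau> = ennreal (H \<tau> \<xi>) * indicator {0<..} \<tau>"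
              using elim by eventually_elim simp
          qed
          \<comment> \<open>Completing the measure does not change the nonnegative integral of any
            function.\<close>
          also have "\<dots> = (\<integral>\<^sup>+\<tau>\<in>{0<..}. ennreal (H \<tau> \<xi>) \<partial>lebesgue)"
            by (rule nn_integral_completion[symmetric])
          also have "\<dots> \<le> majorant_bound H"
            unfolding majorant_bound_def by (rule SUP_upper) simp
          finally show ?case using M(1) by simp
        qed
        have "AE \<tau> in lborel. AE \<xi> in lborel. (\<lambda>(t, \<xi>). H t \<xi>) (\<tau>, \<xi>) = h (\<tau>, \<xi>)"
          by (rule AE_lborel_pair[OF hH])
        then have "AE s in lborel. AE \<xi> in lborel. (\<lambda>(t, \<xi>). H t \<xi>) (t - s, \<xi>) = h (t - s, \<xi>)"
          by (rule AE_lborel_diff)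
        then show ?thesis
          using eqK[OF t]
        proof eventually_elim
          case (elim s)
          show ?case
          proof (cases "s < t")
            case True
            then have eq: "AE x in lborel. K t s x = K' t s x" using elim(2) by simp
            \<comment> \<open>Slices that agree almost everywhere have equal transforms at every
              frequency, so exceptional frequencies arise from \<open>H\<close> alone.\<close>
            have F: "fourier (K t s) \<xi> = fourier (K' t s) \<xi>" for \<xi>
            proof -
              have "AE x in lborel. exp (- \<i> * complex_of_real (x \<bullet> \<xi>)) * K t s x = exp (- \<i> * complex_of_real (x \<bullet> \<xi>)) * K' t s x"
                using eq by eventually_elim simp
              from integral_lebesgue_AE[OF _ this] integral_lebesgue_AE[of "\<lambda>x. exp (- \<i> * complex_of_real (x \<bullet> \<xi>)) * K' t s x"]
              show ?thesis
                unfolding fourier_def using K'_slice by (simp add: integral_completion)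
            qed
            show ?thesis
              using elim(1) cond
            proof eventually_elim
              case (elim \<xi>)
              have "norm (fourier (K' t s) \<xi>) \<le> H (t - s) \<xi>"
                using HK[OF True, of \<xi>] by (simp add: F)
              then show ?case
                using elim True by (simp add: H'_def ennreal_leI)
            qed
          next
            case False
            then have "K' t s = (\<lambda>x. 0)" by (intro ext K'0) simp
            then show ?thesis by (simp add: fourier_def)
          qed
        qed
      qed
      show "(\<integral>\<^sup>+\<tau>\<in>{r<..<t}. (\<integral>\<^sup>+z\<in>{z. c \<le> norm z}. ennreal (norm (K' t \<tau> z)) \<partial>lborel) \<partial>lborel)
          \<le> ennreal (\<phi> ((t - r) * c powr (- \<gamma>)))" if t: "t \<notin> N" and "r < t" "0 < c" for t r c
      proof -
        have "(\<integral>\<^sup>+\<tau>\<in>{r<..<t}. (\<integral>\<^sup>+z\<in>{z. c \<le> norm z}. ennreal (norm (K' t \<tau> z)) \<partial>lborel) \<partial>lborel)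
            = (\<integral>\<^sup>+\<tau>\<in>{r<..<t}. (\<integral>\<^sup>+z\<in>{z. c \<le> norm z}. ennreal (norm (K t \<tau> z)) \<partial>lborel) \<partial>lborel)"
        proof (rule nn_integral_cong_AE)
          show "AE \<tau> in lborel. (\<integral>\<^sup>+z\<in>{z. c \<le> norm z}. ennreal (norm (K' t \<tau> z)) \<partial>lborel) * indicator {r<..<t} \<tau>
              = (\<integral>\<^sup>+z\<in>{z. c \<le> norm z}. ennreal (norm (K t \<tau> z)) \<partial>lborel) * indicator {r<..<t} \<tau>"
            using eqK[OF t]
          proof eventually_elim
            case (elim \<tau>)
            show ?case
            proof (cases "\<tau> < t")
              case True
              then have "AE x in lborel. K t \<tau> x = K' t \<tau> x" using elim by simp
              then have "(\<integral>\<^sup>+z\<in>{z. c \<le> norm z}. ennreal (norm (K' t \<tau> z)) \<partial>lborel) = (\<integral>\<^sup>+z\<in>{z. c \<le> norm z}. ennreal (norm (K t \<tau> z)) \<partial>lborel)"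
                by (intro nn_integral_cong_AE) (erule eventually_mono, simp)
              then show ?thesis by simp
            qed simp
          qed
        qed
        then show ?thesis
          using est1[OF that(2,3)] by (simp add: nn_integral_completion)
      qed
      show "(\<integral>\<^sup>+\<tau>\<in>{..<a}. (\<integral>\<^sup>+z. ennreal (norm (K' t \<tau> z - K' r \<tau> z)) \<partial>lborel) \<partial>lborel)
          \<le> ennreal (\<phi> ((t - r) / (r - a)))" if t: "t \<notin> N" and r: "r \<notin> N" and ar: "a < r" "r < t" for t r a
      proof -
        have "(\<integral>\<^sup>+\<tau>\<in>{..<a}. (\<integral>\<^sup>+z. ennreal (norm (K' t \<tau> z - K' r \<tau> z)) \<partial>lborel) \<partial>lborel)
            = (\<integral>\<^sup>+\<tau>\<in>{..<a}. (\<integral>\<^sup>+z. ennreal (norm (K t \<tau> z - K r \<tau> z)) \<partial>lborel) \<partial>lborel)"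
        proof (rule nn_integral_cong_AE)
          show "AE \<tau> in lborel. (\<integral>\<^sup>+z. ennreal (norm (K' t \<tau> z - K' r \<tau> z)) \<partial>lborel) * indicator {..<a} \<tau>
              = (\<integral>\<^sup>+z. ennreal (norm (K t \<tau> z - K r \<tau> z)) \<partial>lborel) * indicator {..<a} \<tau>"
            using eqK[OF t] eqK[OF r]
          proof eventually_elim
            case (elim \<tau>)
            show ?case
            proof (cases "\<tau> < a")
              case True
              then have "AE x in lborel. K t \<tau> x = K' t \<tau> x" "AE x in lborel. K r \<tau> x = K' r \<tau> x"
                using elim ar by simp_all
              then have "(\<integral>\<^sup>+z. ennreal (norm (K' t \<tau> z - K' r \<tau> z)) \<partial>lborel) = (\<integral>\<^sup>+z. ennreal (norm (K t \<tau> z - K r \<tau> z)) \<partial>lborel)"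
                by (intro nn_integral_cong_AE) (erule (1) eventually_elim2, simp)
              then show ?thesis by simp
            qed simp
          qed
        qed
        then show ?thesis
          using est2[OF ar] by (simp add: nn_integral_completion)
      qed
      show "(\<integral>\<^sup>+\<tau>\<in>{..<a}. (\<integral>\<^sup>+z. ennreal (norm (K' t \<tau> (z + y) - K' t \<tau> z)) \<partial>lborel) \<partial>lborel)
          \<le> ennreal (\<phi> (norm y * (t - a) powr (- 1 / \<gamma>)))" if t: "t \<notin> N" and a: "a < t" and y: "y \<noteq> 0" for t a y
      proof -
        have "(\<integral>\<^sup>+\<tau>\<in>{..<a}. (\<integral>\<^sup>+z. ennreal (norm (K' t \<tau> (z + y) - K' t \<tau> z)) \<partial>lborel) \<partial>lborel)
            = (\<integral>\<^sup>+\<tau>\<in>{..<a}. (\<integral>\<^sup>+z. ennreal (norm (K t \<tau> (z + y) - K t \<tau> z)) \<partial>lborel) \<partial>lborel)"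
        proof (rule nn_integral_cong_AE)
          show "AE \<tau> in lborel. (\<integral>\<^sup>+z. ennreal (norm (K' t \<tau> (z + y) - K' t \<tau> z)) \<partial>lborel) * indicator {..<a} \<tau>
              = (\<integral>\<^sup>+z. ennreal (norm (K t \<tau> (z + y) - K t \<tau> z)) \<partial>lborel) * indicator {..<a} \<tau>"
            using eqK[OF t]
          proof eventually_elim
            case (elim \<tau>)
            show ?case
            proof (cases "\<tau> < a")
              case True
              then have eq: "AE x in lborel. K t \<tau> x = K' t \<tau> x" using elim a by simp
              then have "(\<integral>\<^sup>+z. ennreal (norm (K' t \<tau> (z + y) - K' t \<tau> z)) \<partial>lborel) = (\<integral>\<^sup>+z. ennreal (norm (K t \<tau> (z + y) - K t \<tau> z)) \<partial>lborel)"
                using AE_lborel_add[OF eq, of y] by (intro nn_integral_cong_AE) (erule (1) eventually_elim2, simp)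
              then show ?thesis by simp
            qed simp
          qed
        qed
        then show ?thesis
          using est3[OF a y] by (simp add: nn_integral_completion)
      qed
    qed
  qed
qed

section \<open>The norms of the definitions\<close>

text \<open>The factor 2 is the price of replacing \<kappa> by the mean, which differs from \<kappa>
  by at most the average of |g - \<kappa>|.\<close>

lemma mean_oscillation_le:
  fixes u g :: "'a::euclidean_space \<Rightarrow> complex"
  assumes Q [measurable]: "Q \<in> sets borel" and Q0: "emeasure lborel Q \<noteq> 0" "emeasure lborel Q < \<infinity>"
    and g [measurable]: "g \<in> borel_measurable borel" and ug: "AE z in lborel. u z = g z"
    and gi: "set_integrable lborel Q g"
    and C: "(\<integral>\<^sup>+z\<in>Q. ennreal (norm (g z - \<kappa>)) \<partial>lborel) \<le> ennreal C * emeasure lborel Q" "0 \<le> C"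
  shows "mean_oscillation Q u \<le> ennreal (2 * C)"
proof -
  define q where "q = measure lborel Q"
  have q1: "emeasure lborel Q = ennreal q"
    unfolding q_def using Q0(2) by (intro emeasure_eq_ennreal_measure) auto
  moreover have "q \<noteq> 0"
    using Q0(1) q1 by auto
  then have "0 < q"
    using measure_nonneg[of lborel Q] unfolding q_def by linarith
  ultimately have q: "emeasure lborel Q = ennreal q" "0 < q" by auto
  have mq: "measure lebesgue Q = q"
    by (simp add: q_def measure_completion)
  define m where "m = mean Q u"
  have uQ: "AE z in lborel. indicator Q z *\<^sub>R u z = indicator Q z *\<^sub>R g z"
    using ug by eventually_elim simp
  have m_eq: "m = (LINT z|lborel. indicator Q z *\<^sub>R g z) /\<^sub>R q"
    unfolding m_def mean_def set_lebesgue_integral_def mq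
    by (subst integral_lebesgue_AE[OF _ uQ]) auto
  have gi': "integrable lborel (\<lambda>z. indicator Q z *\<^sub>R g z)"
    using gi by (simp add: set_integrable_def)
  have ci: "integrable lborel (\<lambda>z. indicator Q z *\<^sub>R \<kappa>)"
    using Q0 by (intro integrable_scaleR_left) auto
  have "m - \<kappa> = ((LINT z|lborel. indicator Q z *\<^sub>R g z) - q *\<^sub>R \<kappa>) /\<^sub>R q"
    unfolding m_eq using q(2) by (simp add: scaleR_diff_right)
  also have "q *\<^sub>R \<kappa> = (LINT z|lborel. indicator Q z *\<^sub>R \<kappa>)"
    using Q0 by (simp add: q_def)
  also have "(LINT z|lborel. indicator Q z *\<^sub>R g z) - (LINT z|lborel. indicator Q z *\<^sub>R \<kappa>) = (LINT z|lborel. indicator Q z *\<^sub>R (g z - \<kappa>))"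
    using gi' ci by (simp add: scaleR_diff_right)
  finally have mk: "q * norm (m - \<kappa>) = norm (LINT z|lborel. indicator Q z *\<^sub>R (g z - \<kappa>))"
    using q(2) by simp
  have "ennreal (q * norm (m - \<kappa>)) \<le> (\<integral>\<^sup>+z. ennreal (norm (indicator Q z *\<^sub>R (g z - \<kappa>))) \<partial>lborel)"
    unfolding mk by (rule ennreal_norm_integral_le)
  also have "\<dots> = (\<integral>\<^sup>+z\<in>Q. ennreal (norm (g z - \<kappa>)) \<partial>lborel)"
    by (intro nn_integral_cong) (simp add: indicator_def)
  also have "\<dots> \<le> ennreal (C * q)"
    using C q by (simp add: ennreal_mult)
  finally have "q * norm (m - \<kappa>) \<le> C * q"
    using C(2) q(2) by (subst (asm) ennreal_le_iff) auto
  then have mC: "norm (m - \<kappa>) \<le> C"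
    using q(2) by (simp add: mult.commute)
  have "(\<integral>\<^sup>+z\<in>Q. ennreal (norm (u z - m)) \<partial>lebesgue) = (\<integral>\<^sup>+z\<in>Q. ennreal (norm (u z - m)) \<partial>lborel)"
    by (rule nn_integral_completion)
  also have "\<dots> \<le> (\<integral>\<^sup>+z. ennreal (norm (g z - \<kappa>)) * indicator Q z + ennreal C * indicator Q z \<partial>lborel)"
  proof (rule nn_integral_mono_AE)
    show "AE z in lborel. ennreal (norm (u z - m)) * indicator Q z \<le> ennreal (norm (g z - \<kappa>)) * indicator Q z + ennreal C * indicator Q z"
      using ug
    proof eventually_elim
      case (elim z)
      have "norm (u z - m) \<le> norm (g z - \<kappa>) + C"
        using norm_triangle_ineq4[of "g z - \<kappa>" "m - \<kappa>"] mC elim by simp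
      then show ?case
        using C(2) by (simp add: indicator_def ennreal_plus[symmetric] ennreal_leI del: ennreal_plus)
    qed
  qed
  also have "\<dots> = (\<integral>\<^sup>+z\<in>Q. ennreal (norm (g z - \<kappa>)) \<partial>lborel) + ennreal C * emeasure lborel Q"
    by (subst nn_integral_add) (auto simp: nn_integral_cmult_indicator)
  also have "\<dots> \<le> ennreal C * emeasure lborel Q + ennreal C * emeasure lborel Q"
    by (intro add_right_mono C)
  also have "\<dots> = ennreal (2 * C) * ennreal q"
    using C(2) q by (simp add: ennreal_mult[symmetric] ennreal_plus[symmetric] del: ennreal_plus)
  finally have "(\<integral>\<^sup>+z\<in>Q. ennreal (norm (u z - m)) \<partial>lebesgue) \<le> ennreal (2 * C) * ennreal q" .
  then have "(\<integral>\<^sup>+z\<in>Q. ennreal (norm (u z - m)) \<partial>lebesgue) / ennreal q \<le> ennreal (2 * C) * ennreal q / ennreal q"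
    by (rule divide_right_mono_ennreal)
  also have "\<dots> = ennreal (2 * C)"
    using q(2) C(2) by (simp add: ennreal_mult[symmetric] divide_ennreal)
  also have "ennreal q = emeasure lebesgue Q"
    by (simp add: q(1)[symmetric])
  finally show ?thesis
    unfolding mean_oscillation_def m_def .
qed

text \<open>By continuity a value above the essential supremum would be accompanied by a whole ball
  of such values, and balls have positive measure.\<close>

lemma continuous_norm_le_Linf_norm:
  fixes f :: "'a::euclidean_space \<Rightarrow> complex"
  assumes f: "continuous_on UNIV f"
  shows "ennreal (norm (f z)) \<le> Linf_norm f"
proof (rule ccontr)
  assume "\<not> ?thesis"
  then have less: "Linf_norm f < ennreal (norm (f z))" by simp
  obtain b where b: "Linf_norm f = ennreal b" "0 \<le> b"
    using less by (cases "Linf_norm f") auto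
  define U where "U = {x. b < norm (f x)}"
  have "open U"
    unfolding U_def using f by (intro open_Collect_less continuous_intros)
  moreover have "z \<in> U"
    using less b by (simp add: U_def ennreal_less_iff)
  ultimately obtain e where e: "0 < e" "ball z e \<subseteq> U"
    by (auto simp: open_contains_ball)
  have "AE x in lebesgue. ennreal (norm (f x)) \<le> Linf_norm f"
    unfolding Linf_norm_def by (rule esssup_AE)
  then have "AE x in lborel. x \<notin> ball z e"
    unfolding AE_completion_iff
  proof eventually_elim
    case (elim x)
    then have "norm (f x) \<le> b" using b by simp
    then show ?case using e(2) by (auto simp: U_def)
  qed
  then have "emeasure lborel (ball z e) = 0"
    by (subst (asm) AE_iff_measurable[of "ball z e"]) (auto simp del: ball_eq_empty)
  then show False
    using e(1) content_ball_pos[of e z] by (simp add: measure_def)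
qed

lemma bounded_compact_support_Lp:
  fixes f :: "real \<times> (real ^ 'n) \<Rightarrow> complex"
  assumes f: "bounded_compact_support f" and p: "0 < p"
  shows "(\<integral>\<^sup>+z. ennreal (norm (f z) powr p) \<partial>lborel) < \<infinity>"
proof -
  obtain B R where [measurable]: "f \<in> borel_measurable borel" and B: "\<And>z. norm (f z) \<le> B"
    and R: "\<And>z. R < norm z \<Longrightarrow> f z = 0"
    by (rule bounded_compact_supportE[OF f]) (rule that)
  have "(\<integral>\<^sup>+z. ennreal (norm (f z) powr p) \<partial>lborel) \<le> (\<integral>\<^sup>+z. ennreal (B powr p) * indicator (cball (0 :: real \<times> (real ^ 'n)) R) z \<partial>lborel)"
  proof (rule nn_integral_mono)
    fix z
    show "ennreal (norm (f z) powr p) \<le> ennreal (B powr p) * indicator (cball 0 R) z"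
      using R[of z] B[of z] p by (cases "norm z \<le> R") (auto intro!: ennreal_leI powr_mono2)
  qed
  also have "\<dots> = ennreal (B powr p) * emeasure lborel (cball (0 :: real \<times> (real ^ 'n)) R)"
    by (rule nn_integral_cmult_indicator) simp
  also have "\<dots> < \<infinity>"
    using emeasure_lborel_cball_finite[of "0 :: real \<times> (real ^ 'n)" R] by (simp add: ennreal_mult_less_top)
  finally show ?thesis .
qed

context causal_kernel_estimates
begin

lemma kernel_op_BMO_norm:
  fixes f u :: "real \<times> (real ^ 'n) \<Rightarrow> complex"
  assumes f: "f \<in> test_functions" and u: "AE z in lborel. u z = kernel_op f z"
  shows "BMO_norm \<gamma> u \<le> ennreal (2 * bmo_const) * Linf_norm f"
proof -
  note reg = regular_test_function[OF f]
  have fm: "f \<in> borel_measurable borel" using reg by (simp add: regular_def)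
  note [measurable] = kernel_op_borel_measurable[OF fm]
  obtain B where B: "\<And>t x. t \<notin> N \<Longrightarrow> norm (kernel_op f (t, x)) \<le> B"
    by (rule kernel_op_bounded[OF reg]) (rule that)
  have opB: "AE z in lborel. norm (kernel_op f z) \<le> B"
    using AE_fst_not_N by eventually_elim (metis B prod.collapse)
  have int: "integrable lborel (\<lambda>z. indicator C z *\<^sub>R kernel_op f z)" if [measurable]: "C \<in> sets borel" and "emeasure lborel C < \<infinity>" for C
  proof (rule integrableI_bounded_set[where A=C and B=B])
    show "AE z in lborel. z \<in> C \<longrightarrow> norm (indicator C z *\<^sub>R kernel_op f z) \<le> B"
      using opB by eventually_elim simp
  qed (use that in auto)
  have loc: "locally_integrable u"
    unfolding locally_integrable_def set_integrable_def
  proof (intro allI impI)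
    fix C :: "(real \<times> (real ^ 'n)) set" assume C: "compact C"
    have [measurable]: "C \<in> sets borel" using C by (simp add: borel_compact)
    have "AE z in lborel. indicator C z *\<^sub>R u z = indicator C z *\<^sub>R kernel_op f z"
      using u by eventually_elim simp
    from integrable_lebesgue_AE[OF _ this] int[of C]
    show "integrable lebesgue (\<lambda>z. indicator C z *\<^sub>R u z)"
      using emeasure_compact_finite[OF C] by simp
  qed
  have osc: "mean_oscillation (cylinder \<gamma> c t x) u \<le> ennreal (2 * bmo_const) * Linf_norm f" if c: "0 < c" for c t x
  proof (cases "Linf_norm f")
    case top
    then show ?thesis using bmo_const_pos by (simp add: ennreal_mult_eq_top_iff ennreal_mult_top)
  next
    case (real b)
    have fb: "norm (f z) \<le> b" for z
      using continuous_norm_le_Linf_norm[OF test_function_continuous[OF f], of z] real by simp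
    have ex: "\<exists>\<kappa>. (\<integral>\<^sup>+z\<in>cylinder \<gamma> c t x. ennreal (norm (kernel_op f z - \<kappa>)) \<partial>lborel)
        \<le> ennreal (bmo_const * b) * emeasure lborel (cylinder \<gamma> c t x)"
    \<comment> \<open>\<open>kernel_op_oscillation\<close> divides by its bound, so the zero input
      is treated separately.\<close>
    proof (cases "b = 0")
      case True
      then have "f z = 0" for z using fb[of z] by simp
      then have "kernel_op f z = 0" for z by (cases z) (simp add: kernel_op_def)
      then show ?thesis by (intro exI[of _ 0]) simp
    next
      case False
      then show ?thesis using real by (intro kernel_op_oscillation[OF reg fb _ c]) simp
    qed
    then obtain \<kappa> where \<kappa>: "(\<integral>\<^sup>+z\<in>cylinder \<gamma> c t x. ennreal (norm (kernel_op f z - \<kappa>)) \<partial>lborel)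
        \<le> ennreal (bmo_const * b) * emeasure lborel (cylinder \<gamma> c t x)" by blast
    have "mean_oscillation (cylinder \<gamma> c t x) u \<le> ennreal (2 * (bmo_const * b))"
    proof (rule mean_oscillation_le[OF _ _ _ _ u _ \<kappa>])
      show "cylinder \<gamma> c t x \<in> sets borel" by (rule borel_open[OF open_cylinder])
      then show "set_integrable lborel (cylinder \<gamma> c t x) (kernel_op f)"
        unfolding set_integrable_def using c by (intro int) (simp_all add: emeasure_cylinder)
      show "emeasure lborel (cylinder \<gamma> c t x) \<noteq> 0" "emeasure lborel (cylinder \<gamma> c t x) < \<infinity>"
        using c by (simp_all add: emeasure_cylinder ennreal_eq_0_iff not_le)
      show "0 \<le> bmo_const * b" using bmo_const_pos real by simp
    qed measurable
    also have "\<dots> = ennreal (2 * bmo_const) * Linf_norm f"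
      using real bmo_const_pos by (simp add: ennreal_mult[symmetric] mult.assoc)
    finally show ?thesis .
  qed
  show ?thesis
    unfolding BMO_norm_def using loc osc by (auto intro!: SUP_least)
qed

lemma kernel_op_Lp_norm:
  fixes f u :: "real \<times> (real ^ 'n) \<Rightarrow> complex"
  assumes f: "f \<in> test_functions" and u: "AE z in lborel. u z = kernel_op f z" and p: "2 \<le> p" and S: "0 \<le> strong_const p"
  shows "Lp_norm p u \<le> ennreal (strong_const p powr (1 / p)) * Lp_norm p f"
proof -
  note reg = regular_test_function[OF f] and bcs = test_function_bounded_compact_support[OF f]
  have fm: "f \<in> borel_measurable borel" using reg by (simp add: regular_def)
  have um: "u \<in> borel_measurable lebesgue"
    by (rule borel_measurable_lebesgue_AE[OF kernel_op_borel_measurable[OF fm] u])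
  have fml: "f \<in> borel_measurable lebesgue"
    using fm by (intro measurable_completion) simp
  obtain a where a: "(\<integral>\<^sup>+z. ennreal (norm (f z) powr p) \<partial>lborel) = ennreal a" "0 \<le> a"
    using bounded_compact_support_Lp[OF bcs, of p] p
    by (cases "\<integral>\<^sup>+z. ennreal (norm (f z) powr p) \<partial>lborel") auto
  have "(\<integral>\<^sup>+z. ennreal (norm (u z) powr p) \<partial>lebesgue) = (\<integral>\<^sup>+z. ennreal (norm (u z) powr p) \<partial>lborel)"
    by (rule nn_integral_completion)
  also have "\<dots> = (\<integral>\<^sup>+z. ennreal (norm (kernel_op f z) powr p) \<partial>lborel)"
    using u by (intro nn_integral_cong_AE) (erule eventually_mono, simp)
  also have "\<dots> \<le> ennreal (strong_const p) * (\<integral>\<^sup>+z. ennreal (norm (f z) powr p) \<partial>lborel)"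
    by (rule kernel_op_Lp[OF bcs reg p])
  also have "\<dots> = ennreal (strong_const p * a)"
    using a S by (simp add: ennreal_mult)
  finally have le: "(\<integral>\<^sup>+z. ennreal (norm (u z) powr p) \<partial>lebesgue) \<le> ennreal (strong_const p * a)" .
  \<comment> \<open>Finiteness, together with measurability, rules out the default value \<infinity>
    of \<open>Lp_norm\<close>.\<close>
  then obtain b where b: "(\<integral>\<^sup>+z. ennreal (norm (u z) powr p) \<partial>lebesgue) = ennreal b" "0 \<le> b"
    by (cases "\<integral>\<^sup>+z. ennreal (norm (u z) powr p) \<partial>lebesgue") (auto simp: top_unique)
  have ba: "b \<le> strong_const p * a"
    using le S a b by (simp add: ennreal_le_iff)
  have "Lp_norm p u = ennreal (b powr (1 / p))"
    using um b by (simp add: Lp_norm_def)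
  also have "\<dots> \<le> ennreal ((strong_const p * a) powr (1 / p))"
    using ba b p by (intro ennreal_leI powr_mono2) auto
  also have "\<dots> = ennreal (strong_const p powr (1 / p)) * ennreal (a powr (1 / p))"
    using S a by (simp add: powr_mult ennreal_mult)
  also have "ennreal (a powr (1 / p)) = Lp_norm p f"
    using fml a by (simp add: Lp_norm_def nn_integral_completion)
  finally show ?thesis .
qed

end

lemma lp_const_nonneg:
  assumes "2 < p" "0 \<le> A"
  shows "0 \<le> lp_const \<gamma> p n A"
  using assms cyl_ratio_nonneg[of \<gamma> n] by (simp add: lp_const_def Let_def)

theorem theorem2p4:
  fixes \<gamma> p :: real and \<phi> :: "real \<Rightarrow> real" and M :: ennreal
  assumes "\<gamma> > 0" and "p \<ge> 2" and "M < \<infinity>"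
  shows "\<exists>N\<ge>0. \<forall>(K :: real \<Rightarrow> real \<Rightarrow> real ^ 'n \<Rightarrow> complex) H.
           admissible_kernel K \<and> fourier_majorant H K \<and> majorant_bound H = M \<and> kernel_estimates \<gamma> \<phi> K \<longrightarrow>
           (\<forall>f\<in>test_functions.
              BMO_norm \<gamma> (kernel_operator K f) \<le> ennreal N * Linf_norm f \<and>
              Lp_norm p (kernel_operator K f) \<le> ennreal N * Lp_norm p f)"
proof -
  define m where "m = enn2real M"
  have m: "M = ennreal m" "0 \<le> m" using assms(3) by (simp_all add: m_def)
  \<comment> \<open>Copies of \<open>bmo_const\<close> and \<open>strong_const\<close> formed before
    any kernel is chosen; this is what makes the final constant uniform.\<close>
  define C where "C = 1 + m\<^sup>2 * (3 / 2 * 4 ^ CARD('n)) + (\<phi> 3 + 2 * \<phi> 2)"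
  define S where "S = (if p = 2 then m\<^sup>2 else lp_const \<gamma> p CARD('n) (m\<^sup>2 + C))"
  show ?thesis
  \<comment> \<open>No sign of \<phi> is known until a kernel is given, so \<open>max 0\<close>
    enforces nonnegativity; the inner maximum serves both inequalities at once.\<close>
  proof (intro exI[of _ "max 0 (max (2 * C) (S powr (1 / p)))"] conjI allI impI ballI)
    show "0 \<le> max 0 (max (2 * C) (S powr (1 / p)))" by simp
    fix K :: "real \<Rightarrow> real \<Rightarrow> real ^ 'n \<Rightarrow> complex" and H f
    assume hyp: "admissible_kernel K \<and> fourier_majorant H K \<and> majorant_bound H = M \<and> kernel_estimates \<gamma> \<phi> K"
      and f: "f \<in> (test_functions :: (real \<times> (real ^ 'n) \<Rightarrow> complex) set)"
    obtain K' H' N where cke: "causal_kernel_estimates K' H' N m \<gamma> \<phi>"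
      and eq: "\<And>f t x. f \<in> borel_measurable borel \<Longrightarrow> t \<notin> N \<Longrightarrow>
        kernel_operator K f (t, x) = (LINT s|lborel. LINT y|lborel. K' t s (x - y) * f (s, y))"
      by (rule borel_modification[of K H m \<gamma> \<phi>]) (use hyp m assms(1) in auto)
    interpret causal_kernel_estimates K' H' N m \<gamma> \<phi> by (rule cke)
    have C_eq: "bmo_const = C" by (simp add: bmo_const_def C_def)
    have S_eq: "strong_const p = S" by (simp add: strong_const_def S_def C_eq)
    have fm: "f \<in> borel_measurable borel"
      using regular_test_function[OF f] by (simp add: regular_def)
    have ae: "AE z in lborel. kernel_operator K f z = kernel_op f z"
      using AE_fst_not_N
    proof eventually_elim
      case (elim z)
      then show ?case using eq[OF fm, of "fst z" "snd z"] by (simp add: kernel_op_def case_prod_beta)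
    qed
    have "0 \<le> S"
    proof (cases "p = 2")
      case False
      then show ?thesis
        using assms(2) bmo_const_pos unfolding S_def C_eq by (auto intro!: lp_const_nonneg)
    qed (simp add: S_def)
    show "BMO_norm \<gamma> (kernel_operator K f) \<le> ennreal (max 0 (max (2 * C) (S powr (1 / p)))) * Linf_norm f"
    proof (rule order.trans[OF kernel_op_BMO_norm[OF f ae, unfolded C_eq] mult_right_mono])
      show "ennreal (2 * C) \<le> ennreal (max 0 (max (2 * C) (S powr (1 / p))))"
        by (rule ennreal_leI) linarith
    qed simp
    show "Lp_norm p (kernel_operator K f) \<le> ennreal (max 0 (max (2 * C) (S powr (1 / p)))) * Lp_norm p f"
    proof (rule order.trans[OF kernel_op_Lp_norm[OF f ae assms(2), unfolded S_eq] mult_right_mono])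
      show "ennreal (S powr (1 / p)) \<le> ennreal (max 0 (max (2 * C) (S powr (1 / p))))"
        by (rule ennreal_leI) linarith
    qed (use \<open>0 \<le> S\<close> in simp_all)
  qed
qed

end
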